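(* Let $M$ be a closed surface in $\mathrm{Nil}$ obtained by revolving a curve $\gamma\subset B=\mathrm{Nil}/SO(2)$ around the $z$-axis. Let $s$ be the arc length parameter on $\gamma$, $\gamma(s)=(u(s),v(s))$, let $\sigma$ be the angle between $\gamma$ and the direction $\partial/\partial u$, and let the dot denote $d/ds$. Then the spinor energy of $M$ equals $$E(M)=\frac14\int_M\Big(H^2-\frac14 n_3^2\Big)d\mu =\frac{\pi}{16}\int_\gamma\Big(\dot\sigma-\frac{\sin\sigma}{u}\Big)^2\sqrt{4u^2+u^4}\,ds-\frac{\pi}{4}\int_\gamma\frac{d}{ds}\big[\dot u\sqrt{4+u^2}\big]\,ds$$ $$=\frac{\pi}{16}\int_\gamma\Big(\dot\sigma-\frac{\sin\sigma}{u}\Big)^2\sqrt{4u^2+u^4}\,ds+\frac{\pi\,\chi(M)}{2},$$ where $\chi(M)$ is the Euler characteristic of $M$. Moreover, if $\dot\sigma=\frac{\sin\sigma}{u}$ everywhere on the surface, then $M$ is a constant mean curvature sphere.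
   Context: $\mathrm{Nil}$ is the three-dimensional Heisenberg group of real upper triangular matrices $\begin{pmatrix}1&x&z\\0&1&y\\0&0&1\end{pmatrix}$ with the left-invariant Riemannian metric $ds^2=dx^2+dy^2+(dz-x\,dy)^2$. Let $e_1,e_2,e_3$ be the left-invariant orthonormal frame which at the identity equals $\partial_x,\partial_y,\partial_z$. Cylindrical coordinates $(\rho,\phi,h)$ on $\mathrm{Nil}$ are given by $x=\rho\cos\phi$, $y=\rho\sin\phi$, $z=\frac{\rho^2}{2}\cos\phi\sin\phi+h$; in them the metric is $d\rho^2-\rho^2\,dh\,d\phi+\frac14\rho^2(4+\rho^2)d\phi^2+dh^2$, so the rotations $\phi\mapsto\phi+\theta$ around the $z$-axis are isometries and define an $SO(2)$-action. The quotient $B=\mathrm{Nil}/SO(2)$ is the half-plane $\{u\ge 0\}$ with coordinates $u=\rho$, $v=h$ and the quotient metric $du^2+\frac{4u^2}{4u^2+u^4}dv^2$. Arc length and angle on $\gamma$ are taken with respect to this metric, so that $\dot u=\cos\sigma$, $\dot v=(2u)^{-1}\sqrt{4u^2+u^4}\,\sin\sigma$. The surface obtained by revolving $\gamma$ is the preimage of $\gamma$ under $\mathrm{Nil}\to B$; it is assumed to be a smooth connected closed surface (compact without boundary), generated by a smooth curve $\gamma$: thus $\gamma$ is either a closed curve in $\{u>0\}$ or an arc whose endpoints lie on $\{u=0\}$ and whose interior lies in $\{u>0\}$. For an oriented surface in $\mathrm{Nil}$ with unit normal $n$: $n_3=\langle n,e_3\rangle$, $H$ is the mean curvature (half the sum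 of the principal curvatures), $d\mu$ is the induced area measure, and for a closed oriented surface $M$ the spinor energy is $E(M)=\frac14\int_M\big(H^2-\frac{n_3^2}{4}\big)d\mu$. *)

theory Defs
  imports "HOL-Analysis.Analysis" "HOL-Homology.Homology"
begin

fun Ck_on :: "nat \<Rightarrow> 'a::euclidean_space set \<Rightarrow> ('a \<Rightarrow> 'b::real_normed_vector) \<Rightarrow> bool" where
  "Ck_on 0 U f \<longleftrightarrow> continuous_on U f"
| "Ck_on (Suc k) U f \<longleftrightarrow> (\<forall>x\<in>U. f differentiable (at x)) \<and>
     (\<forall>b\<in>Basis. Ck_on k U (\<lambda>x. frechet_derivative f (at x) b))"

text \<open>Only used for open \<open>U\<close>.\<close>

definition smooth_on :: "'a::euclidean_space set \<Rightarrow> ('a \<Rightarrow> 'b::real_normed_vector) \<Rightarrow> bool" where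
  "smooth_on U f \<longleftrightarrow> (\<forall>k. Ck_on k U f)"

text \<open>Smoothness of a map on an arbitrary subset of Euclidean space: local smooth extensions exist.\<close>

definition smooth_along :: "'a::euclidean_space set \<Rightarrow> ('a \<Rightarrow> 'b::real_normed_vector) \<Rightarrow> bool" where
  "smooth_along M f \<longleftrightarrow> (\<forall>p\<in>M. \<exists>W F. open W \<and> p \<in> W \<and> smooth_on W F \<and> (\<forall>q\<in>M \<inter> W. f q = F q))"

text \<open>Smooth functions of one real variable on an interval, with one-sided derivatives of all
  orders at those endpoints that belong to the interval.\<close>

definition smooth_interval :: "real set \<Rightarrow> (real \<Rightarrow> real) \<Rightarrow> bool" where
  "smooth_interval I f \<longleftrightarrow> (\<exists>D :: nat \<Rightarrow> real \<Rightarrow> real. D 0 = f \<and>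
     (\<forall>k. \<forall>s\<in>I. (D k has_real_derivative D (Suc k) s) (at s within I)))"

text \<open>A point \<open>(x, y, z)\<close> of \<open>real^3\<close> stands for the unipotent upper triangular matrix with
  entries \<open>x\<close> and \<open>y\<close> above the diagonal and \<open>z\<close> in the corner; \<open>nil_mult\<close> is the matrix product.
  Tangent vectors at any point are written in the coordinate basis.\<close>

type_synonym nil = "real^3"

definition nil_mult :: "nil \<Rightarrow> nil \<Rightarrow> nil" where
  "nil_mult p q = vector [p$1 + q$1, p$2 + q$2, p$3 + q$3 + p$1 * q$2]"

text \<open>\<open>dx^2 + dy^2 + (dz - x dy)^2\<close>\<close>

definition nil_inner :: "nil \<Rightarrow> real^3 \<Rightarrow> real^3 \<Rightarrow> real" where
  "nil_inner p a b = a$1 * b$1 + a$2 * b$2 + (a$3 - p$1 * a$2) * (b$3 - p$1 * b$2)"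

text \<open>The left-invariant frame that is the coordinate frame at the identity.\<close>

definition nil_frame :: "3 \<Rightarrow> nil \<Rightarrow> real^3" where
  "nil_frame i p = frechet_derivative (nil_mult p) (at 0) (axis i 1)"

definition nil_metric :: "nil \<Rightarrow> real^3^3" where
  "nil_metric p = (\<chi> i j. nil_inner p (axis i 1) (axis j 1))"

text \<open>\<open>christoffel p k i j\<close> is the Christoffel symbol with upper index \<open>k\<close> of the
  Levi-Civita connection.\<close>

definition partial :: "3 \<Rightarrow> (nil \<Rightarrow> real) \<Rightarrow> nil \<Rightarrow> real" where
  "partial i f p = frechet_derivative f (at p) (axis i 1)"

definition christoffel :: "nil \<Rightarrow> 3 \<Rightarrow> 3 \<Rightarrow> 3 \<Rightarrow> real" where
  "christoffel p k i j = 1/2 * (\<Sum>l\<in>UNIV. matrix_inv (nil_metric p) $ k $ l *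
     (partial i (\<lambda>q. nil_metric q $ j $ l) p + partial j (\<lambda>q. nil_metric q $ i $ l) p
      - partial l (\<lambda>q. nil_metric q $ i $ j) p))"

definition connection_form :: "nil \<Rightarrow> real^3 \<Rightarrow> real^3 \<Rightarrow> real^3" where
  "connection_form p a b = (\<chi> k. \<Sum>i\<in>UNIV. \<Sum>j\<in>UNIV. christoffel p k i j * a$i * b$j)"

definition local_param :: "nil set \<Rightarrow> (real^2) set \<Rightarrow> (real^2 \<Rightarrow> nil) \<Rightarrow> bool" where
  "local_param M U \<phi> \<longleftrightarrow> open U \<and> smooth_on U \<phi> \<and>
     (\<forall>x\<in>U. inj (frechet_derivative \<phi> (at x))) \<and>
     openin (top_of_set M) (\<phi> ` U) \<and> (\<exists>\<psi>. homeomorphism U (\<phi> ` U) \<phi> \<psi>)"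

definition smooth_surface :: "nil set \<Rightarrow> bool" where
  "smooth_surface M \<longleftrightarrow> (\<forall>p\<in>M. \<exists>U \<phi>. local_param M U \<phi> \<and> p \<in> \<phi> ` U)"

definition closed_surface :: "nil set \<Rightarrow> bool" where
  "closed_surface M \<longleftrightarrow> smooth_surface M \<and> compact M \<and> connected M"

definition tangent_plane :: "nil set \<Rightarrow> nil \<Rightarrow> (real^3) set" where
  "tangent_plane M p = {frechet_derivative \<phi> (at x) a | \<phi> U x a. local_param M U \<phi> \<and> x \<in> U \<and> \<phi> x = p}"

definition unit_normal_field :: "nil set \<Rightarrow> (nil \<Rightarrow> real^3) \<Rightarrow> bool" where
  "unit_normal_field M n \<longleftrightarrow> smooth_along M n \<and>
     (\<forall>p\<in>M. nil_inner p (n p) (n p) = 1 \<and> (\<forall>a\<in>tangent_plane M p. nil_inner p (n p) a = 0))"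

text \<open>The shape operator is \<open>a \<mapsto> - \<nabla>\<^sub>a n\<close>, applied to tangent vectors \<open>a\<close> of \<open>M\<close> only. The derivative
  within \<open>M\<close> is not unique as a linear map on \<open>real^3\<close>, but its values on \<open>tangent_plane M p\<close> are.\<close>

definition shape_operator :: "nil set \<Rightarrow> (nil \<Rightarrow> real^3) \<Rightarrow> nil \<Rightarrow> real^3 \<Rightarrow> real^3" where
  "shape_operator M n p a = - (frechet_derivative n (at p within M) a + connection_form p a (n p))"

definition principal_curvatures :: "nil set \<Rightarrow> (nil \<Rightarrow> real^3) \<Rightarrow> nil \<Rightarrow> real \<Rightarrow> real \<Rightarrow> bool" where
  "principal_curvatures M n p k1 k2 \<longleftrightarrow> (\<exists>t1\<in>tangent_plane M p. \<exists>t2\<in>tangent_plane M p.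
     nil_inner p t1 t1 = 1 \<and> nil_inner p t2 t2 = 1 \<and> nil_inner p t1 t2 = 0 \<and>
     shape_operator M n p t1 = k1 *\<^sub>R t1 \<and> shape_operator M n p t2 = k2 *\<^sub>R t2)"

definition mean_curvature :: "nil set \<Rightarrow> (nil \<Rightarrow> real^3) \<Rightarrow> nil \<Rightarrow> real" where
  "mean_curvature M n p = (THE h. \<exists>k1 k2. principal_curvatures M n p k1 k2 \<and> h = (k1 + k2) / 2)"

definition gram :: "(real^2 \<Rightarrow> nil) \<Rightarrow> real^2 \<Rightarrow> real^2^2" where
  "gram \<phi> x = (\<chi> i j. nil_inner (\<phi> x) (frechet_derivative \<phi> (at x) (axis i 1))
                                      (frechet_derivative \<phi> (at x) (axis j 1)))"

text \<open>The induced area measure on the Borel sets of \<open>M\<close>. On a smooth surface with countable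
  topology exactly one measure satisfies this, since the countably many images of charts
  covering \<open>M\<close> carry compatible densities.\<close>

definition area_measure :: "nil set \<Rightarrow> nil measure \<Rightarrow> bool" where
  "area_measure M \<mu> \<longleftrightarrow> space \<mu> = M \<and> sets \<mu> = sets (restrict_space borel M) \<and>
     (\<forall>U \<phi> A. local_param M U \<phi> \<and> A \<in> sets borel \<and> A \<subseteq> U \<longrightarrow>
        emeasure \<mu> (\<phi> ` A) = (\<integral>\<^sup>+x\<in>A. ennreal (sqrt (det (gram \<phi> x))) \<partial>lborel))"

definition spinor_density :: "nil set \<Rightarrow> (nil \<Rightarrow> real^3) \<Rightarrow> nil \<Rightarrow> real" where
  "spinor_density M n p = (mean_curvature M n p)\<^sup>2 - (nil_inner p (n p) (nil_frame 3 p))\<^sup>2 / 4"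

definition spinor_energy :: "nil set \<Rightarrow> (nil \<Rightarrow> real^3) \<Rightarrow> nil measure \<Rightarrow> real" where
  "spinor_energy M n \<mu> = 1/4 * (LINT p|\<mu>. spinor_density M n p)"

text \<open>Rank of a commutative group, written multiplicatively: the largest number of elements
  that are independent over the integers (meaningful when the rank is finite).\<close>

definition group_rank :: "('a, 'b) monoid_scheme \<Rightarrow> nat" where
  "group_rank G = Sup {card S | S. finite S \<and> S \<subseteq> carrier G \<and>
     (\<forall>c :: 'a \<Rightarrow> int. finprod G (\<lambda>x. x [^]\<^bsub>G\<^esub> c x) S = \<one>\<^bsub>G\<^esub> \<longrightarrow> (\<forall>x\<in>S. c x = 0))}"

definition betti :: "nat \<Rightarrow> 'a topology \<Rightarrow> nat" where
  "betti p X = group_rank (homology_group (int p) X)"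

definition euler_char :: "'a topology \<Rightarrow> int" where
  "euler_char X = (\<Sum>p | betti p X \<noteq> 0. (-1) ^ p * int (betti p X))"

definition cylindrical :: "real \<Rightarrow> real \<Rightarrow> real \<Rightarrow> nil" where
  "cylindrical \<rho> \<phi> h = vector [\<rho> * cos \<phi>, \<rho> * sin \<phi>, \<rho>\<^sup>2 / 2 * cos \<phi> * sin \<phi> + h]"

text \<open>The quotient map onto the half-plane of orbits, in the coordinates \<open>u = \<rho>\<close>, \<open>v = h\<close>.\<close>

definition orbit_map :: "nil \<Rightarrow> real \<times> real" where
  "orbit_map p = (sqrt ((p$1)\<^sup>2 + (p$2)\<^sup>2), p$3 - p$1 * p$2 / 2)"

lemma orbit_map_cylindrical:
  assumes "0 \<le> \<rho>"
  shows "orbit_map (cylindrical \<rho> \<phi> h) = (\<rho>, h)"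
proof -
  have "(\<rho> * cos \<phi>)\<^sup>2 + (\<rho> * sin \<phi>)\<^sup>2 = \<rho>\<^sup>2 * ((cos \<phi>)\<^sup>2 + (sin \<phi>)\<^sup>2)"
    by (simp only: power_mult_distrib distrib_left)
  then have "(\<rho> * cos \<phi>)\<^sup>2 + (\<rho> * sin \<phi>)\<^sup>2 = \<rho>\<^sup>2" by simp
  with assms show ?thesis
    by (simp add: orbit_map_def cylindrical_def vector_3 power2_eq_square)
qed

text \<open>The first alternative is a simple closed curve in \<open>u > 0\<close>, given by \<open>L\<close>-periodic functions on
  the whole line; the second a simple arc on \<open>{0..L}\<close> with exactly its endpoints on the axis.\<close>

definition closed_profile :: "real \<Rightarrow> (real \<Rightarrow> real) \<Rightarrow> (real \<Rightarrow> real) \<Rightarrow> bool" where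
  "closed_profile L u v \<longleftrightarrow> 0 < L \<and> smooth_interval UNIV u \<and> smooth_interval UNIV v \<and>
     (\<forall>s. u (s + L) = u s \<and> v (s + L) = v s) \<and> (\<forall>s. 0 < u s) \<and>
     inj_on (\<lambda>s. (u s, v s)) {0..<L}"

definition arc_profile :: "real \<Rightarrow> (real \<Rightarrow> real) \<Rightarrow> (real \<Rightarrow> real) \<Rightarrow> bool" where
  "arc_profile L u v \<longleftrightarrow> 0 < L \<and> smooth_interval {0..L} u \<and> smooth_interval {0..L} v \<and>
     u 0 = 0 \<and> u L = 0 \<and> (\<forall>s. 0 < s \<and> s < L \<longrightarrow> 0 < u s) \<and>
     inj_on (\<lambda>s. (u s, v s)) {0..L}"

text \<open>The parameter is arc length and \<open>\<sigma>\<close> the angle to the \<open>u\<close>-direction with respect to the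
  quotient metric \<open>du^2 + 4 u^2 / (4 u^2 + u^4) dv^2\<close>. The coefficient is written as
  \<open>4 / (4 + u^2)\<close>, its smooth extension to \<open>u = 0\<close>, because division by zero would give \<open>0\<close> there.\<close>

definition arc_length_angle ::
    "real set \<Rightarrow> (real \<Rightarrow> real) \<Rightarrow> (real \<Rightarrow> real) \<Rightarrow> (real \<Rightarrow> real) \<Rightarrow> bool" where
  "arc_length_angle I u v \<sigma> \<longleftrightarrow> smooth_interval I \<sigma> \<and>
     (\<forall>s\<in>I. (u has_real_derivative cos (\<sigma> s)) (at s within I) \<and>
            (v has_real_derivative sqrt (4 + (u s)\<^sup>2) / 2 * sin (\<sigma> s)) (at s within I))"

definition profile_curve ::
    "real \<Rightarrow> (real \<Rightarrow> real) \<Rightarrow> (real \<Rightarrow> real) \<Rightarrow> (real \<Rightarrow> real) \<Rightarrow> bool" where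
  "profile_curve L u v \<sigma> \<longleftrightarrow>
     closed_profile L u v \<and> arc_length_angle UNIV u v \<sigma> \<or>
     arc_profile L u v \<and> arc_length_angle {0..L} u v \<sigma>"

definition revolution :: "(real \<times> real) set \<Rightarrow> nil set" where
  "revolution \<Gamma> = orbit_map -` \<Gamma>"

text \<open>The two integrands along the curve. At the endpoints of an arc their values are irrelevant.\<close>

definition bending_density :: "(real \<Rightarrow> real) \<Rightarrow> (real \<Rightarrow> real) \<Rightarrow> real \<Rightarrow> real" where
  "bending_density u \<sigma> s =
     (deriv \<sigma> s - sin (\<sigma> s) / u s)\<^sup>2 * sqrt (4 * (u s)\<^sup>2 + (u s) ^ 4)"

definition boundary_density :: "(real \<Rightarrow> real) \<Rightarrow> real \<Rightarrow> real" where
  "boundary_density u s = deriv (\<lambda>t. deriv u t * sqrt (4 + (u t)\<^sup>2)) s"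

end

theory Submission
  imports Defs
begin

text \<open>
  Write \<open>q = sqrt (4 + u\<^sup>2)\<close>. At the point over \<open>(u, v)\<close> with angle \<open>\<theta>\<close>, rotate the left-invariant
  vectors \<open>e\<^sub>1, e\<^sub>2\<close> by \<open>\<theta>\<close>. In this orthonormal frame nothing depends on \<open>\<theta>\<close> any more: the meridian
  has velocity \<open>(cos \<sigma>, 0, q sin \<sigma> / 2)\<close>, the orbit of the rotations has velocity
  \<open>(0, u, - u\<^sup>2 / 2)\<close>, so the area element is \<open>u q / 2 ds d\<theta>\<close> and the unit normal is, up to sign,
  \<open>(- sin \<sigma>, u cos \<sigma> / q, 2 cos \<sigma> / q)\<close>. Differentiating the normal along both curves gives
  \<open>H = \<plusminus> (\<sigma>' + sin \<sigma> / u) / 2\<close>, and \<open>n\<^sub>3\<^sup>2 = 4 (cos \<sigma>)\<^sup>2 / q\<^sup>2\<close> is read off the last component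
  (\<open>mean_curvature_interior\<close>, \<open>spinor_density_interior\<close>).

  The energy formula is then the pointwise identity
  \<open>(H\<^sup>2 - n\<^sub>3\<^sup>2 / 4) u q / 2 = (\<sigma>' - sin \<sigma> / u)\<^sup>2 u q / 8 - (cos \<sigma> q)' / 2\<close>, integrated over \<open>\<theta>\<close> and \<open>s\<close>
  (\<open>spinor_energy_formula\<close>). It rests on
  \<open>(\<sigma>' + sin \<sigma> / u)\<^sup>2 = (\<sigma>' - sin \<sigma> / u)\<^sup>2 + 4 \<sigma>' sin \<sigma> / u\<close>, whose last summand is, up to the term
  with \<open>n\<^sub>3\<close>, a total derivative.

  The boundary term counts the Euler characteristic. For a closed profile \<open>cos \<sigma> q\<close> is periodic, the
  integral of its derivative is \<open>0\<close>, and the surface is a torus. For an arc the normal is continuous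
  at the poles, where all meridians meet; as its horizontal part turns with \<open>\<theta>\<close>, it must vanish,
  so \<open>sin \<sigma> = 0\<close> (\<open>normal_at_pole\<close>). Since \<open>u \<ge> 0\<close>, this leaves \<open>cos \<sigma> = 1\<close> at the start and
  \<open>cos \<sigma> = - 1\<close> at the end; there \<open>q = 2\<close>, the integral is \<open>- 4\<close>, and the surface is a sphere. The
  homology of the torus comes from a splitting of the homology of \<open>X \<times> circle\<close>
  (\<open>homology_Times_circle\<close>).

  If \<open>\<sigma>' = sin \<sigma> / u\<close>, then \<open>sin \<sigma> / u\<close> has derivative \<open>0\<close> and is a constant \<open>k\<close>, which is \<open>\<plusminus> H\<close>.
  On a closed profile \<open>v\<close> returns to its initial value, so \<open>sin \<sigma>\<close> has a zero and \<open>k = 0\<close>; but \<open>u\<close>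
  returns as well, so \<open>cos \<sigma>\<close> has a zero too, which is absurd. Hence the surface is a sphere, and the
  mean curvature at the poles, \<open>\<plusminus> \<sigma>'\<close>, is the same constant by continuity.
\<close>

section \<open>Homology of a product with a circle\<close>

abbreviation circle :: "complex set" where "circle \<equiv> sphere 0 1"

text \<open>The map \<open>h\<close> pulls \<open>J\<close> into \<open>K\<close> and keeps \<open>K\<close> inside itself, so \<open>id \<times> h\<close> deforms the identity of
  \<open>X \<times> J\<close>, as a map of pairs, into one with image in \<open>X \<times> K\<close>. Points of \<open>K\<close> may move within \<open>K\<close>, as
  they do when an arc shrinks towards one of its points.\<close>

lemma trivial_relative_homology_Times_deformation:
  fixes X :: "'a::topological_space set" and J K :: "'b::topological_space set"
  assumes h: "continuous_on ({0..1} \<times> J) h" and hJ: "\<And>t w. t \<in> {0..1} \<Longrightarrow> w \<in> J \<Longrightarrow> h (t, w) \<in> J"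
    and h0: "\<And>w. w \<in> J \<Longrightarrow> h (0::real, w) \<in> K" and h1: "\<And>w. w \<in> J \<Longrightarrow> h (1, w) = w"
    and hK: "\<And>t w. t \<in> {0..1} \<Longrightarrow> w \<in> K \<Longrightarrow> h (t, w) \<in> K" and "K \<subseteq> J"
  shows "trivial_group (relative_homology_group p (top_of_set (X \<times> J)) (X \<times> K))"
proof (rule trivial_relative_homology_group_alt)
  have cont: "continuous_on ({0..1} \<times> X \<times> J) (\<lambda>(t, x, w). (x, h (t, w)))"
    unfolding case_prod_unfold
    by (intro continuous_on_Pair continuous_on_compose2[OF h] continuous_intros) auto
  show "continuous_map (top_of_set (X \<times> J)) (subtopology (top_of_set (X \<times> J)) (X \<times> K))
      (\<lambda>(x, w). (x, h (0, w)))"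
  proof -
    have "continuous_on (X \<times> J) (\<lambda>(x, w). (x, h (0, w)))"
      unfolding case_prod_unfold
      by (intro continuous_on_Pair continuous_on_compose2[OF h] continuous_intros) auto
    then show ?thesis
      using h0 \<open>K \<subseteq> J\<close> by (auto simp: continuous_map_in_subtopology hJ)
  qed
  show "homotopic_with (\<lambda>k. k ` (X \<times> K) \<subseteq> X \<times> K) (top_of_set (X \<times> J)) (top_of_set (X \<times> J))
      (\<lambda>(x, w). (x, h (0, w))) id"
  proof (subst homotopic_with)
    show "(k ` (X \<times> K) \<subseteq> X \<times> K) = (k' ` (X \<times> K) \<subseteq> X \<times> K)"
      if "\<And>x. x \<in> topspace (top_of_set (X \<times> J)) \<Longrightarrow> k x = k' x" for k k'
    proof -
      have "k ` (X \<times> K) = k' ` (X \<times> K)"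
        using that \<open>K \<subseteq> J\<close> by (intro image_cong) auto
      then show ?thesis by simp
    qed
    show "\<exists>g. continuous_map (prod_topology (top_of_set {0..1::real}) (top_of_set (X \<times> J))) (top_of_set (X \<times> J)) g \<and>
        (\<forall>x\<in>topspace (top_of_set (X \<times> J)). g (0, x) = (case x of (x, w) \<Rightarrow> (x, h (0, w)))) \<and>
        (\<forall>x\<in>topspace (top_of_set (X \<times> J)). g (1, x) = id x) \<and>
        (\<forall>t\<in>{0..1}. (\<lambda>x. g (t, x)) ` (X \<times> K) \<subseteq> X \<times> K)"
    proof (intro exI conjI ballI)
      show "continuous_map (prod_topology (top_of_set {0..1::real}) (top_of_set (X \<times> J))) (top_of_set (X \<times> J))
          (\<lambda>(t, x, w). (x, h (t, w)))"
        unfolding prod_topology_subtopology_eu continuous_map_subtopology_eu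
        using cont hJ by (simp add: Pi_iff)
      fix t :: real assume t: "t \<in> {0..1}"
      show "(\<lambda>x. case (t, x) of (t, x, w) \<Rightarrow> (x, h (t, w))) ` (X \<times> K) \<subseteq> X \<times> K"
        using hK[OF t] by (simp add: image_subset_iff)
    qed (auto simp: h1)
  qed
qed

lemma homology_iso_of_trivial_relative_homology:
  assumes "\<And>p. trivial_group (relative_homology_group p Y S)"
  shows "homology_group p (subtopology Y S) \<cong> homology_group p Y"
proof (rule is_isoI, rule very_short_exact_sequence)
  show "exact_seq ([relative_homology_group p Y S, homology_group p Y, homology_group p (subtopology Y S),
      relative_homology_group (p + 1) Y S],
      [hom_induced p Y {} Y S id, hom_induced p (subtopology Y S) {} Y {} id, hom_boundary (p + 1) Y S])"
    using homology_exactness_axiom_3[of p Y S] homology_exactness_axiom_2[of "p + 1" Y S] by simp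
qed (use assms in auto)

lemma cis_Arg_circle: "w \<in> circle \<Longrightarrow> cis (Arg w) = w"
  by (metis cis_Arg mem_sphere_0 norm_zero sgn_eq zero_neq_one div_by_1 of_real_1)

lemma circle_not_nonpos_Reals: "w \<in> circle \<Longrightarrow> w \<in> \<real>\<^sub>\<le>\<^sub>0 \<longleftrightarrow> w = -1"
  by (auto simp: complex_nonpos_Reals_iff complex_eq_iff cmod_def power2_eq_1_iff)

lemma Arg_circle_bounds: "w \<in> circle \<Longrightarrow> w \<noteq> -1 \<Longrightarrow> - pi < Arg w \<and> Arg w < pi"
  by (metis Arg_bounded Arg_eq_pi circle_not_nonpos_Reals complex_nonpos_Reals_iff less_eq_real_def)

lemma continuous_on_Arg_circle: "continuous_on (circle - {-1}) Arg"
  by (rule continuous_on_subset[OF continuous_on_Arg]) (auto simp: circle_not_nonpos_Reals)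

lemma continuous_on_Arg_minus_circle: "continuous_on (circle - {1}) (\<lambda>w. Arg (- w))"
  by (rule continuous_on_compose2[OF continuous_on_Arg_circle]) (auto intro!: continuous_intros simp: minus_equation_iff)

lemma minus_cis_Arg_circle: "w \<in> circle \<Longrightarrow> - cis (Arg (- w)) = w"
  using cis_Arg_circle[of "- w"] by simp

lemma Arg_minus_circle_bounds:
  assumes "w \<in> circle" "w \<noteq> 1" shows "- pi < Arg (- w)" "Arg (- w) < pi"
  using Arg_circle_bounds[of "- w"] assms by (auto simp: minus_equation_iff)

lemma cis_neq_minus_one: "- pi < a \<Longrightarrow> a < pi \<Longrightarrow> cis a \<noteq> -1"
proof
  assume a: "- pi < a" "a < pi" "cis a = -1"
  then have "Arg (cis a) = a" by (intro Arg_cis) auto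
  then show False using a Arg_cis[of pi] by simp
qed

lemma Im_circle_Arg_minus:
  assumes "w \<in> circle" "w \<noteq> 1"
  shows "0 < Im w \<longleftrightarrow> Arg (- w) < 0" "Im w < 0 \<longleftrightarrow> 0 < Arg (- w)"
proof -
  have *: "Im w = - sin (Arg (- w))"
    using minus_cis_Arg_circle[OF assms(1)] by (metis cis.sel(2) uminus_complex.sel(2))
  note b = Arg_minus_circle_bounds[OF assms]
  have "Arg (- w) < 0 \<Longrightarrow> sin (Arg (- w)) < 0" using b sin_gt_zero[of "- Arg (- w)"] by simp
  moreover have "Arg (- w) > 0 \<Longrightarrow> sin (Arg (- w)) > 0" using b sin_gt_zero by simp
  moreover have "Arg (- w) = 0 \<Longrightarrow> sin (Arg (- w)) = 0" by simp
  ultimately show "0 < Im w \<longleftrightarrow> Arg (- w) < 0" "Im w < 0 \<longleftrightarrow> 0 < Arg (- w)"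
    unfolding * by (cases "Arg (- w)" "0 :: real" rule: linorder_cases; simp)+
qed

lemma trivial_relative_homology_Times_circle_point:
  "trivial_group (relative_homology_group p (top_of_set (X \<times> (circle - {-1}))) (X \<times> {1}))"
proof (rule trivial_relative_homology_Times_deformation[where h = "\<lambda>(t, w). cis (t * Arg w)"])
  show "continuous_on ({0..1} \<times> (circle - {- 1})) (\<lambda>(t, w). cis (t * Arg w))"
    unfolding case_prod_unfold
    by (intro continuous_intros continuous_on_cis continuous_on_compose2[OF continuous_on_Arg_circle]) auto
  show "(case (t, w) of (t, w) \<Rightarrow> cis (t * Arg w)) \<in> circle - {- 1}" if "t \<in> {0..1}" "w \<in> circle - {- 1}" for t w
  proof -
    have "\<bar>t * Arg w\<bar> \<le> 1 * \<bar>Arg w\<bar>"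
      using that unfolding abs_mult by (intro mult_right_mono) auto
    with Arg_circle_bounds[of w] that show ?thesis
      using cis_neq_minus_one[of "t * Arg w"] by (auto simp: abs_if split: if_splits)
  qed
qed (auto simp: cis_Arg_circle)

text \<open>Arcs that avoid \<open>1\<close> are described by \<open>Arg (- w)\<close>, which is continuous there; in this coordinate
  they are intervals, and contracting linearly towards \<open>c\<close> preserves every interval containing \<open>c\<close>.\<close>

lemma trivial_relative_homology_Times_circle_arc:
  assumes J: "J = {w \<in> circle - {1}. Arg (- w) \<in> I}" and K: "K = {w \<in> circle - {1}. Arg (- w) \<in> I'}"
    and "convex I" "convex I'" "I' \<subseteq> I" "I \<subseteq> {- pi<..<pi}" "c \<in> I'"
  shows "trivial_group (relative_homology_group p (top_of_set (X \<times> J)) (X \<times> K))"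
proof (rule trivial_relative_homology_Times_deformation[where h = "\<lambda>(t, w). - cis (t * Arg (- w) + (1 - t) * c)"])
  show "continuous_on ({0..1} \<times> J) (\<lambda>(t, w). - cis (t * Arg (- w) + (1 - t) * c))"
    unfolding case_prod_unfold
    by (intro continuous_intros continuous_on_cis continuous_on_compose2[OF continuous_on_Arg_minus_circle]) (auto simp: J)
  have step: "- cis (t * Arg (- w) + (1 - t) * c) \<in> {w \<in> circle - {1}. Arg (- w) \<in> C}"
    if "w \<in> {w \<in> circle - {1}. Arg (- w) \<in> C}" "t \<in> {0..1}" "convex C" "c \<in> C" "C \<subseteq> {- pi<..<pi}" for C t w
  proof -
    define a where "a = t * Arg (- w) + (1 - t) * c"
    have aC: "a \<in> C"
      using convexD_alt[OF \<open>convex C\<close> \<open>c \<in> C\<close>, of "Arg (- w)" t] that by (simp add: a_def add.commute)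
    with that have "- pi < a" "a < pi" by auto
    moreover from this have "Arg (cis a) = a" by (simp add: Arg_cis)
    ultimately show ?thesis using aC cis_neq_minus_one[of a] unfolding a_def[symmetric]
      by (simp add: minus_equation_iff)
  qed
  have "I' \<subseteq> {- pi<..<pi}" "c \<in> I" using assms by auto
  show "(case (t, w) of (t, w) \<Rightarrow> - cis (t * Arg (- w) + (1 - t) * c)) \<in> J" if "t \<in> {0..1}" "w \<in> J" for t w
    using step[of w I t] that assms \<open>c \<in> I\<close> by simp
  show "(case (t, w) of (t, w) \<Rightarrow> - cis (t * Arg (- w) + (1 - t) * c)) \<in> K" if "t \<in> {0..1}" "w \<in> K" for t w
    using step[of w I' t] that assms \<open>I' \<subseteq> {- pi<..<pi}\<close> by simp
  have "- pi < c" "c < pi" using assms by auto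
  then show "(case (0, w) of (t, w) \<Rightarrow> - cis (t * Arg (- w) + (1 - t) * c)) \<in> K" for w
    using assms cis_neq_minus_one[of c] by (simp add: K Arg_cis minus_equation_iff)
qed (use \<open>I' \<subseteq> I\<close> in \<open>auto simp: J K minus_cis_Arg_circle\<close>)

text \<open>The slice \<open>A = X \<times> {1}\<close> is a retract, so it splits off and the relative group of the product modulo
  \<open>A\<close> remains. Thickening \<open>A\<close> to the complement of \<open>X \<times> {-1}\<close> and excising \<open>A\<close> turns this group into
  that of \<open>X\<close> times the circle without \<open>1\<close>, modulo the part over the open upper and lower half
  circles. The whole contracts onto the upper half, so the boundary map of the triple lowers the degree
  by one and leaves the two halves modulo the upper one, which by excision is the lower half, a copy
  of \<open>X\<close> up to homotopy.\<close>

lemma homology_Times_circle: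
  fixes X :: "'a::t1_space set"
  shows "homology_group p (top_of_set (X \<times> circle)) \<cong>
    homology_group p (top_of_set X) \<times>\<times> homology_group (p - 1) (top_of_set X)"
proof -
  define S where "S = top_of_set (X \<times> circle)"
  define A where "A = X \<times> {1::complex}"
  define B where "B = X \<times> (circle - {-1})"
  define S' where "S' = top_of_set (X \<times> (circle - {1}))"
  define T' where "T' = X \<times> (circle - {1, -1})"
  define up where "up = {w \<in> circle. 0 < Im w}"
  define low where "low = {w \<in> circle. Im w < 0}"
  have not1: "w \<noteq> 1" if "0 < Im w \<or> Im w < 0" for w using that by auto
  have up: "up = {w \<in> circle - {1}. Arg (- w) \<in> {- pi<..<0}}"
    unfolding up_def greaterThanLessThan_iff using not1 Arg_minus_circle_bounds Im_circle_Arg_minus by blast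
  have low: "low = {w \<in> circle - {1}. Arg (- w) \<in> {0<..<pi}}"
    unfolding low_def greaterThanLessThan_iff using not1 Arg_minus_circle_bounds Im_circle_Arg_minus by blast
  have minus1: "circle - {1} = {w \<in> circle - {1}. Arg (- w) \<in> {- pi<..<pi}}"
    using Arg_minus_circle_bounds by auto
  have uplow: "circle - {1, -1} = up \<union> low" "up \<inter> low = {}" "up \<union> low \<subseteq> circle - {1}"
  proof -
    have Im: "Im w \<noteq> 0 \<longleftrightarrow> w \<noteq> 1 \<and> w \<noteq> -1" if "w \<in> circle" for w
    proof -
      have "(Re w)\<^sup>2 + (Im w)\<^sup>2 = 1" using that cmod_power2[of w] by simp
      then have "Im w = 0 \<longleftrightarrow> Re w = 1 \<and> Im w = 0 \<or> Re w = -1 \<and> Im w = 0"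
        by (auto simp: power2_eq_1_iff)
      then show ?thesis by (simp add: complex_eq_iff) blast
    qed
    show "circle - {1, -1} = up \<union> low"
    proof (rule Set.set_eqI)
      fix w show "w \<in> circle - {1, -1} \<longleftrightarrow> w \<in> up \<union> low"
        using Im[of w] linorder_less_linear[of "Im w" 0] by (simp add: up_def low_def) argo
    qed
  qed (auto simp: up_def low_def)
  have point: "homology_group q (top_of_set (X \<times> {c})) \<cong> homology_group q (top_of_set X)" for q and c :: complex
  proof (rule homeomorphic_space_imp_isomorphic_homology_groups)
    have "homeomorphism (X \<times> {c}) X fst (\<lambda>x. (x, c))"
      by (auto simp: homeomorphism_def intro!: continuous_intros)
    then show "top_of_set (X \<times> {c}) homeomorphic_space top_of_set X"
      unfolding homeomorphic_space_iff_homeomorphic homeomorphic_def by blast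
  qed
  have subS: "subtopology S Y = top_of_set Y" if "Y \<subseteq> X \<times> circle" for Y
    using that by (simp add: S_def subtopology_subtopology inf.absorb2)
  have "A retract_of_space S"
    unfolding retract_of_space_def
  proof (intro conjI exI)
    show "continuous_map S (subtopology S A) (\<lambda>(x, w). (x, 1))"
      unfolding S_def A_def case_prod_unfold continuous_map_in_subtopology
      by (auto intro!: continuous_on_Pair continuous_on_fst continuous_on_const continuous_on_id)
    show "\<forall>x\<in>A. (case x of (x, w) \<Rightarrow> (x, 1)) = x" by (auto simp: A_def)
    show "A \<subseteq> topspace S" by (auto simp: S_def A_def)
  qed
  moreover have subA: "subtopology S A = top_of_set A"
    by (rule subS) (auto simp: A_def)
  ultimately have retr: "homology_group p S \<cong> homology_group p (top_of_set A) \<times>\<times> relative_homology_group p S A"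
    using isomorphic_group_homology_group_prod_retract[of A S p] by simp
  have prod: "homology_group p (top_of_set A) \<times>\<times> relative_homology_group p S A
      \<cong> homology_group p (top_of_set X) \<times>\<times> homology_group (p - 1) (top_of_set X)"
  proof (rule group.DirProd_iso_trans)
    show "homology_group p (top_of_set A) \<cong> homology_group p (top_of_set X)"
      unfolding A_def by (rule point)
    have AB: "A \<subseteq> B" by (auto simp: A_def B_def)
    have subB: "subtopology S B = top_of_set B" by (rule subS) (auto simp: B_def)
    have triv: "trivial_group (relative_homology_group q (top_of_set B) A)" for q
      unfolding A_def B_def by (rule trivial_relative_homology_Times_circle_point)
    have s1: "relative_homology_group p S A \<cong> relative_homology_group p S B"
    proof (rule is_isoI, rule very_short_exact_sequence)
      show "exact_seq ([relative_homology_group (p - 1) (subtopology S B) A, relative_homology_group p S B,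
          relative_homology_group p S A, relative_homology_group p (subtopology S B) A],
          [hom_relboundary p S B A, hom_induced p S A S B id, hom_induced p (subtopology S B) A S A id])"
        using homology_exactness_triple_1[OF AB] homology_exactness_triple_3[OF AB] by fastforce
    qed (use triv in \<open>simp_all add: subB\<close>)
    have s2: "relative_homology_group p S B \<cong> relative_homology_group p S' T'"
    proof -
      have "closedin S A"
      proof -
        have "A = (X \<times> circle) \<inter> (UNIV \<times> {1})" by (auto simp: A_def)
        moreover have "closed (UNIV \<times> {1 :: complex} :: ('a \<times> complex) set)" by (intro closed_Times) auto
        ultimately show ?thesis unfolding S_def by (simp add: closedin_closed_Int)
      qed
      moreover have "openin S B"
      proof -
        have "B = (X \<times> circle) \<inter> (UNIV \<times> (- {-1}))" by (auto simp: B_def)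
        moreover have "open (UNIV \<times> (- {-1 :: complex}) :: ('a \<times> complex) set)" by (intro open_Times) auto
        ultimately show ?thesis unfolding S_def by (simp add: openin_open_Int)
      qed
      ultimately have "S closure_of A \<subseteq> S interior_of B"
        using AB by (simp add: closure_of_closedin interior_of_openin)
      from homology_excision_axiom[OF this, of "X \<times> circle" p]
      have "relative_homology_group p (subtopology S (X \<times> circle - A)) (B - A)
          \<cong> relative_homology_group p (subtopology S (X \<times> circle)) B"
        by (intro is_isoI) (auto simp: B_def)
      moreover have "X \<times> circle - A = X \<times> (circle - {1})" "B - A = T'"
        by (auto simp: A_def B_def T'_def)
      moreover have "subtopology S (X \<times> (circle - {1})) = S'" "subtopology S (X \<times> circle) = S"
        unfolding S'_def by (rule subS, blast, unfold S_def, simp add: subtopology_subtopology)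
      ultimately have "relative_homology_group p S' T' \<cong> relative_homology_group p S B" by simp
      then show ?thesis by (simp add: group.iso_sym)
    qed
    have s3: "relative_homology_group p S' T' \<cong> relative_homology_group (p - 1) (subtopology S' T') (X \<times> up)"
    proof (rule is_isoI, rule very_short_exact_sequence)
      have sub: "X \<times> up \<subseteq> T'" using uplow by (auto simp: T'_def)
      show "exact_seq ([relative_homology_group (p - 1) S' (X \<times> up), relative_homology_group (p - 1) (subtopology S' T') (X \<times> up),
          relative_homology_group p S' T', relative_homology_group p S' (X \<times> up)],
         [hom_induced (p - 1) (subtopology S' T') (X \<times> up) S' (X \<times> up) id, hom_relboundary p S' T' (X \<times> up),
          hom_induced p S' (X \<times> up) S' T' id])"
        using homology_exactness_triple_1[OF sub] homology_exactness_triple_2[OF sub] by simp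
      show "trivial_group (relative_homology_group q S' (X \<times> up))" for q
        unfolding S'_def by (rule trivial_relative_homology_Times_circle_arc[OF minus1 up, where c = "- pi / 2"]) auto
      then show "trivial_group (relative_homology_group (p - 1) S' (X \<times> up))" .
    qed
    have s4: "relative_homology_group (p - 1) (subtopology S' T') (X \<times> up) \<cong> homology_group (p - 1) (top_of_set (X \<times> low))"
    proof -
      have T': "T' = X \<times> up \<union> X \<times> low" using uplow by (auto simp: T'_def)
      have "X \<times> up = T' \<inter> (UNIV \<times> {w. 0 < Im w})" "X \<times> up = T' \<inter> (UNIV \<times> {w. 0 \<le> Im w})"
        unfolding T' by (auto simp: up_def low_def)
      moreover have "open (UNIV \<times> {w. 0 < Im w} :: ('a \<times> complex) set)"
        by (intro open_Times open_halfspace_Im_gt) auto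
      moreover have "closed (UNIV \<times> {w. 0 \<le> Im w} :: ('a \<times> complex) set)"
        by (intro closed_Times closed_halfspace_Im_ge) auto
      ultimately have "openin (top_of_set T') (X \<times> up)" "closedin (top_of_set T') (X \<times> up)"
        by (metis openin_open_Int, metis closedin_closed_Int)
      then have "top_of_set T' closure_of (X \<times> up) \<subseteq> top_of_set T' interior_of (X \<times> up)"
        by (simp add: closure_of_closedin interior_of_openin)
      from homology_excision_axiom[OF this, of T' "p - 1"]
      have "relative_homology_group (p - 1) (subtopology (top_of_set T') (T' - X \<times> up)) (X \<times> up - X \<times> up)
          \<cong> relative_homology_group (p - 1) (subtopology (top_of_set T') T') (X \<times> up)"
        by (intro is_isoI) (auto simp: T')
      moreover have "T' - X \<times> up = X \<times> low" using uplow by (auto simp: T')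
      ultimately have "homology_group (p - 1) (top_of_set (X \<times> low)) \<cong> relative_homology_group (p - 1) (top_of_set T') (X \<times> up)"
        by (simp add: subtopology_subtopology inf.absorb2 T')
      moreover have "subtopology S' T' = top_of_set T'"
        unfolding S'_def T'_def subtopology_subtopology by (rule arg_cong[where f = top_of_set]) auto
      ultimately show ?thesis by (simp add: group.iso_sym)
    qed
    have s5: "homology_group (p - 1) (top_of_set (X \<times> low)) \<cong> homology_group (p - 1) (top_of_set (X \<times> {-\<i>}))"
    proof -
      have eq: "{-\<i>} = {w \<in> circle - {1}. Arg (- w) \<in> {pi / 2}}"
      proof -
        have "w = -\<i>" if "w \<in> {w \<in> circle - {1}. Arg (- w) \<in> {pi / 2}}" for w
        proof -
          have "Arg (- w) = pi / 2" "w \<in> circle" using that by auto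
          then show ?thesis using minus_cis_Arg_circle[of w] by (metis cis_pi_half)
        qed
        moreover have "-\<i> \<in> {w \<in> circle - {1}. Arg (- w) \<in> {pi / 2}}" by (simp add: complex_eq_iff)
        ultimately show ?thesis by (metis (lifting) equalityI insert_subset empty_subsetI singletonI subsetI)
      qed
      have triv: "trivial_group (relative_homology_group q (top_of_set (X \<times> low)) (X \<times> {-\<i>}))" for q
        by (rule trivial_relative_homology_Times_circle_arc[OF low eq, where c = "pi / 2"]) auto
      have "subtopology (top_of_set (X \<times> low)) (X \<times> {-\<i>}) = top_of_set (X \<times> {-\<i>})"
        unfolding subtopology_subtopology
        by (rule arg_cong[where f = top_of_set]) (auto simp: low_def)
      with homology_iso_of_trivial_relative_homology[OF triv, of "p - 1"] show ?thesis
        by (simp add: group.iso_sym)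
    qed
    show "relative_homology_group p S A \<cong> homology_group (p - 1) (top_of_set X)"
      by (rule iso_trans[OF iso_trans[OF iso_trans[OF s1 s2] iso_trans[OF s3 s4]] iso_trans[OF s5 point]])
  qed simp
  show ?thesis
    unfolding S_def[symmetric] by (rule iso_trans[OF retr prod])
qed

section \<open>Euler characteristic of the torus and of the sphere\<close>

abbreviation int_independent :: "('a, 'b) monoid_scheme \<Rightarrow> 'a set \<Rightarrow> bool" where
  "int_independent G S \<equiv> finite S \<and> S \<subseteq> carrier G \<and>
     (\<forall>c :: 'a \<Rightarrow> int. finprod G (\<lambda>x. x [^]\<^bsub>G\<^esub> c x) S = \<one>\<^bsub>G\<^esub> \<longrightarrow> (\<forall>x\<in>S. c x = 0))"

lemma group_rank_eqI:
  assumes "int_independent G S" "card S = k" "\<And>T. int_independent G T \<Longrightarrow> card T \<le> k"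
  shows "group_rank G = k"
  unfolding group_rank_def by (rule cSup_eq_maximum) (use assms in auto)

lemma hom_integer_group_finprod:
  fixes c :: "'a \<Rightarrow> int"
  assumes "comm_group G" "h \<in> hom G integer_group" "finite S" "S \<subseteq> carrier G"
  shows "h (finprod G (\<lambda>x. x [^]\<^bsub>G\<^esub> c x) S) = (\<Sum>x\<in>S. c x * h x)"
  using assms(3,4)
proof (induction S rule: finite_induct)
  case empty
  interpret comm_group G by (rule assms)
  show ?case using hom_one[OF assms(2)] by (simp add: is_group)
next
  case (insert x S)
  interpret comm_group G by (rule assms)
  interpret group_hom G integer_group h
    by (simp add: group_hom_def group_hom_axioms_def assms(2) is_group)
  have "finprod G (\<lambda>x. x [^]\<^bsub>G\<^esub> c x) (insert x S) = x [^]\<^bsub>G\<^esub> c x \<otimes>\<^bsub>G\<^esub> finprod G (\<lambda>x. x [^]\<^bsub>G\<^esub> c x) S"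
    using insert by (intro finprod_insert) auto
  moreover have "finprod G (\<lambda>x. x [^]\<^bsub>G\<^esub> c x) S \<in> carrier G"
    using insert by (intro finprod_closed) auto
  ultimately show ?case using insert by (simp add: hom_int_pow)
qed

text \<open>A family of homomorphisms to the integers that separates the unit element translates integral
  relations in \<open>G\<close> into systems of linear equations.\<close>

lemma finprod_int_pow_eq_one_iff:
  fixes c :: "'a \<Rightarrow> int"
  assumes "comm_group G" "\<And>h. h \<in> H \<Longrightarrow> h \<in> hom G integer_group"
    and "\<And>x. x \<in> carrier G \<Longrightarrow> \<forall>h\<in>H. h x = 0 \<Longrightarrow> x = \<one>\<^bsub>G\<^esub>"
    and S: "finite S" "S \<subseteq> carrier G"
  shows "finprod G (\<lambda>x. x [^]\<^bsub>G\<^esub> c x) S = \<one>\<^bsub>G\<^esub> \<longleftrightarrow> (\<forall>h\<in>H. (\<Sum>x\<in>S. c x * h x) = 0)"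
proof -
  interpret comm_group G by (rule assms)
  have mem: "finprod G (\<lambda>x. x [^]\<^bsub>G\<^esub> c x) S \<in> carrier G"
    using S by (intro finprod_closed) auto
  have one: "h \<one>\<^bsub>G\<^esub> = 0" if "h \<in> H" for h
    using hom_one[OF assms(2)[OF that]] by (simp add: is_group)
  show ?thesis
    using hom_integer_group_finprod[OF assms(1) assms(2) S, of _ c] one assms(3)[OF mem] by metis
qed

lemma group_rank_trivial:
  assumes "trivial_group G"
  shows "group_rank G = 0"
proof -
  have G: "comm_group G"
    using assms unfolding trivial_group_def
    by (intro group.group_comm_groupI) auto
  show ?thesis
  proof (rule group_rank_eqI[where S = "{}"])
    fix T assume T: "int_independent G T"
    interpret comm_group G by (rule G)
    have "finprod G (\<lambda>x. x [^]\<^bsub>G\<^esub> (1::int)) T \<in> carrier G"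
      using T by (intro finprod_closed) auto
    then have "finprod G (\<lambda>x. x [^]\<^bsub>G\<^esub> (1::int)) T = \<one>\<^bsub>G\<^esub>"
      using assms by (simp add: trivial_group_def)
    then have "\<forall>x\<in>T. (1::int) = 0"
      using conjunct2[OF conjunct2[OF T], rule_format, of "\<lambda>_. 1"] by blast
    then have "\<not> (\<exists>x. x \<in> T)" by simp
    then show "card T \<le> 0" by (metis card.empty ex_in_conv order_refl)
  qed auto
qed

lemma sum_three_point_support:
  fixes g :: "'a \<Rightarrow> int"
  assumes "finite S" "{p, q, r} \<subseteq> S" "p \<noteq> q" "p \<noteq> r" "q \<noteq> r"
  shows "(\<Sum>x\<in>S. (if x = p then a else if x = q then b else if x = r then d else 0) * g x) = a * g p + b * g q + d * g r"
proof -
  have "(\<Sum>x\<in>S. (if x = p then a else if x = q then b else if x = r then d else 0) * g x)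
      = (\<Sum>x\<in>{p, q, r}. (if x = p then a else if x = q then b else if x = r then d else 0) * g x)"
    using assms by (intro sum.mono_neutral_right) auto
  then show ?thesis using assms by simp
qed

text \<open>Three vectors \<open>p, q, r\<close> in the plane satisfy a relation whose coefficients are their two by two
  minors. If the vectors are independent, all minors vanish; then any two of them are already
  proportional, and this forces their coordinates to be \<open>0\<close>.\<close>

lemma group_rank_integer_group_square:
  assumes "comm_group G" "G \<cong> integer_group \<times>\<times> integer_group"
  shows "group_rank G = 2"
proof -
  obtain f where f: "f \<in> iso G (integer_group \<times>\<times> integer_group)" using assms(2) by (auto simp: is_iso_def)
  then have bij: "bij_betw f (carrier G) UNIV" by (auto simp: iso_def)
  have fhom: "f \<in> hom G (integer_group \<times>\<times> integer_group)" using f by (simp add: iso_def)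
  define h1 where "h1 = fst \<circ> f"
  define h2 where "h2 = snd \<circ> f"
  have H: "h \<in> hom G integer_group" if "h \<in> {h1, h2}" for h
    using that fhom unfolding h1_def h2_def by (auto simp: hom_def mult_DirProd' split_beta)
  have f1: "f \<one>\<^bsub>G\<^esub> = (0, 0)"
    using hom_one[OF fhom] assms(1) by (simp add: comm_group_def DirProd_group)
  have one_mem: "\<one>\<^bsub>G\<^esub> \<in> carrier G" using assms(1) by (simp add: comm_group_def group.is_monoid monoid.one_closed)
  have inj: "x = y" if "x \<in> carrier G" "y \<in> carrier G" "h1 x = h1 y" "h2 x = h2 y" for x y
    using that bij unfolding bij_betw_def inj_on_def h1_def h2_def by (metis comp_apply prod_eqI)
  have iff: "finprod G (\<lambda>x. x [^]\<^bsub>G\<^esub> c x) S = \<one>\<^bsub>G\<^esub> \<longleftrightarrow>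
      (\<Sum>x\<in>S. c x * h1 x) = 0 \<and> (\<Sum>x\<in>S. c x * h2 x) = 0" if "finite S" "S \<subseteq> carrier G" for S and c :: "'a \<Rightarrow> int"
  proof -
    have "finprod G (\<lambda>x. x [^]\<^bsub>G\<^esub> c x) S = \<one>\<^bsub>G\<^esub> \<longleftrightarrow> (\<forall>h\<in>{h1, h2}. (\<Sum>x\<in>S. c x * h x) = 0)"
      using f1 one_mem by (intro finprod_int_pow_eq_one_iff[OF assms(1) H _ that] inj) (auto simp: h1_def h2_def)
    then show ?thesis by simp
  qed
  have "(1, 0) \<in> f ` carrier G" "(0, 1) \<in> f ` carrier G" using bij by (auto simp: bij_betw_def)
  then obtain x y where xy: "x \<in> carrier G" "f x = (1, 0)" "y \<in> carrier G" "f y = (0, 1)" by (metis imageE)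
  then have "x \<noteq> y" by auto
  show ?thesis
  proof (rule group_rank_eqI[where S = "{x, y}"])
    show "int_independent G {x, y}" "card {x, y} = 2"
      using xy \<open>x \<noteq> y\<close> iff[of "{x, y}"] by (auto simp: h1_def h2_def)
    fix T assume T: "int_independent G T"
    show "card T \<le> 2"
    proof (rule ccontr)
      assume "\<not> card T \<le> 2"
      then obtain T' where T': "T' \<subseteq> T" "card T' = 3" using obtain_subset_with_card_n[of 3 T] by (metis not_less_eq_eq numeral_2_eq_2 numeral_3_eq_3)
      then obtain p q r where pqr: "T' = {p, q, r}" "p \<noteq> q" "p \<noteq> r" "q \<noteq> r" by (auto simp: card_3_iff)
      have dep: "a = 0 \<and> b = 0 \<and> d = 0"
        if "a * h1 p + b * h1 q + d * h1 r = 0" "a * h2 p + b * h2 q + d * h2 r = 0" for a b d :: int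
      proof -
        define c where "c = (\<lambda>x. if x = p then a else if x = q then b else if x = r then d else 0)"
        have "finprod G (\<lambda>x. x [^]\<^bsub>G\<^esub> c x) T = \<one>\<^bsub>G\<^esub>"
          using T T' pqr that sum_three_point_support[of T p q r a b d] by (subst iff) (auto simp: c_def)
        then have "\<forall>x\<in>T. c x = 0" using T by blast
        then have "c p = 0" "c q = 0" "c r = 0" using T' pqr by auto
        then show ?thesis using pqr by (auto simp: c_def split: if_splits)
      qed
      have "h1 q * h2 r - h2 q * h1 r = 0 \<and> h1 r * h2 p - h2 r * h1 p = 0 \<and> h1 p * h2 q - h2 p * h1 q = 0"
        by (rule dep) (auto simp: algebra_simps)
      then have "h1 p = 0" "h1 q = 0" "h2 p = 0" "h2 q = 0"
        using dep[of "h1 q" "- h1 p" 0] dep[of "h2 q" "- h2 p" 0] by (auto simp: algebra_simps)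
      moreover have "p \<in> carrier G" "q \<in> carrier G" using T T' pqr by auto
      ultimately have "p = q" using inj[of p q] by simp
      with pqr show False by simp
    qed
  qed
qed

lemma group_rank_integer_group:
  assumes "comm_group G" "G \<cong> integer_group"
  shows "group_rank G = 1"
proof -
  obtain f where f: "f \<in> iso G integer_group" using assms(2) by (auto simp: is_iso_def)
  then have bij: "bij_betw f (carrier G) UNIV" and fhom: "f \<in> hom G integer_group" by (auto simp: iso_def)
  have f1: "f \<one>\<^bsub>G\<^esub> = 0"
    using hom_one[OF fhom] assms(1) by (simp add: comm_group_def)
  have one_mem: "\<one>\<^bsub>G\<^esub> \<in> carrier G" using assms(1) by (simp add: comm_group_def group.is_monoid monoid.one_closed)
  have inj: "x = y" if "x \<in> carrier G" "y \<in> carrier G" "f x = f y" for x y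
    using that bij unfolding bij_betw_def inj_on_def by blast
  have iff: "finprod G (\<lambda>x. x [^]\<^bsub>G\<^esub> c x) S = \<one>\<^bsub>G\<^esub> \<longleftrightarrow> (\<Sum>x\<in>S. c x * f x) = 0"
    if "finite S" "S \<subseteq> carrier G" for S and c :: "'a \<Rightarrow> int"
  proof -
    have "finprod G (\<lambda>x. x [^]\<^bsub>G\<^esub> c x) S = \<one>\<^bsub>G\<^esub> \<longleftrightarrow> (\<forall>h\<in>{f}. (\<Sum>x\<in>S. c x * h x) = 0)"
      using f1 one_mem fhom by (intro finprod_int_pow_eq_one_iff[OF assms(1) _ _ that] inj) auto
    then show ?thesis by simp
  qed
  have "1 \<in> f ` carrier G" using bij by (auto simp: bij_betw_def)
  then obtain x where x: "x \<in> carrier G" "f x = 1" by (metis imageE)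
  show ?thesis
  proof (rule group_rank_eqI[where S = "{x}"])
    show "int_independent G {x}" "card {x} = 1"
      using x iff[of "{x}"] by auto
    fix T assume T: "int_independent G T"
    show "card T \<le> 1"
    proof (rule ccontr)
      assume "\<not> card T \<le> 1"
      then obtain p q where pq: "p \<in> T" "q \<in> T" "p \<noteq> q"
        using T card_le_Suc0_iff_eq[of T] by auto
      have dep: "a = 0 \<and> b = 0" if "a * f p + b * f q = 0" for a b :: int
      proof -
        define c where "c = (\<lambda>x. if x = p then a else if x = q then b else 0)"
        have "(\<Sum>x\<in>T. c x * f x) = (\<Sum>x\<in>{p, q}. c x * f x)"
          using T pq by (intro sum.mono_neutral_right) (auto simp: c_def)
        then have "finprod G (\<lambda>x. x [^]\<^bsub>G\<^esub> c x) T = \<one>\<^bsub>G\<^esub>"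
          using T pq that by (subst iff) (auto simp: c_def)
        then have "\<forall>x\<in>T. c x = 0" using T by blast
        then have "c p = 0" "c q = 0" using pq by auto
        then show ?thesis using pq by (auto simp: c_def split: if_splits)
      qed
      have "f q = 0 \<and> - f p = 0" by (rule dep) (auto simp: algebra_simps)
      moreover have "p \<in> carrier G" "q \<in> carrier G" using T pq by auto
      ultimately show False using inj[of p q] pq by simp
    qed
  qed
qed

lemma DirProd_trivial_right:
  assumes "group G" "group H" "trivial_group H"
  shows "G \<times>\<times> H \<cong> G"
proof (rule is_isoI)
  have "fst \<in> hom (G \<times>\<times> H) G" by (auto simp: hom_def mult_DirProd')
  moreover have "bij_betw fst (carrier (G \<times>\<times> H)) (carrier G)"
    using assms(3) by (intro bij_betwI[where g = "\<lambda>x. (x, \<one>\<^bsub>H\<^esub>)"]) (auto simp: trivial_group_def)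
  ultimately show "fst \<in> iso (G \<times>\<times> H) G" by (simp add: iso_def)
qed

lemma DirProd_trivial_left:
  assumes "group G" "group H" "trivial_group H"
  shows "H \<times>\<times> G \<cong> G"
  by (rule iso_trans[OF DirProd_commute_iso DirProd_trivial_right[OF assms]])

lemma trivial_DirProd:
  assumes "group G" "group H" "trivial_group G" "trivial_group H"
  shows "trivial_group (G \<times>\<times> H)"
  using assms by (auto simp: trivial_group_def DirProd_group)

text \<open>The product formula applied to a single point.\<close>

lemma homology_circle:
  shows "p = 0 \<or> p = 1 \<Longrightarrow> homology_group p (top_of_set circle) \<cong> integer_group"
    and "p \<noteq> 0 \<Longrightarrow> p \<noteq> 1 \<Longrightarrow> trivial_group (homology_group p (top_of_set circle))"
proof -
  have pt: "homology_group 0 (top_of_set {0 :: real}) \<cong> integer_group"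
    by (rule isomorphic_integer_zeroth_homology_group) (auto simp flip: path_connectedin_topspace)
  have triv: "q \<noteq> 0 \<Longrightarrow> trivial_group (homology_group q (top_of_set {0 :: real}))" for q
    by (rule homology_dimension_axiom) auto
  have "homeomorphism circle ({0 :: real} \<times> circle) (\<lambda>w. (0, w)) snd"
    by (auto simp: homeomorphism_def intro!: continuous_on_Pair continuous_on_const continuous_on_id continuous_on_snd)
  then have "top_of_set circle homeomorphic_space top_of_set ({0 :: real} \<times> circle)"
    unfolding homeomorphic_space_iff_homeomorphic homeomorphic_def by blast
  then have hom: "homology_group q (top_of_set circle) \<cong>
      homology_group q (top_of_set {0 :: real}) \<times>\<times> homology_group (q - 1) (top_of_set {0 :: real})" for q
    by (rule iso_trans[OF homeomorphic_space_imp_isomorphic_homology_groups homology_Times_circle])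
  show "homology_group p (top_of_set circle) \<cong> integer_group" if "p = 0 \<or> p = 1"
    using that
  proof
    assume "p = 0"
    then show ?thesis
      using iso_trans[OF iso_trans[OF hom[of 0] DirProd_trivial_right] pt] triv[of "-1"] by simp
  next
    assume "p = 1"
    then show ?thesis
      using iso_trans[OF iso_trans[OF hom[of 1] DirProd_trivial_left]] pt triv[of 1] by simp
  qed
  show "trivial_group (homology_group p (top_of_set circle))" if "p \<noteq> 0" "p \<noteq> 1"
    using isomorphic_group_triviality[OF hom[of p]] that
      trivial_DirProd[OF _ _ triv[of p] triv[of "p - 1"]] by (simp add: DirProd_group)
qed

lemma euler_char_eq_alternating_sum:
  assumes "\<And>p. p > 2 \<Longrightarrow> betti p X = 0"
  shows "euler_char X = int (betti 0 X) - int (betti 1 X) + int (betti 2 X)"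
proof -
  have "euler_char X = (\<Sum>p\<in>{0, 1, 2}. (-1) ^ p * int (betti p X))"
    unfolding euler_char_def
  proof (rule sum.mono_neutral_left)
    show "{p. betti p X \<noteq> 0} \<subseteq> {0, 1, 2}"
      using assms by (auto, metis One_nat_def Suc_1 bot_nat_0.extremum_strict less_Suc_eq linorder_neqE_nat)
  qed auto
  then show ?thesis by simp
qed

lemma euler_char_torus:
  assumes "X homeomorphic_space top_of_set (circle \<times> circle)"
  shows "euler_char X = 0"
proof -
  have hom: "homology_group p X \<cong> homology_group p (top_of_set circle) \<times>\<times> homology_group (p - 1) (top_of_set circle)" for p
    by (rule iso_trans[OF homeomorphic_space_imp_isomorphic_homology_groups[OF assms] homology_Times_circle])
  have comm: "comm_group (homology_group p X)" for p by (rule abelian_homology_group)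
  note circ = homology_circle
  have "homology_group 0 X \<cong> integer_group"
    using iso_trans[OF iso_trans[OF hom[of 0] DirProd_trivial_right] circ(1)] circ(2)[of "-1"] by simp
  then have "betti 0 X = 1" unfolding betti_def using group_rank_integer_group[OF comm] by simp
  moreover have "homology_group 1 X \<cong> integer_group \<times>\<times> integer_group"
    using iso_trans[OF hom[of 1] group.DirProd_iso_trans[OF _ circ(1) circ(1)]] by simp
  then have "betti 1 X = 2" unfolding betti_def using group_rank_integer_group_square[OF comm] by simp
  moreover have "homology_group 2 X \<cong> integer_group"
    using iso_trans[OF iso_trans[OF hom[of 2] DirProd_trivial_left] circ(1)] circ(2)[of 2] by simp
  then have "betti 2 X = 1" unfolding betti_def using group_rank_integer_group[OF comm] by simp
  moreover have "betti p X = 0" if "p > 2" for p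
    unfolding betti_def using that circ(2)
    by (intro group_rank_trivial) (subst isomorphic_group_triviality[OF hom], auto simp: DirProd_group intro!: trivial_DirProd)
  ultimately show ?thesis by (subst euler_char_eq_alternating_sum) auto
qed

lemma euler_char_sphere:
  assumes "X homeomorphic_space top_of_set (sphere 0 1 :: (real^3) set)"
  shows "euler_char X = 2"
proof -
  obtain f g where "homeomorphic_maps (nsphere (3 - 1)) (top_of_set (sphere 0 1 \<inter> span (Basis :: (real^3) set))) f g"
    by (rule homeomorphic_maps_nsphere_euclidean_sphere[of "Basis :: (real^3) set" 3])
      (auto simp: independent_Basis pairwise_def orthogonal_def inner_Basis)
  then have "nsphere 2 homeomorphic_space top_of_set (sphere 0 1 :: (real^3) set)"
    by (auto simp: homeomorphic_space_def)
  then have X: "X homeomorphic_space nsphere 2"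
    using assms homeomorphic_space_sym homeomorphic_space_trans by blast
  have hom: "homology_group p X \<cong> homology_group p (nsphere 2)" for p
    by (rule homeomorphic_space_imp_isomorphic_homology_groups[OF X])
  have comm: "comm_group (homology_group p X)" for p by (rule abelian_homology_group)
  have "path_connected (sphere 0 1 :: (real^3) set)" by (rule path_connected_sphere) simp
  then have pc: "path_connected_space X"
    using homeomorphic_path_connected_space[OF assms] path_connectedin_topspace[of "top_of_set (sphere 0 1 :: (real^3) set)"] by simp
  have ne: "topspace X \<noteq> {}"
  proof -
    have "axis 1 1 \<in> topspace (top_of_set (sphere 0 1 :: (real^3) set))" by simp
    then have "topspace (top_of_set (sphere 0 1 :: (real^3) set)) \<noteq> {}" by (rule_tac notI) (simp only: empty_iff)
    then show ?thesis
      using homeomorphic_empty_space[OF assms] unfolding null_topspace_iff_trivial by simp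
  qed
  have triv: "trivial_group (homology_group (int p) X)" if "p \<noteq> 0" "p \<noteq> 2" for p
    using reduced_homology_group_nsphere(2)[of "int p" 2] that
    by (subst isomorphic_group_triviality[OF hom]) (auto simp: un_reduced_homology_group)
  have "betti 0 X = 1"
    unfolding betti_def using group_rank_integer_group[OF comm] isomorphic_integer_zeroth_homology_group[OF pc ne] by simp
  moreover have "betti p X = 0" if "p \<noteq> 0" "p \<noteq> 2" for p
    unfolding betti_def using triv[OF that] by (rule group_rank_trivial)
  moreover have "betti 2 X = 1"
    unfolding betti_def using reduced_homology_group_nsphere(1)[of 2] iso_trans[OF hom[of 2]]
    by (intro group_rank_integer_group[OF comm]) (auto simp: un_reduced_homology_group)
  ultimately show ?thesis by (subst euler_char_eq_alternating_sum) auto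
qed

section \<open>The Levi-Civita connection in a rotating orthonormal frame\<close>

lemma vector_3_eq_axis: "(vector [a, b, c] :: real^3) = a *\<^sub>R axis 1 1 + b *\<^sub>R axis 2 1 + c *\<^sub>R axis 3 1"
  by (simp add: vec_eq_iff forall_3 axis_def)

lemma has_derivative_vector_3:
  fixes f1 f2 f3 :: "'a::real_normed_vector \<Rightarrow> real"
  assumes "(f1 has_derivative f1') F" "(f2 has_derivative f2') F" "(f3 has_derivative f3') F"
  shows "((\<lambda>x. vector [f1 x, f2 x, f3 x] :: real^3) has_derivative (\<lambda>h. vector [f1' h, f2' h, f3' h])) F"
  unfolding vector_3_eq_axis by (intro has_derivative_add has_derivative_scaleR_left assms)

lemma continuous_on_vector_3:
  fixes f1 f2 f3 :: "'a::topological_space \<Rightarrow> real"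
  assumes "continuous_on S f1" "continuous_on S f2" "continuous_on S f3"
  shows "continuous_on S (\<lambda>x. vector [f1 x, f2 x, f3 x] :: real^3)"
  unfolding vector_3_eq_axis by (intro continuous_intros assms)

text \<open>The vector with components \<open>a, b, d\<close> in the frame obtained from the left-invariant one by turning
  its first two vectors by the angle \<open>\<theta>\<close>, at a point whose first coordinate is \<open>r * cos \<theta>\<close>. Such
  a point is \<open>cylindrical r \<theta> h\<close>. For \<open>r = 0\<close> the angle is still meaningful: it selects one
  of the meridians through a point of the axis.\<close>

definition polar_vec :: "real \<Rightarrow> real \<Rightarrow> real \<Rightarrow> real \<Rightarrow> real \<Rightarrow> real^3" where
  "polar_vec \<theta> r a b d = vector [a * cos \<theta> - b * sin \<theta>, a * sin \<theta> + b * cos \<theta>,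
     d + r * cos \<theta> * (a * sin \<theta> + b * cos \<theta>)]"

lemma sin_cos_squared: "sin \<theta> * sin \<theta> = 1 - cos \<theta> * cos (\<theta> :: real)"
  using sin_cos_squared_add[of \<theta>] by (simp add: power2_eq_square algebra_simps)

lemma sin_sin_mult: "sin \<theta> * (sin \<theta> * t) = t - cos \<theta> * (cos \<theta> * (t :: real))"
  unfolding mult.assoc[symmetric] sin_cos_squared by (simp add: left_diff_distrib)

lemma nil_inner_polar_vec:
  assumes "p $ 1 = r * cos \<theta>"
  shows "nil_inner p (polar_vec \<theta> r a b d) (polar_vec \<theta> r a' b' d') = a * a' + b * b' + d * d'"
  using assms by (simp add: nil_inner_def polar_vec_def algebra_simps sin_sin_mult sin_cos_squared)

lemma polar_vec_exhaust: obtains a b d where "w = polar_vec \<theta> r a b d"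
proof
  show "w = polar_vec \<theta> r (w $ 1 * cos \<theta> + w $ 2 * sin \<theta>) (w $ 2 * cos \<theta> - w $ 1 * sin \<theta>) (w $ 3 - r * cos \<theta> * w $ 2)"
    by (simp add: polar_vec_def vec_eq_iff forall_3 algebra_simps sin_sin_mult)
qed

lemma polar_vec_add: "polar_vec \<theta> r a b d + polar_vec \<theta> r a' b' d' = polar_vec \<theta> r (a + a') (b + b') (d + d')"
  by (simp add: polar_vec_def vec_eq_iff forall_3 algebra_simps)

lemma polar_vec_scaleR: "c *\<^sub>R polar_vec \<theta> r a b d = polar_vec \<theta> r (c * a) (c * b) (c * d)"
  by (simp add: polar_vec_def vec_eq_iff forall_3 algebra_simps)

lemma polar_vec_minus: "- polar_vec \<theta> r a b d = polar_vec \<theta> r (- a) (- b) (- d)"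
  by (simp add: polar_vec_def vec_eq_iff forall_3 algebra_simps)

lemma polar_vec_eq_0_iff: "polar_vec \<theta> r a b d = 0 \<longleftrightarrow> a = 0 \<and> b = 0 \<and> d = 0"
proof
  define p :: nil where "p = vector [r * cos \<theta>, 0, 0]"
  assume "polar_vec \<theta> r a b d = 0"
  then have "nil_inner p (polar_vec \<theta> r a b d) (polar_vec \<theta> r a b d) = 0" by (simp add: nil_inner_def)
  then have "a * a + b * b + d * d = 0" by (simp add: nil_inner_polar_vec p_def)
  then have "a * a = 0 \<and> b * b = 0 \<and> d * d = 0"
    using zero_le_square[of a] zero_le_square[of b] zero_le_square[of d] by linarith
  then show "a = 0 \<and> b = 0 \<and> d = 0" by simp
qed (simp add: polar_vec_def vec_eq_iff forall_3)

text \<open>In the turned frame the velocity of a curve depends on the angle only through its derivative; the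
  summand \<open>- \<rho>\<^sup>2 / 2 * \<phi>'\<close> is the mixed term of the metric in cylindrical coordinates.\<close>

lemma cylindrical_has_derivative:
  assumes "(\<rho> has_derivative \<rho>') (at x within S)" "(\<phi> has_derivative \<phi>') (at x within S)" "(h has_derivative h') (at x within S)"
  shows "((\<lambda>y. cylindrical (\<rho> y) (\<phi> y) (h y)) has_derivative
    (\<lambda>k. polar_vec (\<phi> x) (\<rho> x) (\<rho>' k) (\<rho> x * \<phi>' k) (h' k - (\<rho> x)\<^sup>2 / 2 * \<phi>' k))) (at x within S)"
proof -
  define c where "c = (1 / 2 :: real)"
  have eq: "cylindrical r \<theta> z = vector [r * cos \<theta>, r * sin \<theta>, c * (r * r) * (cos \<theta> * sin \<theta>) + z]" for r \<theta> z
    by (simp add: cylindrical_def power2_eq_square c_def mult.assoc)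
  show ?thesis
    unfolding eq polar_vec_def
    by (rule has_derivative_vector_3; rule has_derivative_eq_rhs, (rule derivative_intros assms)+,
        force simp: c_def algebra_simps power2_eq_square sin_sin_mult sin_cos_squared)
qed

text \<open>Besides the turning of the frame, the derivative of the coordinate components contains the change
  of \<open>x\<close> in \<open>e\<^sub>2 = \<partial>\<^sub>y + x \<partial>\<^sub>z\<close>. That vertical vector is kept apart because it cancels in covariant
  derivatives.\<close>

lemma polar_vec_has_derivative:
  assumes "(\<theta> has_real_derivative \<theta>') F" "(r has_real_derivative r') F"
    "(a has_real_derivative a') F" "(b has_real_derivative b') F" "(d has_real_derivative d') F" "F = at t within S"
  shows "((\<lambda>t. polar_vec (\<theta> t) (r t) (a t) (b t) (d t)) has_vector_derivative
    polar_vec (\<theta> t) (r t) (a' - b t * \<theta>') (b' + a t * \<theta>') d'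
    + vector [0, 0, (r' * cos (\<theta> t) - r t * \<theta>' * sin (\<theta> t)) * (a t * sin (\<theta> t) + b t * cos (\<theta> t))]) F"
proof -
  note D = assms(1-5)[unfolded has_field_derivative_def assms(6)]
  have eq: "(\<lambda>h. h *\<^sub>R (polar_vec (\<theta> t) (r t) (a' - b t * \<theta>') (b' + a t * \<theta>') d'
    + vector [0, 0, (r' * cos (\<theta> t) - r t * \<theta>' * sin (\<theta> t)) * (a t * sin (\<theta> t) + b t * cos (\<theta> t))])) =
    (\<lambda>h. vector [h * ((a' - b t * \<theta>') * cos (\<theta> t) - (b' + a t * \<theta>') * sin (\<theta> t)),
      h * ((a' - b t * \<theta>') * sin (\<theta> t) + (b' + a t * \<theta>') * cos (\<theta> t)),
      h * (d' + r t * cos (\<theta> t) * ((a' - b t * \<theta>') * sin (\<theta> t) + (b' + a t * \<theta>') * cos (\<theta> t))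
        + (r' * cos (\<theta> t) - r t * \<theta>' * sin (\<theta> t)) * (a t * sin (\<theta> t) + b t * cos (\<theta> t)))])"
    by (simp add: fun_eq_iff polar_vec_def vec_eq_iff forall_3)
  show ?thesis
    unfolding has_vector_derivative_def eq unfolding polar_vec_def assms(6)
    by (rule has_derivative_vector_3; rule has_derivative_eq_rhs, (rule derivative_intros D)+,
        force simp: algebra_simps)
qed

lemma nil_metric_nth:
  "nil_metric p $ 1 $ 1 = 1" "nil_metric p $ 1 $ 2 = 0" "nil_metric p $ 1 $ 3 = 0"
  "nil_metric p $ 2 $ 1 = 0" "nil_metric p $ 2 $ 2 = 1 + p $ 1 * p $ 1" "nil_metric p $ 2 $ 3 = - p $ 1"
  "nil_metric p $ 3 $ 1 = 0" "nil_metric p $ 3 $ 2 = - p $ 1" "nil_metric p $ 3 $ 3 = 1"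
  by (simp_all add: nil_metric_def nil_inner_def axis_def power2_eq_square)

lemma matrix_inv_nil_metric:
  "matrix_inv (nil_metric p) = vector [vector [1, 0, 0], vector [0, 1, p $ 1], vector [0, p $ 1, 1 + p $ 1 * p $ 1]]"
  (is "_ = ?B")
proof -
  have AB: "nil_metric p ** ?B = mat 1" "?B ** nil_metric p = mat 1"
    by (simp_all add: vec_eq_iff forall_3 matrix_matrix_mult_def sum_3 nil_metric_nth mat_def power2_eq_square algebra_simps)
  then have "matrix_inv (nil_metric p) ** nil_metric p = mat 1"
    unfolding matrix_inv_def by (metis (mono_tags, lifting) someI_ex)
  then have "matrix_inv (nil_metric p) ** (nil_metric p ** ?B) = ?B" by (simp add: matrix_mul_assoc)
  then show ?thesis using AB by simp
qed

lemma partial_x_polynomial: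
  "partial i (\<lambda>q. c) p = 0"
  "partial i (\<lambda>q. - q $ 1) p = (if i = 1 then -1 else 0)"
  "partial i (\<lambda>q. c + q $ 1 * q $ 1) p = (if i = 1 then 2 * p $ 1 else 0)"
proof -
  have lin: "((\<lambda>q :: nil. q $ 1) has_derivative (\<lambda>h. h $ 1)) (at p)"
    by (rule bounded_linear_imp_has_derivative) (rule bounded_linear_vec_nth)
  show "partial i (\<lambda>q. c) p = 0" by (simp add: partial_def)
  have "((\<lambda>q :: nil. - q $ 1) has_derivative (\<lambda>h. - h $ 1)) (at p)"
    by (rule derivative_eq_intros lin refl)+
  then show "partial i (\<lambda>q. - q $ 1) p = (if i = 1 then -1 else 0)"
    by (auto simp: partial_def axis_def dest!: frechet_derivative_at[symmetric])
  have "((\<lambda>q :: nil. c + q $ 1 * q $ 1) has_derivative (\<lambda>h. 2 * (h $ 1 * p $ 1))) (at p)"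
    by (rule derivative_eq_intros lin refl | simp)+
  then show "partial i (\<lambda>q. c + q $ 1 * q $ 1) p = (if i = 1 then 2 * p $ 1 else 0)"
    by (auto simp: partial_def axis_def dest!: frechet_derivative_at[symmetric])
qed

lemma connection_form_eq:
  "connection_form p a b = vector [
     - p $ 1 * a $ 2 * b $ 2 + (a $ 2 * b $ 3 + a $ 3 * b $ 2) / 2,
     p $ 1 / 2 * (a $ 1 * b $ 2 + a $ 2 * b $ 1) - (a $ 1 * b $ 3 + a $ 3 * b $ 1) / 2,
     ((p $ 1)\<^sup>2 - 1) / 2 * (a $ 1 * b $ 2 + a $ 2 * b $ 1) - p $ 1 / 2 * (a $ 1 * b $ 3 + a $ 3 * b $ 1)]"
proof -
  have G: "\<forall>k. christoffel p k 1 1 = 0" "\<forall>k. christoffel p k 1 2 = (if k = 1 then 0 else if k = 2 then p $ 1 / 2 else ((p $ 1)\<^sup>2 - 1) / 2)"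
    "\<forall>k. christoffel p k 1 3 = (if k = 1 then 0 else if k = 2 then - 1 / 2 else - p $ 1 / 2)"
    "\<forall>k. christoffel p k 2 1 = (if k = 1 then 0 else if k = 2 then p $ 1 / 2 else ((p $ 1)\<^sup>2 - 1) / 2)"
    "\<forall>k. christoffel p k 2 2 = (if k = 1 then - p $ 1 else 0)" "\<forall>k. christoffel p k 2 3 = (if k = 1 then 1 / 2 else 0)"
    "\<forall>k. christoffel p k 3 1 = (if k = 1 then 0 else if k = 2 then - 1 / 2 else - p $ 1 / 2)"
    "\<forall>k. christoffel p k 3 2 = (if k = 1 then 1 / 2 else 0)" "\<forall>k. christoffel p k 3 3 = 0"
    by (simp_all add: forall_3 christoffel_def matrix_inv_nil_metric sum_3 nil_metric_nth partial_x_polynomial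
        power2_eq_square field_simps)
  show ?thesis
    unfolding connection_form_def by (simp add: vec_eq_iff forall_3 sum_3 G[rule_format] field_simps)
qed

text \<open>The first vector has the structure constants of the Heisenberg algebra,
  \<open>\<nabla>\<^sub>1 e\<^sub>2 = e\<^sub>3 / 2\<close> and so on, which are invariant under turning \<open>e\<^sub>1, e\<^sub>2\<close>. The vertical vector
  is subtracted because \<open>connection_form\<close> acts on coordinate components, where \<open>e\<^sub>2\<close> is not constant;
  it is opposite to the vertical vector in \<open>polar_vec_has_derivative\<close>.\<close>

lemma connection_form_polar_vec:
  assumes "p $ 1 = r * cos \<theta>"
  shows "connection_form p (polar_vec \<theta> r a1 b1 d1) (polar_vec \<theta> r a2 b2 d2) =
    polar_vec \<theta> r ((b1 * d2 + d1 * b2) / 2) (- (a1 * d2 + d1 * a2) / 2) ((a1 * b2 - b1 * a2) / 2)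
    - vector [0, 0, (a1 * cos \<theta> - b1 * sin \<theta>) * (a2 * sin \<theta> + b2 * cos \<theta>)]"
  unfolding connection_form_eq polar_vec_def assms vec_eq_iff forall_3
  by (simp add: algebra_simps power2_eq_square add_divide_distrib diff_divide_distrib sin_sin_mult sin_cos_squared)

lemma connection_form_add: "connection_form p (a + a') b = connection_form p a b + connection_form p a' b"
  by (simp add: connection_form_eq vec_eq_iff forall_3 field_simps)

lemma connection_form_scaleR: "connection_form p (c *\<^sub>R a) b = c *\<^sub>R connection_form p a b"
  by (simp add: connection_form_eq vec_eq_iff forall_3 field_simps)

lemma nil_frame_3: "nil_frame 3 p = axis 3 1"
proof -
  have lin: "((\<lambda>q :: nil. q $ i) has_derivative (\<lambda>h. h $ i)) (at 0)" for i
    by (rule bounded_linear_imp_has_derivative) (rule bounded_linear_vec_nth)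
  have "(nil_mult p has_derivative (\<lambda>h. vector [h $ 1, h $ 2, h $ 3 + p $ 1 * h $ 2])) (at 0)"
    unfolding nil_mult_def
    by (rule has_derivative_vector_3; (rule derivative_eq_intros lin | simp)+)
  then show ?thesis
    by (simp add: nil_frame_def frechet_derivative_at[symmetric] axis_def vec_eq_iff forall_3)
qed

lemma nil_frame_3_polar: "nil_frame 3 p = polar_vec \<theta> r 0 0 1"
  by (simp add: nil_frame_3 polar_vec_def vec_eq_iff forall_3 axis_def)

lemma nil_inner_add_right: "nil_inner p a (b + c) = nil_inner p a b + nil_inner p a c"
  by (simp add: nil_inner_def algebra_simps)
lemma nil_inner_add_left: "nil_inner p (b + c) a = nil_inner p b a + nil_inner p c a"
  by (simp add: nil_inner_def algebra_simps)
lemma nil_inner_scaleR_right: "nil_inner p a (t *\<^sub>R b) = t * nil_inner p a b"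
  by (simp add: nil_inner_def algebra_simps)
lemma nil_inner_scaleR_left: "nil_inner p (t *\<^sub>R b) a = t * nil_inner p b a"
  by (simp add: nil_inner_def algebra_simps)
lemma nil_inner_commute: "nil_inner p a b = nil_inner p b a"
  by (simp add: nil_inner_def algebra_simps)

section \<open>Smooth maps\<close>

lemma Ck_on_cong:
  assumes "open U" "\<And>x. x \<in> U \<Longrightarrow> f x = g x" "Ck_on k U f"
  shows "Ck_on k U g"
  using assms(2,3)
proof (induction k arbitrary: f g)
  case 0
  then show ?case by (simp cong: continuous_on_cong)
next
  case (Suc k)
  have D: "(g has_derivative frechet_derivative f (at x)) (at x)" if "x \<in> U" for x
  proof (rule has_derivative_transform_within_open[OF _ \<open>open U\<close> that])
    show "(f has_derivative frechet_derivative f (at x)) (at x)"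
      using Suc.prems(2) that by (simp add: frechet_derivative_works[symmetric])
  qed (use Suc.prems(1) in auto)
  then have eq: "frechet_derivative g (at x) = frechet_derivative f (at x)" if "x \<in> U" for x
    using that frechet_derivative_at by metis
  have "Ck_on k U (\<lambda>x. frechet_derivative g (at x) b)" if "b \<in> Basis" for b
    using Suc.IH[of "\<lambda>x. frechet_derivative f (at x) b" "\<lambda>x. frechet_derivative g (at x) b"] Suc.prems(2) that eq by auto
  then show ?case using D by (auto simp: differentiable_def)
qed

lemma Ck_on_SucD: "Ck_on (Suc k) U f \<Longrightarrow> Ck_on k U f"
proof (induction k arbitrary: f)
  case 0
  then show ?case
    by (auto intro!: continuous_at_imp_continuous_on differentiable_imp_continuous_within)
next
  case (Suc k)
  then show ?case using Suc.IH by (metis Ck_on.simps(2))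
qed

lemma Ck_on_SucI:
  assumes "open U" "\<And>x. x \<in> U \<Longrightarrow> (f has_derivative f' x) (at x)" "\<And>b. b \<in> Basis \<Longrightarrow> Ck_on k U (\<lambda>x. f' x b)"
  shows "Ck_on (Suc k) U f"
proof -
  have eq: "f' x = frechet_derivative f (at x)" if "x \<in> U" for x
    using assms(2)[OF that] by (rule frechet_derivative_at)
  have "Ck_on k U (\<lambda>x. frechet_derivative f (at x) b)" if "b \<in> Basis" for b
    by (rule Ck_on_cong[OF assms(1) _ assms(3)[OF that]]) (simp add: eq)
  then show ?thesis using assms(2) by (auto simp: differentiable_def)
qed

lemma Ck_on_has_derivative:
  "Ck_on (Suc k) U f \<Longrightarrow> x \<in> U \<Longrightarrow> (f has_derivative frechet_derivative f (at x)) (at x)"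
  by (simp add: frechet_derivative_works[symmetric])

lemma Ck_on_const: "open U \<Longrightarrow> Ck_on k U (\<lambda>x. c)"
proof (induction k arbitrary: c)
  case (Suc k)
  show ?case by (rule Ck_on_SucI[OF Suc.prems, where f' = "\<lambda>_ _. 0"]) (auto intro: Suc)
qed simp

lemma Ck_on_add:
  assumes "open U" "Ck_on k U f" "Ck_on k U g"
  shows "Ck_on k U (\<lambda>x. f x + g x)"
  using assms(2,3)
proof (induction k arbitrary: f g)
  case 0
  then show ?case by (auto intro: continuous_on_add)
next
  case (Suc k)
  show ?case
    by (rule Ck_on_SucI[OF assms(1)], rule has_derivative_add[OF Ck_on_has_derivative[OF Suc.prems(1)] Ck_on_has_derivative[OF Suc.prems(2)]])
      (use Suc in auto)
qed

lemma Ck_on_scaleR: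
  fixes f :: "'a::euclidean_space \<Rightarrow> real"
  assumes "open U" "Ck_on k U f" "Ck_on k U g"
  shows "Ck_on k U (\<lambda>x. f x *\<^sub>R g x)"
  using assms(2,3)
proof (induction k arbitrary: f g)
  case 0
  then show ?case by (auto intro: continuous_on_scaleR)
next
  case (Suc k)
  note D = has_derivative_scaleR[OF Ck_on_has_derivative[OF Suc.prems(1)] Ck_on_has_derivative[OF Suc.prems(2)]]
  show ?case
  proof (rule Ck_on_SucI[OF assms(1)], rule D)
    fix b :: 'a assume "b \<in> Basis"
    then have "Ck_on k U (\<lambda>x. frechet_derivative f (at x) b)" "Ck_on k U (\<lambda>x. frechet_derivative g (at x) b)"
      using Suc.prems by simp_all
    then show "Ck_on k U (\<lambda>x. f x *\<^sub>R frechet_derivative g (at x) b + frechet_derivative f (at x) b *\<^sub>R g x)"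
      by (intro Ck_on_add[OF assms(1)] Suc.IH Ck_on_SucD[OF Suc.prems(1)] Ck_on_SucD[OF Suc.prems(2)])
  qed
qed

text \<open>The whole sequence of derivatives is carried along, because differentiating one of its members
  again yields a member times a constant.\<close>

lemma Ck_on_coordinate:
  fixes D :: "nat \<Rightarrow> real \<Rightarrow> real" and U :: "(real^'n) set"
  assumes "open U" "\<And>j s. s \<in> A \<Longrightarrow> (D j has_real_derivative D (Suc j) s) (at s)" "\<And>x. x \<in> U \<Longrightarrow> x $ i \<in> A"
  shows "Ck_on k U (\<lambda>x. D j (x $ i))"
proof -
  have lin: "((\<lambda>x. x $ i) has_derivative (\<lambda>h. h $ i)) (at x)" for x :: "real^'n"
    by (rule bounded_linear_imp_has_derivative) (rule bounded_linear_vec_nth)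
  have D: "((\<lambda>x. D j (x $ i)) has_derivative (\<lambda>h. (h $ i) *\<^sub>R D (Suc j) (x $ i))) (at x)" if "x \<in> U" for x j
    using has_derivative_compose[OF lin assms(2)[OF assms(3)[OF that], unfolded has_field_derivative_def]]
    by (simp add: mult.commute)
  show ?thesis
  proof (induction k arbitrary: j)
    case 0
    show ?case using D
      by (auto intro!: continuous_at_imp_continuous_on has_derivative_continuous)
  next
    case (Suc k)
    show ?case by (rule Ck_on_SucI[OF assms(1) D]) (assumption, rule Ck_on_scaleR[OF assms(1) Ck_on_const[OF assms(1)] Suc])
  qed
qed

section \<open>Charts of a surface of revolution\<close>

text \<open>A stretch of the profile curve whose inner points lie off the axis and whose revolution is all
  of \<open>M\<close>. Its ends may lie on the axis or coincide. An arc is a single piece; a closed curve is a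
  piece from each of its points, and two pieces with different ends have charts around every point of
  the torus. Smoothness is required inside only, so that both cases are covered.\<close>

locale profile_piece =
  fixes a b :: real and u v \<sigma> :: "real \<Rightarrow> real" and M :: "nil set"
  assumes ab: "a < b"
    and cont_u: "continuous_on {a..b} u" and cont_v: "continuous_on {a..b} v"
    and smooth_u: "smooth_interval {a<..<b} u" and smooth_v: "smooth_interval {a<..<b} v"
    and smooth_\<sigma>: "smooth_interval {a<..<b} \<sigma>"
    and u_nonneg: "s \<in> {a..b} \<Longrightarrow> 0 \<le> u s" and u_pos: "s \<in> {a<..<b} \<Longrightarrow> 0 < u s"
    and du: "s \<in> {a<..<b} \<Longrightarrow> (u has_real_derivative cos (\<sigma> s)) (at s)"
    and dv: "s \<in> {a<..<b} \<Longrightarrow> (v has_real_derivative sqrt (4 + (u s)\<^sup>2) / 2 * sin (\<sigma> s)) (at s)"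
    and M_eq: "M = revolution ((\<lambda>s. (u s, v s)) ` {a..b})"
    and inj: "s \<in> {a<..<b} \<Longrightarrow> t \<in> {a..b} \<Longrightarrow> u s = u t \<Longrightarrow> v s = v t \<Longrightarrow> s = t"
begin

definition Phi :: "real^2 \<Rightarrow> nil" where
  "Phi x = cylindrical (u (x $ 1)) (x $ 2) (v (x $ 1))"

abbreviation chart_box :: "real \<Rightarrow> (real^2) set" where
  "chart_box \<alpha> \<equiv> box (vector [a, \<alpha> - pi]) (vector [b, \<alpha> + pi])"

abbreviation chart_cbox :: "real \<Rightarrow> (real^2) set" where
  "chart_cbox \<alpha> \<equiv> cbox (vector [a, \<alpha> - pi]) (vector [b, \<alpha> + pi])"

lemma mem_chart_box: "x \<in> chart_box \<alpha> \<longleftrightarrow> a < x $ 1 \<and> x $ 1 < b \<and> \<alpha> - pi < x $ 2 \<and> x $ 2 < \<alpha> + pi"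
  by (auto simp: mem_box_cart forall_2)

lemma mem_chart_cbox: "x \<in> chart_cbox \<alpha> \<longleftrightarrow> a \<le> x $ 1 \<and> x $ 1 \<le> b \<and> \<alpha> - pi \<le> x $ 2 \<and> x $ 2 \<le> \<alpha> + pi"
  by (auto simp: mem_box_cart forall_2)

lemma Phi_mem: "s \<in> {a..b} \<Longrightarrow> cylindrical (u s) \<theta> (v s) \<in> M"
  by (auto simp: M_eq revolution_def orbit_map_cylindrical u_nonneg)

lemma Phi_cover:
  assumes "p \<in> M"
  obtains s \<theta> where "s \<in> {a..b}" "\<alpha> - pi \<le> \<theta>" "\<theta> < \<alpha> + pi" "p = cylindrical (u s) \<theta> (v s)"
proof -
  obtain s where s: "s \<in> {a..b}" "orbit_map p = (u s, v s)" using assms by (auto simp: M_eq revolution_def)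
  then have rho: "sqrt ((p $ 1)\<^sup>2 + (p $ 2)\<^sup>2) = u s" and h: "p $ 3 - p $ 1 * p $ 2 / 2 = v s" by (auto simp: orbit_map_def)
  obtain t where t: "p $ 1 = u s * cos t" "p $ 2 = u s * sin t"
  proof (cases "u s = 0")
    case True
    then have "(p $ 1)\<^sup>2 + (p $ 2)\<^sup>2 = 0" using rho by simp
    then show ?thesis using True that[of 0] by (simp add: sum_power2_eq_zero_iff)
  next
    case False
    have "(p $ 1)\<^sup>2 + (p $ 2)\<^sup>2 = (u s)\<^sup>2" using rho by (metis real_sqrt_pow2 sum_power2_ge_zero)
    then have "(p $ 1 / u s)\<^sup>2 + (p $ 2 / u s)\<^sup>2 = 1" using False
      by (simp add: power_divide flip: add_divide_distrib)
    then obtain t where "p $ 1 / u s = cos t" "p $ 2 / u s = sin t" using sincos_total_2pi by metis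
    then show ?thesis using that[of t] False by (simp add: field_simps)
  qed
  define k where "k = \<lceil>(\<alpha> - pi - t) / (2 * pi)\<rceil>"
  define \<theta> where "\<theta> = t + of_int k * (2 * pi)"
  have "(\<alpha> - pi - t) / (2 * pi) \<le> of_int k" "of_int k < (\<alpha> - pi - t) / (2 * pi) + 1"
    unfolding k_def by (auto simp: le_of_int_ceiling) linarith
  then have "\<alpha> - pi \<le> \<theta>" "\<theta> < \<alpha> + pi"
    unfolding \<theta>_def by (auto simp: field_simps)
  moreover have "cos \<theta> = cos t" "sin \<theta> = sin t"
    using cos_int_2pin[of k] sin_int_2pin[of k] by (simp_all add: \<theta>_def cos_add sin_add mult.commute mult.left_commute)
  then have "p = cylindrical (u s) \<theta> (v s)"
    using t h by (simp add: cylindrical_def vec_eq_iff forall_3 power2_eq_square algebra_simps)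
  ultimately show ?thesis using that s by blast
qed

lemma Phi_cbox: "Phi ` chart_cbox \<alpha> = M"
proof
  show "Phi ` chart_cbox \<alpha> \<subseteq> M" using Phi_mem by (auto simp: Phi_def mem_chart_cbox)
  show "M \<subseteq> Phi ` chart_cbox \<alpha>"
  proof
    fix p assume "p \<in> M"
    then obtain s \<theta> where *: "s \<in> {a..b}" "\<alpha> - pi \<le> \<theta>" "\<theta> < \<alpha> + pi" "p = cylindrical (u s) \<theta> (v s)"
      using Phi_cover[of p \<alpha>] by metis
    then show "p \<in> Phi ` chart_cbox \<alpha>"
      by (intro image_eqI[of _ _ "vector [s, \<theta>]"]) (auto simp: Phi_def mem_chart_cbox)
  qed
qed

lemma cylindrical_inj:
  assumes "s \<in> {a<..<b}" "t \<in> {a..b}" "\<bar>\<theta> - \<phi>\<bar> < 2 * pi" "cylindrical (u s) \<theta> (v s) = cylindrical (u t) \<phi> (v t)"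
  shows "s = t" "\<theta> = \<phi>"
proof -
  have "(u s, v s) = (u t, v t)"
    using orbit_map_cylindrical[of "u s" \<theta> "v s"] orbit_map_cylindrical[of "u t" \<phi> "v t"] assms(4) u_nonneg[of s] u_nonneg[of t] assms(1,2)
    by (simp del: u_nonneg)
  then show st: "s = t" using inj[of s t] assms by auto
  have "u s * cos \<theta> = u s * cos \<phi>" "u s * sin \<theta> = u s * sin \<phi>"
    using assms(4) st by (simp_all add: cylindrical_def vec_eq_iff forall_3)
  then have "cos \<theta> = cos \<phi>" "sin \<theta> = sin \<phi>" using u_pos[OF assms(1)] by auto
  then obtain n :: int where n: "\<theta> = \<phi> + 2 * pi * of_int n" using sin_cos_eq_iff by metis
  with assms(3) have "2 * pi * \<bar>of_int n :: real\<bar> < 2 * pi * 1" by (simp add: abs_mult)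
  then have "\<bar>of_int n :: real\<bar> < 1" by simp
  then have "n = 0" by linarith
  then show "\<theta> = \<phi>" using n by simp
qed

lemma Phi_inj:
  assumes "x \<in> chart_box \<alpha>" "y \<in> chart_cbox \<alpha>" "Phi x = Phi y"
  shows "x = y"
proof -
  have "\<bar>x $ 2 - y $ 2\<bar> < 2 * pi" using assms(1,2) by (auto simp: mem_chart_box mem_chart_cbox)
  moreover have "x $ 1 \<in> {a<..<b}" "y $ 1 \<in> {a..b}" using assms(1,2) by (auto simp: mem_chart_box mem_chart_cbox)
  ultimately show ?thesis
    using cylindrical_inj[OF _ _ _ assms(3)[unfolded Phi_def]] by (simp add: vec_eq_iff forall_2)
qed

lemma continuous_on_Phi: "continuous_on {x. x $ 1 \<in> {a..b}} Phi"
proof -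
  have "continuous_on {x :: real^2. x $ 1 \<in> {a..b}} (\<lambda>x. u (x $ 1))" "continuous_on {x :: real^2. x $ 1 \<in> {a..b}} (\<lambda>x. v (x $ 1))"
    by (auto intro!: continuous_on_compose2[OF cont_u] continuous_on_compose2[OF cont_v] continuous_intros)
  then show ?thesis
    unfolding Phi_def cylindrical_def
    by (intro continuous_on_vector_3 continuous_intros) auto
qed

text \<open>The parametrization maps the compact closed rectangle onto \<open>M\<close>, and points of the open rectangle
  share their image with no other point. So the complement of the image of \<open>V\<close> in \<open>M\<close> is the image
  of a compact set.\<close>

lemma openin_Phi_image:
  assumes "open V" "V \<subseteq> chart_box \<alpha>"
  shows "openin (top_of_set M) (Phi ` V)"
proof -
  have "compact (chart_cbox \<alpha> - V)" by (intro compact_diff compact_cbox assms)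
  then have "compact (Phi ` (chart_cbox \<alpha> - V))"
    by (rule compact_continuous_image[rotated]) (auto intro: continuous_on_subset[OF continuous_on_Phi] simp: mem_chart_cbox)
  then have "closed (Phi ` (chart_cbox \<alpha> - V))" by (rule compact_imp_closed)
  moreover have "Phi ` V = M \<inter> - Phi ` (chart_cbox \<alpha> - V)"
  proof -
    have V: "V \<subseteq> chart_cbox \<alpha>" using assms(2) box_subset_cbox by (rule order_trans)
    have "Phi x \<noteq> Phi y" if "x \<in> V" "y \<in> chart_cbox \<alpha> - V" for x y
      using Phi_inj[of x \<alpha> y] that assms(2) by auto
    moreover have "M = Phi ` V \<union> Phi ` (chart_cbox \<alpha> - V)"
      unfolding image_Un[symmetric] using V Phi_cbox[of \<alpha>] by (simp add: Un_absorb1)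
    ultimately show ?thesis by auto
  qed
  ultimately show ?thesis by (metis open_Compl openin_open_Int)
qed

lemma Phi_has_derivative:
  assumes "x $ 1 \<in> {a<..<b}"
  shows "(Phi has_derivative (\<lambda>h. polar_vec (x $ 2) (u (x $ 1)) (cos (\<sigma> (x $ 1)) * h $ 1) (u (x $ 1) * h $ 2)
      (sqrt (4 + (u (x $ 1))\<^sup>2) / 2 * sin (\<sigma> (x $ 1)) * h $ 1 - (u (x $ 1))\<^sup>2 / 2 * h $ 2))) (at x)"
proof -
  have lin: "((\<lambda>x. x $ i) has_derivative (\<lambda>h. h $ i)) (at x)" for x :: "real^2" and i
    by (rule bounded_linear_imp_has_derivative) (rule bounded_linear_vec_nth)
  show ?thesis
    unfolding Phi_def
    by (rule cylindrical_has_derivative[OF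
        has_derivative_compose[OF lin du[OF assms, unfolded has_field_derivative_def]] lin
        has_derivative_compose[OF lin dv[OF assms, unfolded has_field_derivative_def]]])
qed

lemma frechet_derivative_Phi:
  assumes "x $ 1 \<in> {a<..<b}"
  shows "frechet_derivative Phi (at x) = (\<lambda>h. polar_vec (x $ 2) (u (x $ 1)) (cos (\<sigma> (x $ 1)) * h $ 1) (u (x $ 1) * h $ 2)
      (sqrt (4 + (u (x $ 1))\<^sup>2) / 2 * sin (\<sigma> (x $ 1)) * h $ 1 - (u (x $ 1))\<^sup>2 / 2 * h $ 2))"
  using frechet_derivative_at[OF Phi_has_derivative[OF assms]] by simp

lemma smooth_on_Phi: "smooth_on (chart_box \<alpha>) Phi"
proof -
  obtain Du where Du: "Du 0 = u" "\<And>k s. s \<in> {a<..<b} \<Longrightarrow> (Du k has_real_derivative Du (Suc k) s) (at s within {a<..<b})"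
    using smooth_u unfolding smooth_interval_def by blast
  obtain Dv where Dv: "Dv 0 = v" "\<And>k s. s \<in> {a<..<b} \<Longrightarrow> (Dv k has_real_derivative Dv (Suc k) s) (at s within {a<..<b})"
    using smooth_v unfolding smooth_interval_def by blast
  have at: "at s within {a<..<b} = at s" if "s \<in> {a<..<b}" for s by (rule at_within_open[OF that]) simp
  (* each derivative of sine and cosine is a shift by a quarter turn *)
  have trig: "((\<lambda>s. cos (s + real j * (pi / 2))) has_real_derivative cos (s + real (Suc j) * (pi / 2))) (at s)"
    "((\<lambda>s. sin (s + real j * (pi / 2))) has_real_derivative sin (s + real (Suc j) * (pi / 2))) (at s)" for j and s :: real
  proof -
    have "s + real (Suc j) * (pi / 2) = (s + real j * (pi / 2)) + pi / 2" by (simp add: algebra_simps add_divide_distrib)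
    then have "cos (s + real (Suc j) * (pi / 2)) = - sin (s + real j * (pi / 2))"
      "sin (s + real (Suc j) * (pi / 2)) = cos (s + real j * (pi / 2))"
      by (simp_all only: cos_add sin_add cos_pi_half sin_pi_half) simp_all
    then show "((\<lambda>s. cos (s + real j * (pi / 2))) has_real_derivative cos (s + real (Suc j) * (pi / 2))) (at s)"
      "((\<lambda>s. sin (s + real j * (pi / 2))) has_real_derivative sin (s + real (Suc j) * (pi / 2))) (at s)"
      by (auto intro!: derivative_eq_intros)
  qed
  have "Ck_on k (chart_box \<alpha>) Phi" for k
  proof -
    have U: "Ck_on k (chart_box \<alpha>) (\<lambda>x. u (x $ 1))"
      using Ck_on_coordinate[of "chart_box \<alpha>" "{a<..<b}" Du 1 k 0, OF open_box] Du at by (simp add: mem_chart_box)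
    have V: "Ck_on k (chart_box \<alpha>) (\<lambda>x. v (x $ 1))"
      using Ck_on_coordinate[of "chart_box \<alpha>" "{a<..<b}" Dv 1 k 0, OF open_box] Dv at by (simp add: mem_chart_box)
    have C: "Ck_on k (chart_box \<alpha>) (\<lambda>x. cos (x $ 2))"
      using Ck_on_coordinate[of "chart_box \<alpha>" UNIV "\<lambda>j s. cos (s + real j * (pi / 2))" 2 k 0, OF open_box] trig by simp
    have S: "Ck_on k (chart_box \<alpha>) (\<lambda>x. sin (x $ 2))"
      using Ck_on_coordinate[of "chart_box \<alpha>" UNIV "\<lambda>j s. sin (s + real j * (pi / 2))" 2 k 0, OF open_box] trig by simp
    have "Phi = (\<lambda>x. (u (x $ 1) *\<^sub>R cos (x $ 2)) *\<^sub>R axis 1 1 + (u (x $ 1) *\<^sub>R sin (x $ 2)) *\<^sub>R axis 2 1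
        + ((1 / 2) *\<^sub>R ((u (x $ 1) *\<^sub>R u (x $ 1)) *\<^sub>R (cos (x $ 2) *\<^sub>R sin (x $ 2))) + v (x $ 1)) *\<^sub>R axis 3 1)"
      by (auto simp: fun_eq_iff Phi_def cylindrical_def vector_3_eq_axis power2_eq_square)
    then show ?thesis
      by (simp only:) (intro Ck_on_add Ck_on_scaleR Ck_on_const U V C S open_box)
  qed
  then show ?thesis by (simp add: smooth_on_def)
qed

text \<open>The angle range is one full turn centred at \<open>\<alpha>\<close>; the charts with \<open>\<alpha> = 0\<close> and \<open>\<alpha> = pi\<close> together miss
  only the ends of the piece.\<close>

lemma local_param_Phi: "local_param M (chart_box \<alpha>) Phi"
  unfolding local_param_def
proof (intro conjI ballI)
  show "smooth_on (chart_box \<alpha>) Phi" by (rule smooth_on_Phi)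
  show "openin (top_of_set M) (Phi ` chart_box \<alpha>)" by (rule openin_Phi_image) auto
  have "continuous_on (chart_box \<alpha>) Phi"
    by (rule continuous_on_subset[OF continuous_on_Phi]) (auto simp: mem_chart_box)
  moreover have "inj_on Phi (chart_box \<alpha>)"
    using Phi_inj[of _ \<alpha>] box_subset_cbox by (meson inj_onI subsetD)
  moreover have "openin (top_of_set (Phi ` chart_box \<alpha>)) (Phi ` V)" if "openin (top_of_set (chart_box \<alpha>)) V" for V
  proof -
    have "open V" "V \<subseteq> chart_box \<alpha>" using that unfolding openin_open_eq[OF open_box] by auto
    then have "openin (top_of_set M) (Phi ` V)" by (rule openin_Phi_image)
    moreover have "Phi ` chart_box \<alpha> \<subseteq> M" using Phi_cbox[of \<alpha>] box_subset_cbox by blast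
    ultimately show ?thesis
      using \<open>V \<subseteq> chart_box \<alpha>\<close> by (meson image_mono openin_subset_trans)
  qed
  ultimately show "\<exists>\<psi>. homeomorphism (chart_box \<alpha>) (Phi ` chart_box \<alpha>) Phi \<psi>"
    by (metis homeomorphism_injective_open_map)
  fix x assume "x \<in> chart_box \<alpha>"
  then have x: "x $ 1 \<in> {a<..<b}" by (simp add: mem_chart_box)
  have "linear (frechet_derivative Phi (at x))"
    unfolding frechet_derivative_at[OF Phi_has_derivative[OF x], symmetric]
    by (rule has_derivative_linear[OF Phi_has_derivative[OF x]])
  moreover have "h = 0" if "frechet_derivative Phi (at x) h = 0" for h
  proof -
    have "h $ 2 = 0" "cos (\<sigma> (x $ 1)) * h $ 1 = 0" "sqrt (4 + (u (x $ 1))\<^sup>2) / 2 * sin (\<sigma> (x $ 1)) * h $ 1 = 0"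
      using that u_pos[OF x] unfolding frechet_derivative_Phi[OF x] polar_vec_eq_0_iff by auto
    moreover have "sqrt (4 + (u (x $ 1))\<^sup>2) > 0" by (simp add: add_pos_nonneg)
    moreover have "cos (\<sigma> (x $ 1)) \<noteq> 0 \<or> sin (\<sigma> (x $ 1)) \<noteq> 0" using sin_zero_norm_cos_one[of "\<sigma> (x $ 1)"] by (metis norm_zero zero_neq_one)
    ultimately show ?thesis by (auto simp: vec_eq_iff forall_2)
  qed
  ultimately show "inj (frechet_derivative Phi (at x))" by (simp add: linear_injective_0)
qed auto

lemma sqrt_det_gram_Phi:
  assumes "x $ 1 \<in> {a<..<b}"
  shows "sqrt (det (gram Phi x)) = u (x $ 1) * sqrt (4 + (u (x $ 1))\<^sup>2) / 2"
proof -
  define C where "C = cos (\<sigma> (x $ 1))"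
  define S where "S = sin (\<sigma> (x $ 1))"
  define U where "U = u (x $ 1)"
  define q where "q = sqrt (4 + U\<^sup>2)"
  have q: "q * q = 4 + U * U" unfolding q_def by (simp add: power2_eq_square flip: power2_eq_square)
  have C: "C * C = 1 - S * S" unfolding C_def S_def by (simp add: sin_cos_squared)
  have p1: "Phi x $ 1 = U * cos (x $ 2)" by (simp add: Phi_def cylindrical_def U_def)
  have "det (gram Phi x) = (C * C + (q * S / 2) * (q * S / 2)) * (U * U + (U * U / 2) * (U * U / 2)) - (q * S / 2 * (U * U / 2)) * (q * S / 2 * (U * U / 2))"
    unfolding det_2 gram_def frechet_derivative_Phi[OF assms]
    unfolding C_def[symmetric] S_def[symmetric] U_def[symmetric] q_def[symmetric]
    by (simp add: nil_inner_polar_vec[OF p1] axis_def power2_eq_square)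
  also have "\<dots> = (U * U) * (C * C) * (1 + U * U / 4) + (q * q) * (S * S) * (U * U) / 4"
    by (simp add: algebra_simps)
  also have "\<dots> = (U * U) * (4 + U * U) / 4"
    unfolding C q by (simp add: algebra_simps)
  also have "\<dots> = (U * q / 2)\<^sup>2" unfolding q[symmetric] by (simp add: power2_eq_square)
  finally have "sqrt (det (gram Phi x)) = \<bar>U * q / 2\<bar>" by (simp add: real_sqrt_abs)
  moreover have "U * q / 2 \<ge> 0" using u_pos[OF assms] by (simp add: U_def q_def)
  ultimately show ?thesis by (simp add: U_def q_def)
qed

end

section \<open>Mean curvature from an orthonormal tangent frame\<close>

lemma smooth_along_has_derivative:
  assumes "smooth_along M n" "p \<in> M"
  shows "(n has_derivative frechet_derivative n (at p within M)) (at p within M)"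
proof -
  obtain W F where W: "open W" "p \<in> W" "smooth_on W F" "\<And>q. q \<in> M \<inter> W \<Longrightarrow> n q = F q"
    using assms unfolding smooth_along_def by metis
  then have "Ck_on (Suc 0) W F" by (simp only: smooth_on_def)
  then have "(F has_derivative frechet_derivative F (at p)) (at p)" using W(2) by (rule Ck_on_has_derivative)
  then have F: "(F has_derivative frechet_derivative F (at p)) (at p within M)" by (rule has_derivative_at_withinI)
  obtain d where d: "d > 0" "ball p d \<subseteq> W" using W(1,2) open_contains_ball by metis
  have "(n has_derivative frechet_derivative F (at p)) (at p within M)"
    by (rule has_derivative_transform_within[OF F d(1) assms(2)])
      (use W(4) d(2) in \<open>auto simp: subset_iff dist_commute\<close>)
  then show ?thesis
    unfolding frechet_derivative_works[symmetric] differentiable_def by blast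
qed

lemma smooth_along_continuous_on: "smooth_along M n \<Longrightarrow> continuous_on M n"
  using smooth_along_has_derivative has_derivative_continuous continuous_on_eq_continuous_within by blast

text \<open>The derivative of \<open>n\<close> within \<open>M\<close> is some linear map chosen among several, but the chain rule
  determines its value on the velocity of any curve in \<open>M\<close>. One-sided velocities are allowed for
  the meridians that end at a pole.\<close>

lemma shape_operator_along_curve:
  assumes "smooth_along M n" "t \<in> I" "at t within I \<noteq> bot" "\<And>s. s \<in> I \<Longrightarrow> c s \<in> M"
    and c: "(c has_vector_derivative X) (at t within I)"
    and Y: "((\<lambda>s. n (c s)) has_vector_derivative Y) (at t within I)"
  shows "shape_operator M n (c t) X = - (Y + connection_form (c t) X (n (c t)))"
proof -
  have "(n has_derivative frechet_derivative n (at (c t) within M)) (at (c t) within c ` I)"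
    by (rule has_derivative_subset[OF smooth_along_has_derivative[OF assms(1)]]) (use assms in auto)
  then have "((n \<circ> c) has_derivative frechet_derivative n (at (c t) within M) \<circ> (\<lambda>h. h *\<^sub>R X)) (at t within I)"
    by (rule diff_chain_within[OF c[unfolded has_vector_derivative_def]])
  moreover have "linear (frechet_derivative n (at (c t) within M))"
    using smooth_along_has_derivative[OF assms(1)] assms(2,4) has_derivative_linear by blast
  ultimately have "((\<lambda>s. n (c s)) has_vector_derivative frechet_derivative n (at (c t) within M) X) (at t within I)"
    by (simp add: has_vector_derivative_def o_def linear_scale)
  then have "frechet_derivative n (at (c t) within M) X = Y"
    using vector_derivative_unique_within[OF assms(3) _ Y] by blast
  then show ?thesis by (simp add: shape_operator_def)
qed

lemma shape_operator_combination:
  assumes "smooth_along M n" "p \<in> M"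
  shows "shape_operator M n p (x *\<^sub>R a + y *\<^sub>R b) = x *\<^sub>R shape_operator M n p a + y *\<^sub>R shape_operator M n p b"
proof -
  have "linear (frechet_derivative n (at p within M))"
    using smooth_along_has_derivative[OF assms] has_derivative_linear by blast
  then show ?thesis
    by (simp add: shape_operator_def connection_form_add connection_form_scaleR linear_add linear_scale algebra_simps)
qed

text \<open>One inclusion is orthogonality to \<open>n\<close>; the other holds because a single chart already contributes
  a two-dimensional space to the tangent plane.\<close>

lemma tangent_plane_eq_span:
  assumes M: "smooth_surface M" "p \<in> M" and n: "unit_normal_field M n"
    and perp: "\<And>a. nil_inner p (n p) a = 0 \<Longrightarrow> \<exists>x y. a = x *\<^sub>R T1 + y *\<^sub>R T2"
  shows "tangent_plane M p = {x *\<^sub>R T1 + y *\<^sub>R T2 | x y. True}"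
proof
  have sub: "tangent_plane M p \<subseteq> {x *\<^sub>R T1 + y *\<^sub>R T2 | x y. True}"
    using n M(2) perp unfolding unit_normal_field_def by blast
  then show "tangent_plane M p \<subseteq> {x *\<^sub>R T1 + y *\<^sub>R T2 | x y. True}" .
  obtain U \<phi> where "local_param M U \<phi>" "p \<in> \<phi> ` U" using M unfolding smooth_surface_def by blast
  then obtain x where *: "local_param M U \<phi>" "x \<in> U" "\<phi> x = p" by blast
  define D where "D = frechet_derivative \<phi> (at x)"
  have "Ck_on (Suc 0) U \<phi>" using * unfolding local_param_def smooth_on_def by blast
  then have "(\<phi> has_derivative D) (at x)" using *(2) unfolding D_def by (rule Ck_on_has_derivative)
  then have lin: "linear D" by (rule has_derivative_linear)
  have inj: "inj D" using * unfolding local_param_def D_def by blast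
  have D: "range D \<subseteq> tangent_plane M p" using * unfolding tangent_plane_def D_def by blast
  have span: "{x *\<^sub>R T1 + y *\<^sub>R T2 | x y. True} = span {T1, T2}"
  proof (rule Set.set_eqI)
    fix x
    have "x \<in> span {T1, T2} \<longleftrightarrow> (\<exists>k ka. x = ka *\<^sub>R T2 + k *\<^sub>R T1)" by (auto simp: span_breakdown_eq diff_eq_eq)
    also have "\<dots> \<longleftrightarrow> (\<exists>k ka. x = k *\<^sub>R T1 + ka *\<^sub>R T2)" by (simp only: add.commute)
    finally show "x \<in> {x *\<^sub>R T1 + y *\<^sub>R T2 | x y. True} \<longleftrightarrow> x \<in> span {T1, T2}" by auto
  qed
  have "range D = span {T1, T2}"
  proof (rule subspace_dim_equal)
    show "subspace (range D)" using lin by (simp add: linear_subspace_image)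
    show "range D \<subseteq> span {T1, T2}" using D sub span by blast
    have "dim (span {T1, T2}) \<le> card {T1, T2}" by (simp add: dim_le_card')
    also have "\<dots> \<le> 2" by (simp add: card_insert_if)
    also have "2 = dim (range D)" using dim_image_eq[OF lin, of UNIV] inj by simp
    finally show "dim (span {T1, T2}) \<le> dim (range D)" .
  qed simp
  then show "{x *\<^sub>R T1 + y *\<^sub>R T2 | x y. True} \<subseteq> tangent_plane M p" using D span by simp
qed

text \<open>Every orthonormal basis of eigenvectors gives the same trace, so the description of \<open>H\<close> is
  unambiguous once such a basis exists. It is obtained by turning \<open>T1, T2\<close> by half the angle of the
  vector \<open>((\<alpha> - \<gamma>) / 2, \<beta>)\<close>, which diagonalizes the symmetric matrix.\<close>

lemma mean_curvature_eqI:
  assumes n: "smooth_along M n" "p \<in> M"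
    and tp: "tangent_plane M p = {x *\<^sub>R T1 + y *\<^sub>R T2 | x y. True}"
    and on: "nil_inner p T1 T1 = 1" "nil_inner p T2 T2 = 1" "nil_inner p T1 T2 = 0"
    and S: "shape_operator M n p T1 = \<alpha> *\<^sub>R T1 + \<beta> *\<^sub>R T2" "shape_operator M n p T2 = \<beta> *\<^sub>R T1 + \<gamma> *\<^sub>R T2"
  shows "mean_curvature M n p = (\<alpha> + \<gamma>) / 2"
proof -
  let ?S = "shape_operator M n p"
  have ip: "nil_inner p (x *\<^sub>R T1 + y *\<^sub>R T2) (x' *\<^sub>R T1 + y' *\<^sub>R T2) = x * x' + y * y'" for x y x' y'
    using on nil_inner_commute[of p T2 T1]
    by (simp add: nil_inner_add_left nil_inner_add_right nil_inner_scaleR_left nil_inner_scaleR_right)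
  have SS: "?S (x *\<^sub>R T1 + y *\<^sub>R T2) = (x * \<alpha> + y * \<beta>) *\<^sub>R T1 + (x * \<beta> + y * \<gamma>) *\<^sub>R T2" for x y
    unfolding shape_operator_combination[OF n] S by (simp add: algebra_simps)
  have trace: "k1 + k2 = \<alpha> + \<gamma>" if pc: "principal_curvatures M n p k1 k2" for k1 k2
  proof -
    obtain t1 t2 where tt: "t1 \<in> tangent_plane M p" "t2 \<in> tangent_plane M p" "nil_inner p t1 t1 = 1" "nil_inner p t2 t2 = 1"
      "nil_inner p t1 t2 = 0" "?S t1 = k1 *\<^sub>R t1" "?S t2 = k2 *\<^sub>R t2"
      using pc unfolding principal_curvatures_def by blast
    then obtain x1 y1 x2 y2 where xy: "t1 = x1 *\<^sub>R T1 + y1 *\<^sub>R T2" "t2 = x2 *\<^sub>R T1 + y2 *\<^sub>R T2"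
      unfolding tp by blast
    note t = tt(3-)[unfolded xy]
    have "k1 = nil_inner p (?S (x1 *\<^sub>R T1 + y1 *\<^sub>R T2)) (x1 *\<^sub>R T1 + y1 *\<^sub>R T2)"
      "k2 = nil_inner p (?S (x2 *\<^sub>R T1 + y2 *\<^sub>R T2)) (x2 *\<^sub>R T1 + y2 *\<^sub>R T2)"
      unfolding t(4,5) nil_inner_scaleR_left using t(1,2) by simp_all
    then have k: "k1 = (x1 * \<alpha> + y1 * \<beta>) * x1 + (x1 * \<beta> + y1 * \<gamma>) * y1" "k2 = (x2 * \<alpha> + y2 * \<beta>) * x2 + (x2 * \<beta> + y2 * \<gamma>) * y2"
      unfolding SS ip by simp_all
    have o: "x1 * x1 + y1 * y1 = 1" "x2 * x2 + y2 * y2 = 1" "x1 * x2 + y1 * y2 = 0" using t(1-3) unfolding ip by simp_all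
    (* the determinant of the change of basis; it is 1 or -1, and then rows and columns are orthonormal *)
    define k where "k = x1 * y2 - y1 * x2"
    have "k * k = (x1 * x1 + y1 * y1) * (x2 * x2 + y2 * y2) - (x1 * x2 + y1 * y2) * (x1 * x2 + y1 * y2)"
      unfolding k_def by (simp add: algebra_simps)
    then have kk: "k * k = 1" unfolding o by simp
    have "y2 * k = x1 * (x2 * x2 + y2 * y2) - x2 * (x1 * x2 + y1 * y2)"
      "- (x2 * k) = y1 * (x2 * x2 + y2 * y2) - y2 * (x1 * x2 + y1 * y2)"
      unfolding k_def by (simp_all add: algebra_simps)
    then have xy1: "x1 = y2 * k" "y1 = - (x2 * k)" unfolding o by simp_all
    have "x1 * x1 = y2 * y2 * (k * k)" "y1 * y1 = x2 * x2 * (k * k)" "x1 * y1 = - (x2 * y2) * (k * k)"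
      unfolding xy1 by (simp_all add: algebra_simps)
    then have "x1 * x1 + x2 * x2 = 1" "y1 * y1 + y2 * y2 = 1" "x1 * y1 + x2 * y2 = 0"
      using o(2) unfolding kk by (simp_all add: algebra_simps)
    moreover have "k1 + k2 = \<alpha> * (x1 * x1 + x2 * x2) + 2 * \<beta> * (x1 * y1 + x2 * y2) + \<gamma> * (y1 * y1 + y2 * y2)"
      unfolding k by (simp add: algebra_simps)
    ultimately show ?thesis by simp
  qed
  have "\<exists>k1 k2. principal_curvatures M n p k1 k2"
  proof -
    define A where "A = (\<alpha> - \<gamma>) / 2"
    define R where "R = sqrt (A\<^sup>2 + \<beta>\<^sup>2)"
    obtain \<psi> where psi: "A = R * cos \<psi>" "\<beta> = R * sin \<psi>"
    proof (cases "R = 0")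
      case True
      then have "A\<^sup>2 + \<beta>\<^sup>2 = 0" unfolding R_def by simp
      then have "A = 0" "\<beta> = 0" unfolding sum_power2_eq_zero_iff by auto
      then show ?thesis using that True by simp
    next
      case False
      have "R\<^sup>2 = A\<^sup>2 + \<beta>\<^sup>2" unfolding R_def by (rule real_sqrt_pow2) simp
      then have "(A / R)\<^sup>2 + (\<beta> / R)\<^sup>2 = R\<^sup>2 / R\<^sup>2" by (simp only: power_divide add_divide_distrib)
      then have "(A / R)\<^sup>2 + (\<beta> / R)\<^sup>2 = 1" using False by simp
      then obtain t where "A / R = cos t" "\<beta> / R = sin t" using sincos_total_2pi by metis
      then show ?thesis using that[of t] False by (simp add: field_simps)
    qed
    define c where "c = cos (\<psi> / 2)"
    define s where "s = sin (\<psi> / 2)"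
    have cs: "c * c + s * s = 1" unfolding c_def s_def by (simp add: sin_cos_squared)
    have "cos \<psi> = c * c - s * s" "sin \<psi> = 2 * s * c"
      using cos_double[of "\<psi> / 2"] sin_double[of "\<psi> / 2"] by (simp_all add: c_def s_def power2_eq_square)
    then have off: "\<alpha> = \<gamma> + 2 * R * (c * c - s * s)" "\<beta> = R * (2 * s * c)" using psi by (simp_all add: A_def)
    define t1 where "t1 = c *\<^sub>R T1 + s *\<^sub>R T2"
    define t2 where "t2 = (- s) *\<^sub>R T1 + c *\<^sub>R T2"
    have "t1 \<in> tangent_plane M p" "t2 \<in> tangent_plane M p" unfolding tp t1_def t2_def by blast+
    moreover have "nil_inner p t1 t1 = 1" "nil_inner p t2 t2 = 1" "nil_inner p t1 t2 = 0"
      unfolding t1_def t2_def ip using cs by simp_all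
    moreover have "?S t1 = (\<gamma> + 2 * R * c * c) *\<^sub>R t1" "?S t2 = (\<gamma> - 2 * R * s * s) *\<^sub>R t2"
      unfolding t1_def t2_def SS scaleR_add_right scaleR_scaleR
      by (rule arg_cong2[where f = "\<lambda>x y. x *\<^sub>R T1 + y *\<^sub>R T2"]; simp add: off algebra_simps)+
    ultimately have "principal_curvatures M n p (\<gamma> + 2 * R * c * c) (\<gamma> - 2 * R * s * s)"
      unfolding principal_curvatures_def by blast
    then show ?thesis by blast
  qed
  then show ?thesis
    unfolding mean_curvature_def using trace by (intro the_equality) metis+
qed

section \<open>The shape operator of a surface of revolution\<close>

text \<open>The cross product of the velocities of meridian and orbit at distance \<open>r\<close> from the axis, with
  \<open>s\<close> the angle of the profile, normalized. The velocity of the orbit vanishes at \<open>r = 0\<close>, but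
  its direction has a limit there, and so does the normal.\<close>

definition revolution_normal :: "real \<Rightarrow> real \<Rightarrow> real \<Rightarrow> real^3" where
  "revolution_normal \<theta> r s = polar_vec \<theta> r (- sin s) (cos s * r / sqrt (4 + r\<^sup>2)) (2 * cos s / sqrt (4 + r\<^sup>2))"

lemma connection_form_scaleR_right: "connection_form p a (c *\<^sub>R b) = c *\<^sub>R connection_form p a b"
  by (simp add: connection_form_eq vec_eq_iff forall_3 field_simps)

lemma cylindrical_1: "cylindrical r \<theta> h $ 1 = r * cos \<theta>"
  by (simp add: cylindrical_def)

text \<open>The interval \<open>I\<close> may contain \<open>s\<close> as an end, so that the formula also covers the
  poles, where the meridians are the only curves at hand.\<close>

lemma shape_operator_meridian:
  fixes u v \<sigma> :: "real \<Rightarrow> real" and s \<theta> :: real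
  defines "C \<equiv> cos (\<sigma> s)" and "S \<equiv> sin (\<sigma> s)" and "q \<equiv> sqrt (4 + (u s)\<^sup>2)"
  assumes n: "smooth_along M n" "s \<in> I" "at s within I \<noteq> bot"
    and M: "\<And>t. t \<in> I \<Longrightarrow> cylindrical (u t) \<theta> (v t) \<in> M"
    and neq: "\<And>t. t \<in> I \<Longrightarrow> n (cylindrical (u t) \<theta> (v t)) = \<epsilon> *\<^sub>R revolution_normal \<theta> (u t) (\<sigma> t)"
    and du: "(u has_real_derivative C) (at s within I)"
    and dv: "(v has_real_derivative q / 2 * S) (at s within I)"
    and ds: "(\<sigma> has_real_derivative \<sigma>') (at s within I)"
  shows "shape_operator M n (cylindrical (u s) \<theta> (v s)) (polar_vec \<theta> (u s) C 0 (q * S / 2)) =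
    polar_vec \<theta> (u s) (\<epsilon> * (C * \<sigma>' - S * C * u s / 4))
      (\<epsilon> * (S * \<sigma>' * u s / q - 4 * C\<^sup>2 / q ^ 3 + C\<^sup>2 / q - q * S\<^sup>2 / 4))
      (\<epsilon> * (2 * S * \<sigma>' / q + 2 * u s * C\<^sup>2 / q ^ 3 - C\<^sup>2 * u s / (2 * q)))"
proof -
  have qpos: "q > 0" by (simp add: q_def add_pos_nonneg)
  have q2: "q\<^sup>2 = 4 + (u s)\<^sup>2" by (simp add: q_def)
  have dq: "((\<lambda>t. sqrt (4 + (u t)\<^sup>2)) has_real_derivative u s * C / q) (at s within I)"
    using qpos by (auto intro!: derivative_eq_intros du simp: q_def field_simps)
  have dS: "((\<lambda>t. - sin (\<sigma> t)) has_real_derivative - (C * \<sigma>')) (at s within I)"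
    by (auto intro!: derivative_eq_intros ds simp: C_def)
  have dC: "((\<lambda>t. cos (\<sigma> t)) has_real_derivative - S * \<sigma>') (at s within I)"
    by (auto intro!: derivative_eq_intros ds simp: S_def)
  have q0: "sqrt (4 + (u s)\<^sup>2) \<noteq> 0" using qpos by (simp add: q_def)
  have db: "((\<lambda>t. cos (\<sigma> t) * u t / sqrt (4 + (u t)\<^sup>2)) has_real_derivative
      ((C * C - S * \<sigma>' * u s) * q - C * u s * (u s * C / q)) / (q * q)) (at s within I)"
    by (rule DERIV_cong[OF DERIV_divide[OF DERIV_mult[OF dC du] dq q0]]) (simp add: C_def q_def)
  have dd: "((\<lambda>t. 2 * cos (\<sigma> t) / sqrt (4 + (u t)\<^sup>2)) has_real_derivative
      (- 2 * S * \<sigma>' * q - 2 * C * (u s * C / q)) / (q * q)) (at s within I)"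
    by (rule DERIV_cong[OF DERIV_divide[OF DERIV_cmult[OF dC] dq q0]]) (simp add: C_def q_def)
  have dN: "((\<lambda>t. revolution_normal \<theta> (u t) (\<sigma> t)) has_vector_derivative
      polar_vec \<theta> (u s) (- (C * \<sigma>')) (((C * C - S * \<sigma>' * u s) * q - C * u s * (u s * C / q)) / (q * q))
        ((- 2 * S * \<sigma>' * q - 2 * C * (u s * C / q)) / (q * q))
      + vector [0, 0, C * cos \<theta> * (- S * sin \<theta> + C * u s / q * cos \<theta>)]) (at s within I)"
    unfolding revolution_normal_def
    using polar_vec_has_derivative[OF DERIV_const du dS db dd refl, of \<theta>] by (simp add: C_def S_def q_def)
  have Y: "((\<lambda>t. n (cylindrical (u t) \<theta> (v t))) has_vector_derivative
      \<epsilon> *\<^sub>R (polar_vec \<theta> (u s) (- (C * \<sigma>')) (((C * C - S * \<sigma>' * u s) * q - C * u s * (u s * C / q)) / (q * q))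
        ((- 2 * S * \<sigma>' * q - 2 * C * (u s * C / q)) / (q * q))
      + vector [0, 0, C * cos \<theta> * (- S * sin \<theta> + C * u s / q * cos \<theta>)])) (at s within I)"
    by (rule has_vector_derivative_transform[OF n(2) _ bounded_linear.has_vector_derivative[OF bounded_linear_scaleR_right dN]])
      (simp add: neq)
  have X: "((\<lambda>t. cylindrical (u t) \<theta> (v t)) has_vector_derivative polar_vec \<theta> (u s) C 0 (q * S / 2)) (at s within I)"
    unfolding has_vector_derivative_def polar_vec_scaleR
    using cylindrical_has_derivative[OF du[unfolded has_field_derivative_def] has_derivative_const dv[unfolded has_field_derivative_def], of \<theta>]
    by (simp add: mult.commute mult.left_commute)
  have N: "n (cylindrical (u s) \<theta> (v s)) = \<epsilon> *\<^sub>R polar_vec \<theta> (u s) (- S) (C * u s / q) (2 * C / q)"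
    using neq[OF n(2)] by (simp add: revolution_normal_def C_def S_def q_def)
  have b: "((C * C - S * \<sigma>' * u s) * q - C * u s * (u s * C / q)) / (q * q) = 4 * C\<^sup>2 / q ^ 3 - S * \<sigma>' * u s / q"
    "(- 2 * S * \<sigma>' * q - 2 * C * (u s * C / q)) / (q * q) = - 2 * S * \<sigma>' / q - 2 * u s * C\<^sup>2 / q ^ 3"
  proof -
    have "C * C * q * q - C * C * (u s)\<^sup>2 = 4 * C\<^sup>2" using q2 by (simp add: power2_eq_square algebra_simps)
    then show "((C * C - S * \<sigma>' * u s) * q - C * u s * (u s * C / q)) / (q * q) = 4 * C\<^sup>2 / q ^ 3 - S * \<sigma>' * u s / q"
      using qpos by (simp add: field_simps power2_eq_square power3_eq_cube)
    show "(- 2 * S * \<sigma>' * q - 2 * C * (u s * C / q)) / (q * q) = - 2 * S * \<sigma>' / q - 2 * u s * C\<^sup>2 / q ^ 3"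
      using qpos by (simp add: field_simps power2_eq_square power3_eq_cube)
  qed
  have "shape_operator M n (cylindrical (u s) \<theta> (v s)) (polar_vec \<theta> (u s) C 0 (q * S / 2)) =
    - (\<epsilon> *\<^sub>R (polar_vec \<theta> (u s) (- (C * \<sigma>')) (4 * C\<^sup>2 / q ^ 3 - S * \<sigma>' * u s / q) (- 2 * S * \<sigma>' / q - 2 * u s * C\<^sup>2 / q ^ 3)
      + polar_vec \<theta> (u s) (q * S / 2 * (C * u s / q) / 2) (- (C * (2 * C / q) + q * S / 2 * (- S)) / 2) (C * (C * u s / q) / 2)))"
    using shape_operator_along_curve[OF n(1,2,3) M X Y] unfolding N b connection_form_scaleR_right
      connection_form_polar_vec[OF cylindrical_1]
    by (simp add: algebra_simps flip: scaleR_add_right scaleR_diff_right)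
  also have "\<dots> = polar_vec \<theta> (u s) (\<epsilon> * (C * \<sigma>' - S * C * u s / 4))
      (\<epsilon> * (S * \<sigma>' * u s / q - 4 * C\<^sup>2 / q ^ 3 + C\<^sup>2 / q - q * S\<^sup>2 / 4))
      (\<epsilon> * (2 * S * \<sigma>' / q + 2 * u s * C\<^sup>2 / q ^ 3 - C\<^sup>2 * u s / (2 * q)))"
    unfolding polar_vec_add polar_vec_scaleR polar_vec_minus
    using qpos by (intro arg_cong3[where f = "polar_vec \<theta> (u s)"]) (simp_all add: field_simps power2_eq_square)
  finally show ?thesis .
qed

lemma shape_operator_parallel:
  fixes r h s \<theta> :: real
  defines "C \<equiv> cos s" and "S \<equiv> sin s" and "q \<equiv> sqrt (4 + r\<^sup>2)"
  assumes n: "smooth_along M n"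
    and M: "\<And>t. cylindrical r t h \<in> M"
    and neq: "\<And>t. n (cylindrical r t h) = \<epsilon> *\<^sub>R revolution_normal t r s"
  shows "shape_operator M n (cylindrical r \<theta> h) (polar_vec \<theta> r 0 r (- (r\<^sup>2 / 2))) =
    polar_vec \<theta> r (\<epsilon> * (C * r ^ 3 / (4 * q))) (\<epsilon> * (S * q\<^sup>2 / 4)) (- (\<epsilon> * (r * S / 2)))"
proof -
  have qpos: "q > 0" by (simp add: q_def add_pos_nonneg)
  have q2: "q\<^sup>2 = 4 + r\<^sup>2" by (simp add: q_def)
  have Y: "((\<lambda>t. n (cylindrical r t h)) has_vector_derivative
      \<epsilon> *\<^sub>R (polar_vec \<theta> r (- (C * r / q)) (- S) 0 + vector [0, 0, (- r * sin \<theta>) * (- S * sin \<theta> + C * r / q * cos \<theta>)])) (at \<theta>)"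
  proof -
    have "((\<lambda>t. polar_vec t r (- S) (C * r / q) (2 * C / q)) has_vector_derivative
      polar_vec \<theta> r (0 - C * r / q * 1) (0 + - S * 1) 0 + vector [0, 0, (0 * cos \<theta> - r * 1 * sin \<theta>) * (- S * sin \<theta> + C * r / q * cos \<theta>)]) (at \<theta>)"
      by (rule polar_vec_has_derivative[OF DERIV_ident DERIV_const DERIV_const DERIV_const DERIV_const refl])
    then have "((\<lambda>t. polar_vec t r (- S) (C * r / q) (2 * C / q)) has_vector_derivative
      polar_vec \<theta> r (- (C * r / q)) (- S) 0 + vector [0, 0, (- r * sin \<theta>) * (- S * sin \<theta> + C * r / q * cos \<theta>)]) (at \<theta>)"
      by simp
    then show ?thesis
      unfolding neq revolution_normal_def C_def S_def q_def
      by (rule bounded_linear.has_vector_derivative[OF bounded_linear_scaleR_right])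
  qed
  have X: "((\<lambda>t. cylindrical r t h) has_vector_derivative polar_vec \<theta> r 0 r (- (r\<^sup>2 / 2))) (at \<theta>)"
  proof -
    have "((\<lambda>t. cylindrical r t h) has_derivative (\<lambda>k. polar_vec \<theta> r 0 (r * k) (0 - r\<^sup>2 / 2 * k))) (at \<theta>)"
      by (rule cylindrical_has_derivative[OF has_derivative_const has_derivative_ident has_derivative_const])
    then show ?thesis
      unfolding has_vector_derivative_def polar_vec_scaleR by (simp add: mult.commute)
  qed
  have N: "n (cylindrical r \<theta> h) = \<epsilon> *\<^sub>R polar_vec \<theta> r (- S) (C * r / q) (2 * C / q)"
    using neq by (simp add: revolution_normal_def C_def S_def q_def)
  have "shape_operator M n (cylindrical r \<theta> h) (polar_vec \<theta> r 0 r (- (r\<^sup>2 / 2))) =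
    - (\<epsilon> *\<^sub>R (polar_vec \<theta> r (- (C * r / q)) (- S) 0
      + polar_vec \<theta> r ((r * (2 * C / q) + - (r\<^sup>2 / 2) * (C * r / q)) / 2) (- (- (r\<^sup>2 / 2) * (- S)) / 2) ((- (r * (- S))) / 2)))"
    using shape_operator_along_curve[OF n UNIV_I _ M X Y] unfolding N connection_form_scaleR_right
      connection_form_polar_vec[OF cylindrical_1]
    by (simp add: algebra_simps flip: scaleR_add_right scaleR_diff_right)
  also have "\<dots> = polar_vec \<theta> r (\<epsilon> * (C * r ^ 3 / (4 * q))) (\<epsilon> * (S * q\<^sup>2 / 4)) (- (\<epsilon> * (r * S / 2)))"
    unfolding polar_vec_add polar_vec_scaleR polar_vec_minus q2
    using qpos by (intro arg_cong3[where f = "polar_vec \<theta> r"]) (simp_all add: field_simps power2_eq_square power3_eq_cube)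
  finally show ?thesis .
qed

section \<open>Normal and mean curvature away from the axis\<close>

locale oriented_piece = profile_piece +
  fixes n :: "nil \<Rightarrow> real^3"
  assumes surface: "smooth_surface M" and normal: "unit_normal_field M n"
begin

lemma smooth_along_normal: "smooth_along M n"
  using normal by (simp add: unit_normal_field_def)

lemma normal_eq_revolution_normal:
  fixes s \<theta> :: real
  defines "p \<equiv> cylindrical (u s) \<theta> (v s)" and "N \<equiv> revolution_normal \<theta> (u s) (\<sigma> s)"
  assumes s: "s \<in> {a<..<b}"
  shows "n p = nil_inner p (n p) N *\<^sub>R N" "nil_inner p (n p) N \<in> {1, -1}"
proof -
  define C where "C = cos (\<sigma> s)"
  define S where "S = sin (\<sigma> s)"
  define q where "q = sqrt (4 + (u s)\<^sup>2)"
  define x :: "real^2" where "x = vector [s, \<theta>]"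
  have x: "x \<in> chart_box \<theta>" "Phi x = p" "x $ 1 = s" "x $ 2 = \<theta>"
    using s by (simp_all add: mem_chart_box x_def Phi_def p_def)
  have pM: "p \<in> M" unfolding p_def using s by (intro Phi_mem) auto
  have qpos: "q > 0" by (simp add: q_def add_pos_nonneg)
  have q2: "q * q = 4 + u s * u s" by (simp add: q_def flip: power2_eq_square)
  have CS: "C * C + S * S = 1" by (simp add: C_def S_def sin_cos_squared)
  have p1: "p $ 1 = u s * cos \<theta>" by (simp add: p_def cylindrical_1)
  obtain \<alpha> \<beta> \<delta> where np: "n p = polar_vec \<theta> (u s) \<alpha> \<beta> \<delta>" by (rule polar_vec_exhaust)
  have perp: "nil_inner p (n p) (frechet_derivative Phi (at x) h) = 0" for h
    using normal pM local_param_Phi[of \<theta>] x unfolding unit_normal_field_def tangent_plane_def by blast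
  have unit: "\<alpha> * \<alpha> + \<beta> * \<beta> + \<delta> * \<delta> = 1"
    using normal pM unfolding unit_normal_field_def np[symmetric] nil_inner_polar_vec[OF p1, symmetric] by blast
  have "\<alpha> * C + \<delta> * (q * S / 2) = 0" "\<beta> * u s - \<delta> * ((u s)\<^sup>2 / 2) = 0"
    using perp[of "axis 1 1"] perp[of "axis 2 1"] s
    by (simp_all add: np frechet_derivative_Phi x nil_inner_polar_vec[OF p1] axis_def C_def S_def q_def)
  (* (alpha, k) is orthogonal to (C, S), hence a multiple e of (- S, C) *)
  define k where "k = \<delta> * q / 2"
  have 1: "\<alpha> * C = - (k * S)" using \<open>\<alpha> * C + \<delta> * (q * S / 2) = 0\<close> by (simp add: k_def)
  have "u s * \<beta> = u s * (\<delta> * u s / 2)" using \<open>\<beta> * u s - \<delta> * ((u s)\<^sup>2 / 2) = 0\<close> by (simp add: power2_eq_square algebra_simps)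
  then have 2: "\<beta> = \<delta> * u s / 2" using u_pos[OF s] by simp
  define e where "e = nil_inner p (n p) N"
  have e_sum: "e = - (\<alpha> * S) + \<beta> * (C * u s / q) + \<delta> * (2 * C / q)"
    by (simp add: e_def np N_def revolution_normal_def nil_inner_polar_vec[OF p1] C_def S_def q_def)
  have "\<beta> * (C * u s / q) + \<delta> * (2 * C / q) = \<delta> * C * (u s * u s + 4) / (2 * q)"
    unfolding 2 using qpos by (simp add: field_simps)
  also have "u s * u s + 4 = q * q" using q2 by simp
  also have "\<delta> * C * (q * q) / (2 * q) = k * C" using qpos by (simp add: k_def field_simps)
  finally have e: "e = - (\<alpha> * S) + k * C" using e_sum by linarith
  have a0: "\<alpha> = - ((- (\<alpha> * S) + k * C) * S)"
  proof -
    have "\<alpha> - (- ((- (\<alpha> * S) + k * C) * S)) = (C) * (\<alpha> * C - (- (k * S))) + (- (\<alpha>)) * (C * C + S * S - (1))"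
      by (simp add: field_simps)
    then show ?thesis unfolding 1 CS by simp
  qed
  have k0: "k = (- (\<alpha> * S) + k * C) * C"
  proof -
    have "k - ((- (\<alpha> * S) + k * C) * C) = (S) * (\<alpha> * C - (- (k * S))) + (- (k)) * (C * C + S * S - (1))"
      by (simp add: field_simps)
    then show ?thesis unfolding 1 CS by simp
  qed
  have e0: "(- (\<alpha> * S) + k * C) * (- (\<alpha> * S) + k * C) = \<alpha> * \<alpha> + k * k"
  proof -
    have "(- (\<alpha> * S) + k * C) * (- (\<alpha> * S) + k * C) - (\<alpha> * \<alpha> + k * k) = (- (S * k) - C * \<alpha>) * (\<alpha> * C - (- (k * S))) + (\<alpha> * \<alpha> + k * k) * (C * C + S * S - (1))"
      by (simp add: field_simps)
    then show ?thesis unfolding 1 CS by simp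
  qed
  have a: "\<alpha> = - (e * S)" and ek: "k = e * C" using a0 k0 unfolding e by simp_all
  have d: "\<delta> = e * (2 * C / q)" using ek qpos by (simp add: k_def field_simps)
  have b: "\<beta> = e * (C * u s / q)" unfolding 2 d by simp
  have "n p = e *\<^sub>R N"
    unfolding np N_def revolution_normal_def polar_vec_scaleR
    by (simp add: a b d C_def S_def q_def)
  then show "n p = nil_inner p (n p) N *\<^sub>R N" unfolding e_def .
  have "\<beta> * \<beta> + \<delta> * \<delta> = \<delta> * \<delta> * (4 + u s * u s) / 4"
    unfolding 2 by (simp add: field_simps)
  also have "\<dots> = k * k" unfolding k_def q2[symmetric] by (simp add: field_simps)
  finally have "e\<^sup>2 = 1" using e0 unit unfolding e by (simp add: power2_eq_square)
  then show "nil_inner p (n p) N \<in> {1, -1}" unfolding e_def[symmetric] by (simp add: power2_eq_1_iff)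
qed

lemma continuous_on_profile_interior:
  "continuous_on {a<..<b} u" "continuous_on {a<..<b} v" "continuous_on {a<..<b} \<sigma>"
proof -
  show "continuous_on {a<..<b} u" "continuous_on {a<..<b} v"
    using cont_u cont_v by (auto elim!: continuous_on_subset)
  show "continuous_on {a<..<b} \<sigma>"
    using smooth_\<sigma> unfolding smooth_interval_def continuous_on_eq_continuous_within
    by (metis DERIV_continuous)
qed

text \<open>The sign is a continuous function on the strip of all parameters \<open>(s, \<theta>)\<close>, and the strip is
  connected even where the surface closes up.\<close>

lemma normal_sign:
  obtains \<epsilon> where "\<epsilon> = 1 \<or> \<epsilon> = -1"
    "\<And>s \<theta>. s \<in> {a<..<b} \<Longrightarrow> n (cylindrical (u s) \<theta> (v s)) = \<epsilon> *\<^sub>R revolution_normal \<theta> (u s) (\<sigma> s)"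
proof -
  define e where "e = (\<lambda>(s, \<theta>). nil_inner (cylindrical (u s) \<theta> (v s)) (n (cylindrical (u s) \<theta> (v s))) (revolution_normal \<theta> (u s) (\<sigma> s)))"
  let ?D = "{a<..<b} \<times> (UNIV :: real set)"
  have c: "continuous_on ?D (\<lambda>x. u (fst x))" "continuous_on ?D (\<lambda>x. v (fst x))" "continuous_on ?D (\<lambda>x. \<sigma> (fst x))"
    by (auto intro!: continuous_on_compose2[OF continuous_on_profile_interior(1)] continuous_on_compose2[OF continuous_on_profile_interior(2)]
        continuous_on_compose2[OF continuous_on_profile_interior(3)] continuous_intros)
  have q0: "sqrt (4 + (u s)\<^sup>2) \<noteq> 0" for s using add_pos_nonneg[of 4 "(u s)\<^sup>2"] by simp
  have cyl: "continuous_on ?D (\<lambda>x. cylindrical (u (fst x)) (snd x) (v (fst x)))"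
    unfolding cylindrical_def by (intro continuous_on_vector_3 continuous_intros c) auto
  have N: "continuous_on ?D (\<lambda>x. revolution_normal (snd x) (u (fst x)) (\<sigma> (fst x)))"
    unfolding revolution_normal_def polar_vec_def
    by (intro continuous_on_vector_3 continuous_intros c) (use q0 in auto)
  have nn: "continuous_on ?D (\<lambda>x. n (cylindrical (u (fst x)) (snd x) (v (fst x))))"
    by (rule continuous_on_compose2[OF smooth_along_continuous_on[OF smooth_along_normal] cyl]) (auto intro: Phi_mem)
  have "continuous_on ?D e"
    unfolding e_def case_prod_unfold nil_inner_def
    by (intro continuous_intros cyl N nn)
  moreover have "connected ?D" by (intro connected_Times) auto
  moreover have "e ` ?D \<subseteq> {1, -1}" using normal_eq_revolution_normal(2) unfolding e_def by fast
  then have "finite (e ` ?D)" by (rule finite_subset) simp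
  ultimately obtain \<epsilon> where \<epsilon>: "\<And>x. x \<in> ?D \<Longrightarrow> e x = \<epsilon>"
    using continuous_finite_range_constant[of ?D e] unfolding constant_on_def by blast
  show ?thesis
  proof
    have "((a + b) / 2, 0) \<in> ?D" using ab by (auto simp: field_simps)
    then show "\<epsilon> = 1 \<or> \<epsilon> = -1" using \<epsilon> \<open>e ` ?D \<subseteq> {1, -1}\<close> by (metis imageI insert_iff singletonD subsetD)
    fix s \<theta> assume s: "s \<in> {a<..<b}"
    then have "e (s, \<theta>) = \<epsilon>" using \<epsilon> by blast
    then show "n (cylindrical (u s) \<theta> (v s)) = \<epsilon> *\<^sub>R revolution_normal \<theta> (u s) (\<sigma> s)"
      using normal_eq_revolution_normal(1)[OF s, of \<theta>] by (simp add: e_def)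
  qed
qed

lemma deriv_\<sigma>: "s \<in> {a<..<b} \<Longrightarrow> (\<sigma> has_real_derivative deriv \<sigma> s) (at s)"
  using smooth_\<sigma> unfolding smooth_interval_def
  by (metis DERIV_imp_deriv at_within_open open_greaterThanLessThan)

text \<open>The orthonormal frame consists of the unit vector \<open>T2\<close> along the orbit and its
  complement \<open>T1\<close> in the tangent plane. In it the shape operator has the diagonal entries
  \<open>\<sigma>' - u sin \<sigma> / q\<^sup>2\<close> and \<open>sin \<sigma> / u + u sin \<sigma> / q\<^sup>2\<close> and is not diagonal; the extra terms cancel
  in the trace.

  With \<open>r = 1 / q\<close> and \<open>w = 1 / U\<close> every equation needed is polynomial and holds modulo the
  relations \<open>C\<^sup>2 + S\<^sup>2 = 1\<close>, \<open>r\<^sup>2 (4 + U\<^sup>2) = 1\<close>, \<open>q = r (4 + U\<^sup>2)\<close> and \<open>U w = 1\<close>. Each is proved by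
  writing the difference of its sides as a combination of these relations with explicit cofactors.\<close>

lemma mean_curvature_interior:
  assumes s: "s \<in> {a<..<b}" and \<epsilon>: "\<epsilon> = 1 \<or> \<epsilon> = -1"
    and neq: "\<And>s \<theta>. s \<in> {a<..<b} \<Longrightarrow> n (cylindrical (u s) \<theta> (v s)) = \<epsilon> *\<^sub>R revolution_normal \<theta> (u s) (\<sigma> s)"
  shows "mean_curvature M n (cylindrical (u s) \<theta> (v s)) = \<epsilon> * (deriv \<sigma> s + sin (\<sigma> s) / u s) / 2"
proof -
  define C where "C = cos (\<sigma> s)"
  define S where "S = sin (\<sigma> s)"
  define U where "U = u s"
  define r where "r = 1 / sqrt (4 + U\<^sup>2)"
  define q where "q = sqrt (4 + U\<^sup>2)"
  define D where "D = deriv \<sigma> s"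
  define w where "w = 1 / U"
  define p where "p = cylindrical U \<theta> (v s)"
  have U: "U > 0" using u_pos[OF s] by (simp add: U_def)
  have qpos: "q > 0" by (simp add: q_def add_pos_nonneg)
  have q2: "q * q = 4 + U * U" by (simp add: q_def flip: power2_eq_square)
  have rq: "r * q = 1" using qpos by (simp add: r_def q_def)
  have r2: "r * r * (4 + U * U) = 1" unfolding q2[symmetric] using rq by (metis mult.assoc mult.commute mult_1)
  have qd: "q = r * (4 + U * U)" unfolding q2[symmetric] using rq by (metis mult.assoc mult_1)
  have Uw: "U * w = 1" using U by (simp add: w_def)
  have CS: "C * C + S * S = 1" by (simp add: C_def S_def sin_cos_squared)
  have p1: "p $ 1 = U * cos \<theta>" by (simp add: p_def cylindrical_1)
  have pM: "p \<in> M" unfolding p_def U_def using s by (intro Phi_mem) auto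
  define T1 where "T1 = polar_vec \<theta> U C (U * S * r) (2 * S * r)"
  define T2 where "T2 = polar_vec \<theta> U 0 (2 * r) (- (U * r))"
  have on1: "C * C + (U * S * r) * (U * S * r) + (2 * S * r) * (2 * S * r) = 1"
  proof -
    have "C * C + (U * S * r) * (U * S * r) + (2 * S * r) * (2 * S * r) - (1) = (S * S) * (r * r * (4 + U * U) - (1)) + (1) * (C * C + S * S - (1))"
      by (simp add: field_simps)
    then show ?thesis unfolding r2 CS by simp
  qed
  have on2: "(2 * r) * (2 * r) + (U * r) * (U * r) = 1"
  proof -
    have "(2 * r) * (2 * r) + (U * r) * (U * r) - (1) = (1) * (r * r * (4 + U * U) - (1))"
      by (simp add: field_simps)
    then show ?thesis unfolding r2 by simp
  qed
  have on: "nil_inner p T1 T1 = 1" "nil_inner p T2 T2 = 1" "nil_inner p T1 T2 = 0"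
    unfolding T1_def T2_def nil_inner_polar_vec[OF p1] using on1 on2 by simp_all
  have np: "n p = \<epsilon> *\<^sub>R polar_vec \<theta> U (- S) (C * U * r) (2 * C * r)"
    using neq[OF s, of \<theta>] by (simp add: p_def U_def revolution_normal_def C_def S_def r_def)
  have tp: "tangent_plane M p = {x *\<^sub>R T1 + y *\<^sub>R T2 | x y. True}"
  proof (rule tangent_plane_eq_span[OF surface pM normal])
    fix t assume t: "nil_inner p (n p) t = 0"
    obtain \<alpha> \<beta> \<delta> where td: "t = polar_vec \<theta> U \<alpha> \<beta> \<delta>" by (rule polar_vec_exhaust)
    have z: "- S * \<alpha> + C * U * r * \<beta> + 2 * C * r * \<delta> = 0"
      using t \<epsilon> by (auto simp: np td nil_inner_scaleR_left nil_inner_polar_vec[OF p1])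
    have exp_al: "\<alpha> = (C * \<alpha> + U * S * r * \<beta> + 2 * S * r * \<delta>) * (C) + (2 * r * \<beta> - U * r * \<delta>) * (0) + (- S * \<alpha> + C * U * r * \<beta> + 2 * C * r * \<delta>) * (- S)"
    proof -
      have "\<alpha> - ((C * \<alpha> + U * S * r * \<beta> + 2 * S * r * \<delta>) * (C) + (2 * r * \<beta> - U * r * \<delta>) * (0) + (- S * \<alpha> + C * U * r * \<beta> + 2 * C * r * \<delta>) * (- S)) = (- (\<alpha>)) * (C * C + S * S - (1))"
        by (simp add: field_simps)
      then show ?thesis unfolding CS by simp
    qed
    have exp_be: "\<beta> = (C * \<alpha> + U * S * r * \<beta> + 2 * S * r * \<delta>) * (U * S * r) + (2 * r * \<beta> - U * r * \<delta>) * (2 * r) + (- S * \<alpha> + C * U * r * \<beta> + 2 * C * r * \<delta>) * (C * U * r)"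
    proof -
      have "\<beta> - ((C * \<alpha> + U * S * r * \<beta> + 2 * S * r * \<delta>) * (U * S * r) + (2 * r * \<beta> - U * r * \<delta>) * (2 * r) + (- S * \<alpha> + C * U * r * \<beta> + 2 * C * r * \<delta>) * (C * U * r)) = (- (S * S * \<beta>) - C * C * \<beta>) * (r * r * (4 + U * U) - (1)) + (- (2 * U * \<delta> * r * r) + 4 * \<beta> * r * r - \<beta>) * (C * C + S * S - (1))"
        by (simp add: field_simps)
      then show ?thesis unfolding r2 CS by simp
    qed
    have exp_de: "\<delta> = (C * \<alpha> + U * S * r * \<beta> + 2 * S * r * \<delta>) * (2 * S * r) + (2 * r * \<beta> - U * r * \<delta>) * (- (U * r)) + (- S * \<alpha> + C * U * r * \<beta> + 2 * C * r * \<delta>) * (2 * C * r)"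
    proof -
      have "\<delta> - ((C * \<alpha> + U * S * r * \<beta> + 2 * S * r * \<delta>) * (2 * S * r) + (2 * r * \<beta> - U * r * \<delta>) * (- (U * r)) + (- S * \<alpha> + C * U * r * \<beta> + 2 * C * r * \<delta>) * (2 * C * r)) = (- (\<delta>)) * (r * r * (4 + U * U) - (1)) + (- (2 * U * \<beta> * r * r) - 4 * \<delta> * r * r) * (C * C + S * S - (1))"
        by (simp add: field_simps)
      then show ?thesis unfolding r2 CS by simp
    qed
    define x where "x = C * \<alpha> + U * S * r * \<beta> + 2 * S * r * \<delta>"
    define y where "y = 2 * r * \<beta> - U * r * \<delta>"
    have "\<alpha> = x * C + y * 0" "\<beta> = x * (U * S * r) + y * (2 * r)" "\<delta> = x * (2 * S * r) + y * (- (U * r))"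
      unfolding x_def y_def using exp_al exp_be exp_de unfolding z by simp_all
    then have "t = x *\<^sub>R T1 + y *\<^sub>R T2" unfolding td T1_def T2_def polar_vec_scaleR polar_vec_add by simp
    then show "\<exists>x y. t = x *\<^sub>R T1 + y *\<^sub>R T2" by blast
  qed
  have neg: "1 / q = r" by (simp add: r_def q_def)
  have SX: "shape_operator M n p (polar_vec \<theta> U C 0 (q * S / 2)) =
     \<epsilon> *\<^sub>R polar_vec \<theta> U (C * D - S * C * U / 4) (S * D * U * r - 4 * C * C * r * r * r + C * C * r - q * S * S / 4) (2 * S * D * r + 2 * U * C * C * r * r * r - C * C * U * r / 2)"
  proof -
    have at: "at s within {a<..<b} = at s" by (rule at_within_open[OF s]) simp
    have "shape_operator M n (cylindrical (u s) \<theta> (v s)) (polar_vec \<theta> (u s) (cos (\<sigma> s)) 0 (sqrt (4 + (u s)\<^sup>2) * sin (\<sigma> s) / 2)) =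
    polar_vec \<theta> (u s) (\<epsilon> * (cos (\<sigma> s) * deriv \<sigma> s - sin (\<sigma> s) * cos (\<sigma> s) * u s / 4))
      (\<epsilon> * (sin (\<sigma> s) * deriv \<sigma> s * u s / sqrt (4 + (u s)\<^sup>2) - 4 * (cos (\<sigma> s))\<^sup>2 / sqrt (4 + (u s)\<^sup>2) ^ 3 + (cos (\<sigma> s))\<^sup>2 / sqrt (4 + (u s)\<^sup>2) - sqrt (4 + (u s)\<^sup>2) * (sin (\<sigma> s))\<^sup>2 / 4))
      (\<epsilon> * (2 * sin (\<sigma> s) * deriv \<sigma> s / sqrt (4 + (u s)\<^sup>2) + 2 * u s * (cos (\<sigma> s))\<^sup>2 / sqrt (4 + (u s)\<^sup>2) ^ 3 - (cos (\<sigma> s))\<^sup>2 * u s / (2 * sqrt (4 + (u s)\<^sup>2))))"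
      by (rule shape_operator_meridian[OF smooth_along_normal s, unfolded at])
        (use s du[OF s] dv[OF s] deriv_\<sigma>[OF s] neq in \<open>auto intro: Phi_mem\<close>)
    then show ?thesis
      unfolding polar_vec_scaleR p_def U_def[symmetric] C_def[symmetric] S_def[symmetric] D_def[symmetric] q_def[symmetric] neg[symmetric]
      using qpos by (simp add: power2_eq_square power3_eq_cube mult_ac)
  qed
  have SP: "shape_operator M n p (polar_vec \<theta> U 0 U (- (U * U / 2))) =
     \<epsilon> *\<^sub>R polar_vec \<theta> U (C * U * U * U * r / 4) (S * q * q / 4) (- (U * S / 2))"
    unfolding polar_vec_scaleR
    using shape_operator_parallel[OF smooth_along_normal, of "u s" "v s" \<epsilon> "\<sigma> s" \<theta>] Phi_mem[of s] s neq[OF s]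
    by (simp add: p_def U_def C_def S_def q_def r_def power2_eq_square power3_eq_cube mult_ac)
  have T1: "T1 = 1 *\<^sub>R polar_vec \<theta> U C 0 (q * S / 2) + (S * r) *\<^sub>R polar_vec \<theta> U 0 U (- (U * U / 2))"
    unfolding T1_def polar_vec_scaleR polar_vec_add
    by (intro arg_cong3[where f = "polar_vec \<theta> U"]) (simp_all add: qd field_simps)
  have T2: "T2 = 0 *\<^sub>R polar_vec \<theta> U C 0 (q * S / 2) + (2 * r * w) *\<^sub>R polar_vec \<theta> U 0 U (- (U * U / 2))"
    unfolding T2_def polar_vec_scaleR polar_vec_add
    using U by (intro arg_cong3[where f = "polar_vec \<theta> U"]) (simp_all add: w_def)
  define \<alpha> where "\<alpha> = (D - S * U * r * r)"
  define \<beta> where "\<beta> = (U * U * r * r / 2)"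
  define \<gamma> where "\<gamma> = (S * w + S * U * r * r)"
  have S1_0: "(C * D - S * C * U / 4) + S * r * (C * U * U * U * r / 4) = (D - S * U * r * r) * C + (U * U * r * r / 2) * 0"
  proof -
    have "(C * D - S * C * U / 4) + S * r * (C * U * U * U * r / 4) - ((D - S * U * r * r) * C + (U * U * r * r / 2) * 0) = ((C * S * U) / 4) * (r * r * (4 + U * U) - (1))"
      by (simp add: field_simps)
    then show ?thesis unfolding r2 by simp
  qed
  have S1_1: "(S * D * U * r - 4 * C * C * r * r * r + C * C * r - q * S * S / 4) + S * r * (S * q * q / 4) = (D - S * U * r * r) * (U * S * r) + (U * U * r * r / 2) * (2 * r)"
  proof -
    have "(S * D * U * r - 4 * C * C * r * r * r + C * C * r - q * S * S / 4) + S * r * (S * q * q / 4) - ((D - S * U * r * r) * (U * S * r) + (U * U * r * r / 2) * (2 * r)) = (- ((S * S) / 4) + (S * S * q * r) / 4 + (S * S * U * U * r * r) / 4 + S * S * r * r) * (q - (r * (4 + U * U))) + (2 * S * S * r - r + (S * S * U * U * r) / 4) * (r * r * (4 + U * U) - (1)) + (- (4 * r * r * r) + r) * (C * C + S * S - (1))"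
      by (simp add: field_simps)
    then show ?thesis unfolding qd r2 CS by simp
  qed
  have S1_2: "(2 * S * D * r + 2 * U * C * C * r * r * r - C * C * U * r / 2) + S * r * (- (U * S / 2)) = (D - S * U * r * r) * (2 * S * r) + (U * U * r * r / 2) * (- (U * r))"
  proof -
    have "(2 * S * D * r + 2 * U * C * C * r * r * r - C * C * U * r / 2) + S * r * (- (U * S / 2)) - ((D - S * U * r * r) * (2 * S * r) + (U * U * r * r / 2) * (- (U * r))) = ((U * r) / 2) * (r * r * (4 + U * U) - (1)) + (- ((U * r) / 2) + 2 * U * r * r * r) * (C * C + S * S - (1))"
      by (simp add: field_simps)
    then show ?thesis unfolding r2 CS by simp
  qed
  have S2_0: "2 * r * w * (C * U * U * U * r / 4) = (U * U * r * r / 2) * C + (S * w + S * U * r * r) * 0"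
  proof -
    have "2 * r * w * (C * U * U * U * r / 4) - ((U * U * r * r / 2) * C + (S * w + S * U * r * r) * 0) = ((C * U * w) / 2 - C / 2) * (r * r * (4 + U * U) - (1)) + (- (2 * C * r * r) + C / 2) * (U * w - (1))"
      by (simp add: field_simps)
    then show ?thesis unfolding r2 Uw by simp
  qed
  have S2_1: "2 * r * w * (S * q * q / 4) = (U * U * r * r / 2) * (U * S * r) + (S * w + S * U * r * r) * (2 * r)"
  proof -
    have "2 * r * w * (S * q * q / 4) - ((U * U * r * r / 2) * (U * S * r) + (S * w + S * U * r * r) * (2 * r)) = ((S * q * r * w) / 2 + (S * U * U * r * r * w) / 2 + 2 * S * r * r * w) * (q - (r * (4 + U * U))) + (- ((S * U * r) / 2) + (S * U * U * r * w) / 2 + 2 * S * r * w) * (r * r * (4 + U * U) - (1)) + ((S * U * r) / 2) * (U * w - (1))"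
      by (simp add: field_simps)
    then show ?thesis unfolding qd r2 Uw by simp
  qed
  have S2_2: "2 * r * w * (- (U * S / 2)) = (U * U * r * r / 2) * (2 * S * r) + (S * w + S * U * r * r) * (- (U * r))"
    by (simp add: field_simps)
  have S1: "shape_operator M n p T1 = (\<epsilon> * \<alpha>) *\<^sub>R T1 + (\<epsilon> * \<beta>) *\<^sub>R T2"
  proof -
    have "polar_vec \<theta> U (C * D - S * C * U / 4) (S * D * U * r - 4 * C * C * r * r * r + C * C * r - q * S * S / 4) (2 * S * D * r + 2 * U * C * C * r * r * r - C * C * U * r / 2) + (S * r) *\<^sub>R polar_vec \<theta> U (C * U * U * U * r / 4) (S * q * q / 4) (- (U * S / 2)) = \<alpha> *\<^sub>R T1 + \<beta> *\<^sub>R T2"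
      unfolding T1_def T2_def polar_vec_scaleR polar_vec_add \<alpha>_def \<beta>_def
      by (intro arg_cong3[where f = "polar_vec \<theta> U"] S1_0 S1_1 S1_2)
    from arg_cong[OF this, of "\<lambda>w. \<epsilon> *\<^sub>R w"] show ?thesis
      unfolding arg_cong[OF T1, of "shape_operator M n p"] shape_operator_combination[OF smooth_along_normal pM] SX SP
      by (simp add: scaleR_add_right mult.commute)
  qed
  have S2: "shape_operator M n p T2 = (\<epsilon> * \<beta>) *\<^sub>R T1 + (\<epsilon> * \<gamma>) *\<^sub>R T2"
  proof -
    have "(2 * r * w) *\<^sub>R polar_vec \<theta> U (C * U * U * U * r / 4) (S * q * q / 4) (- (U * S / 2)) = \<beta> *\<^sub>R T1 + \<gamma> *\<^sub>R T2"
      unfolding T1_def T2_def polar_vec_scaleR polar_vec_add \<beta>_def \<gamma>_def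
      by (intro arg_cong3[where f = "polar_vec \<theta> U"] S2_0 S2_1 S2_2)
    from arg_cong[OF this, of "\<lambda>w. \<epsilon> *\<^sub>R w"] show ?thesis
      unfolding arg_cong[OF T2, of "shape_operator M n p"] shape_operator_combination[OF smooth_along_normal pM] SX SP
      by (simp add: scaleR_add_right mult.commute)
  qed
  have "mean_curvature M n p = (\<epsilon> * \<alpha> + \<epsilon> * \<gamma>) / 2"
    by (rule mean_curvature_eqI[OF smooth_along_normal pM tp on S1 S2])
  also have "\<dots> = \<epsilon> * (D + S * w) / 2" unfolding \<alpha>_def \<gamma>_def by (simp add: algebra_simps)
  finally show ?thesis by (simp add: p_def U_def D_def S_def w_def)
qed

lemma spinor_density_interior:
  assumes s: "s \<in> {a<..<b}"
  shows "spinor_density M n (cylindrical (u s) \<theta> (v s)) =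
    ((deriv \<sigma> s + sin (\<sigma> s) / u s) / 2)\<^sup>2 - (cos (\<sigma> s))\<^sup>2 / (4 + (u s)\<^sup>2)"
proof -
  obtain \<epsilon> where \<epsilon>: "\<epsilon> = 1 \<or> \<epsilon> = -1"
    and neq: "\<And>s \<theta>. s \<in> {a<..<b} \<Longrightarrow> n (cylindrical (u s) \<theta> (v s)) = \<epsilon> *\<^sub>R revolution_normal \<theta> (u s) (\<sigma> s)"
    using normal_sign by blast
  have "\<epsilon>\<^sup>2 = 1" using \<epsilon> by auto
  have "nil_inner (cylindrical (u s) \<theta> (v s)) (n (cylindrical (u s) \<theta> (v s))) (nil_frame 3 (cylindrical (u s) \<theta> (v s)))
      = \<epsilon> * (2 * cos (\<sigma> s) / sqrt (4 + (u s)\<^sup>2))"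
    unfolding neq[OF s] revolution_normal_def nil_frame_3_polar[of _ \<theta> "u s"] nil_inner_scaleR_left
      nil_inner_polar_vec[OF cylindrical_1] by simp
  moreover have "(\<epsilon> * (2 * cos (\<sigma> s) / sqrt (4 + (u s)\<^sup>2)))\<^sup>2 / 4 = (cos (\<sigma> s))\<^sup>2 / (4 + (u s)\<^sup>2)"
    unfolding power_mult_distrib power_divide \<open>\<epsilon>\<^sup>2 = 1\<close>
    using add_pos_nonneg[of 4 "(u s)\<^sup>2"] by (simp add: field_simps)
  moreover have "mean_curvature M n (cylindrical (u s) \<theta> (v s)) = \<epsilon> * (deriv \<sigma> s + sin (\<sigma> s) / u s) / 2"
    by (rule mean_curvature_interior[OF s \<epsilon> neq])
  then have "(mean_curvature M n (cylindrical (u s) \<theta> (v s)))\<^sup>2 = ((deriv \<sigma> s + sin (\<sigma> s) / u s) / 2)\<^sup>2"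
    by (simp only: power_mult_distrib power_divide \<open>\<epsilon>\<^sup>2 = 1\<close> mult_1)
  ultimately show ?thesis unfolding spinor_density_def by (simp only:)
qed

end

section \<open>The poles of a surface of revolution\<close>

context oriented_piece
begin

text \<open>The normal is continuous at the pole, so its limits along all meridians agree. The limits along two
  opposite meridians have opposite horizontal parts, of length \<open>\<bar>sin \<sigma>\<bar>\<close>.\<close>

lemma normal_at_pole:
  assumes e: "e = a \<or> e = b" "u e = 0" and \<sigma>: "continuous (at e within {a..b}) \<sigma>"
    and neq: "\<And>s \<theta>. s \<in> {a<..<b} \<Longrightarrow> n (cylindrical (u s) \<theta> (v s)) = \<epsilon> *\<^sub>R revolution_normal \<theta> (u s) (\<sigma> s)"
    and \<epsilon>: "\<epsilon> = 1 \<or> \<epsilon> = -1"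
  shows "n (cylindrical (u e) \<theta> (v e)) = \<epsilon> *\<^sub>R revolution_normal \<theta> (u e) (\<sigma> e)" "sin (\<sigma> e) = 0"
proof -
  let ?F = "at e within {a<..<b}"
  have nt: "?F \<noteq> bot"
    using e(1) ab by (auto simp: trivial_limit_within islimpt_greaterThanLessThan1 islimpt_greaterThanLessThan2)
  have emem: "e \<in> {a..b}" using e ab by auto
  have uc: "(u \<longlongrightarrow> u e) ?F" and vc: "(v \<longlongrightarrow> v e) ?F"
    using cont_u cont_v emem unfolding continuous_on_def
    by (meson greaterThanLessThan_subseteq_atLeastAtMost_iff order_refl tendsto_within_subset)+
  have sc: "(\<sigma> \<longlongrightarrow> \<sigma> e) ?F"
    using \<sigma> unfolding continuous_within
    by (meson greaterThanLessThan_subseteq_atLeastAtMost_iff order_refl tendsto_within_subset)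
  have vec3: "((\<lambda>t. vector [f t, g t, h t] :: real^3) \<longlongrightarrow> vector [x, y, z]) ?F"
    if "(f \<longlongrightarrow> x) ?F" "(g \<longlongrightarrow> y) ?F" "(h \<longlongrightarrow> z) ?F" for f g h :: "real \<Rightarrow> real" and x y z
    unfolding vector_3_eq_axis by (intro tendsto_intros that)
  have eq: "n (cylindrical (u e) \<theta> (v e)) = \<epsilon> *\<^sub>R revolution_normal \<theta> (u e) (\<sigma> e)" for \<theta>
  proof (rule tendsto_unique[OF nt])
    have "((\<lambda>t. cylindrical (u t) \<theta> (v t)) \<longlongrightarrow> cylindrical (u e) \<theta> (v e)) ?F"
      unfolding cylindrical_def by (intro vec3 tendsto_intros uc vc) auto
    moreover have "cylindrical (u e) \<theta> (v e) \<in> M" by (rule Phi_mem[OF emem])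
    moreover have "\<forall>\<^sub>F t in ?F. cylindrical (u t) \<theta> (v t) \<in> M"
      unfolding eventually_at_filter by (auto intro!: always_eventually Phi_mem)
    ultimately show "((\<lambda>t. n (cylindrical (u t) \<theta> (v t))) \<longlongrightarrow> n (cylindrical (u e) \<theta> (v e))) ?F"
      by (rule continuous_on_tendsto_compose[OF smooth_along_continuous_on[OF smooth_along_normal]])
    have "sqrt (4 + (u e)\<^sup>2) \<noteq> 0" using add_pos_nonneg[of 4 "(u e)\<^sup>2"] by simp
    then have "((\<lambda>t. \<epsilon> *\<^sub>R revolution_normal \<theta> (u t) (\<sigma> t)) \<longlongrightarrow> \<epsilon> *\<^sub>R revolution_normal \<theta> (u e) (\<sigma> e)) ?F"
      unfolding revolution_normal_def polar_vec_def by (intro tendsto_intros vec3 uc sc) auto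
    moreover have "\<forall>\<^sub>F t in ?F. \<epsilon> *\<^sub>R revolution_normal \<theta> (u t) (\<sigma> t) = n (cylindrical (u t) \<theta> (v t))"
      unfolding eventually_at_filter by (auto intro!: always_eventually simp: neq)
    ultimately show "((\<lambda>t. n (cylindrical (u t) \<theta> (v t))) \<longlongrightarrow> \<epsilon> *\<^sub>R revolution_normal \<theta> (u e) (\<sigma> e)) ?F"
      by (rule Lim_transform_eventually)
  qed
  then show "n (cylindrical (u e) \<theta> (v e)) = \<epsilon> *\<^sub>R revolution_normal \<theta> (u e) (\<sigma> e)" .
  have "cylindrical (u e) 0 (v e) = cylindrical (u e) pi (v e)" by (simp add: cylindrical_def e)
  then have "\<epsilon> *\<^sub>R revolution_normal 0 (u e) (\<sigma> e) = \<epsilon> *\<^sub>R revolution_normal pi (u e) (\<sigma> e)"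
    using eq by metis
  then have "revolution_normal 0 (u e) (\<sigma> e) $ 1 = revolution_normal pi (u e) (\<sigma> e) $ 1" using \<epsilon> by auto
  then show "sin (\<sigma> e) = 0" by (simp add: revolution_normal_def polar_vec_def e)
qed

text \<open>Each meridian through the pole shows that its direction is an eigenvector with eigenvalue
  \<open>\<plusminus> \<sigma>'\<close>. The meridians with angles \<open>0\<close> and \<open>pi / 2\<close> give an orthonormal basis: the pole is umbilic.\<close>

lemma mean_curvature_at_pole:
  assumes e: "e = a \<or> e = b" "u e = 0"
    and neq: "\<And>s \<theta>. s \<in> {a<..<b} \<Longrightarrow> n (cylindrical (u s) \<theta> (v s)) = \<epsilon> *\<^sub>R revolution_normal \<theta> (u s) (\<sigma> s)"
    and \<epsilon>: "\<epsilon> = 1 \<or> \<epsilon> = -1"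
    and du_e: "(u has_real_derivative cos (\<sigma> e)) (at e within {a..b})"
    and dv_e: "(v has_real_derivative sqrt (4 + (u e)\<^sup>2) / 2 * sin (\<sigma> e)) (at e within {a..b})"
    and ds_e: "(\<sigma> has_real_derivative \<sigma>') (at e within {a..b})"
  shows "mean_curvature M n (cylindrical (u e) \<theta> (v e)) = \<epsilon> * \<sigma>'"
proof -
  define C where "C = cos (\<sigma> e)"
  define p where "p = cylindrical (u e) \<theta> (v e)"
  let ?I = "insert e {a<..<b}"
  have sub: "?I \<subseteq> {a..b}" using e ab by auto
  have nt: "at e within ?I \<noteq> bot"
    using e(1) ab by (auto simp: trivial_limit_within islimpt_insert islimpt_greaterThanLessThan1 islimpt_greaterThanLessThan2)
  have cont: "continuous (at e within {a..b}) \<sigma>" using ds_e by (rule DERIV_continuous)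
  note pole = normal_at_pole[OF e cont neq \<epsilon>]
  have S: "sin (\<sigma> e) = 0" by (rule pole(2))
  then have C2: "C\<^sup>2 = 1" using sin_cos_squared_add[of "\<sigma> e"] by (simp add: C_def)
  have p: "p = cylindrical (u e) \<phi> (v e)" for \<phi> by (simp add: p_def cylindrical_def e)
  have pM: "p \<in> M" unfolding p_def using e ab by (intro Phi_mem) auto
  have shape: "shape_operator M n p (polar_vec \<phi> 0 C 0 0) = (\<epsilon> * \<sigma>') *\<^sub>R polar_vec \<phi> 0 C 0 0" for \<phi>
  proof -
    have neq': "n (cylindrical (u t) \<phi> (v t)) = \<epsilon> *\<^sub>R revolution_normal \<phi> (u t) (\<sigma> t)" if "t \<in> ?I" for t
      using that pole(1) neq by auto
    have "cylindrical (u t) \<phi> (v t) \<in> M" if "t \<in> ?I" for t using that sub by (intro Phi_mem) auto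
    from shape_operator_meridian[OF smooth_along_normal insertI1 nt this neq'
        DERIV_subset[OF du_e sub] DERIV_subset[OF dv_e sub] DERIV_subset[OF ds_e sub]]
    show ?thesis
      by (simp add: e(2) S p[of \<phi>] polar_vec_scaleR C_def[symmetric] C2 mult_ac)
  qed
  have T: "polar_vec 0 0 C 0 0 = vector [C, 0, 0]" "polar_vec (pi / 2) 0 C 0 0 = vector [0, C, 0]"
    by (simp_all add: polar_vec_def)
  have p1: "p $ 1 = 0" by (simp add: p_def cylindrical_def e)
  have np: "n p = \<epsilon> *\<^sub>R vector [0, 0, C]"
    using pole(1)[of \<theta>] by (simp add: p_def revolution_normal_def polar_vec_def e(2) S C_def)
  have "tangent_plane M p = {x *\<^sub>R polar_vec 0 0 C 0 0 + y *\<^sub>R polar_vec (pi / 2) 0 C 0 0 | x y. True}"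
  proof (rule tangent_plane_eq_span[OF surface pM normal])
    fix t assume "nil_inner p (n p) t = 0"
    then have "t $ 3 = 0" using \<epsilon> C2 by (auto simp: np nil_inner_def p1)
    then have "t = (t $ 1 * C) *\<^sub>R polar_vec 0 0 C 0 0 + (t $ 2 * C) *\<^sub>R polar_vec (pi / 2) 0 C 0 0"
      using C2 unfolding T by (simp add: vec_eq_iff forall_3 power2_eq_square mult.assoc)
    then show "\<exists>x y. t = x *\<^sub>R polar_vec 0 0 C 0 0 + y *\<^sub>R polar_vec (pi / 2) 0 C 0 0" by blast
  qed
  then have "mean_curvature M n p = (\<epsilon> * \<sigma>' + \<epsilon> * \<sigma>') / 2"
    by (rule mean_curvature_eqI[OF smooth_along_normal pM, where \<beta> = 0])
      (use C2 in \<open>simp_all add: shape, simp_all add: T nil_inner_def p1 power2_eq_square\<close>)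
  then show ?thesis by (simp add: p_def)
qed

end

section \<open>Integration over a surface of revolution\<close>

text \<open>The bridge from Lebesgue measure on \<open>real^2\<close>, where charts live, to iterated integrals.\<close>

lemma lborel_vec2_eq_distr:
  "(lborel :: (real^2) measure) = distr (lborel \<Otimes>\<^sub>M lborel) borel (\<lambda>(s, t). vector [s, t])"
proof (rule lborel_eqI)
  have cont: "continuous_on UNIV (\<lambda>x :: real \<times> real. vector [fst x, snd x] :: real^2)"
  proof -
    have "(vector [s, t] :: real^2) = s *\<^sub>R axis 1 1 + t *\<^sub>R axis 2 1" for s t :: real
      by (simp add: vec_eq_iff forall_2 axis_def)
    then show ?thesis by (simp only:) (intro continuous_intros)
  qed
  then have meas: "(\<lambda>(s, t). vector [s, t] :: real^2) \<in> measurable (lborel \<Otimes>\<^sub>M lborel) borel"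
    by (simp add: lborel_prod case_prod_unfold borel_measurable_continuous_onI)
  fix l u :: "real^2" assume le: "\<And>b. b \<in> Basis \<Longrightarrow> l \<bullet> b \<le> u \<bullet> b"
  have le': "l $ i \<le> u $ i" for i
    using le[of "axis i 1"] by (simp add: inner_axis)
  have "(\<lambda>(s, t). vector [s, t] :: real^2) -` box l u = box (l $ 1) (u $ 1) \<times> box (l $ 2) (u $ 2)"
    by (auto simp: mem_box_cart forall_2)
  then have "emeasure (distr (lborel \<Otimes>\<^sub>M lborel) borel (\<lambda>(s, t). vector [s, t])) (box l u)
      = emeasure (lborel \<Otimes>\<^sub>M lborel) (box (l $ 1) (u $ 1) \<times> box (l $ 2) (u $ 2))"
    using meas by (subst emeasure_distr) (auto simp: space_pair_measure)
  also have "\<dots> = ennreal ((u $ 1 - l $ 1) * (u $ 2 - l $ 2))"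
    using le' by (subst lborel.emeasure_pair_measure_Times) (auto simp: ennreal_mult)
  also have "(u $ 1 - l $ 1) * (u $ 2 - l $ 2) = (\<Prod>b\<in>Basis. (u - l) \<bullet> b)"
  proof -
    have "(\<Prod>b\<in>Basis. (u - l) \<bullet> b) = (\<Prod>i\<in>UNIV. (u - l) \<bullet> axis i 1)"
      unfolding Basis_vec_def
      by (subst prod.reindex_bij_betw[symmetric, where h = "\<lambda>i. axis i 1" and S = UNIV])
        (auto simp: bij_betw_def inj_on_def axis_eq_axis)
    then show ?thesis by (simp add: UNIV_2 inner_axis)
  qed
  finally show "emeasure (distr (lborel \<Otimes>\<^sub>M lborel) borel (\<lambda>(s, t). vector [s, t])) (box l u) = (\<Prod>b\<in>Basis. (u - l) \<bullet> b)" .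
qed simp

lemma integral_product_vec2:
  fixes F G :: "real \<Rightarrow> real"
  assumes F: "integrable lborel F" and G: "integrable lborel G"
  shows "integrable lborel (\<lambda>x :: real^2. F (x $ 1) * G (x $ 2))"
    and "(LINT x :: real^2|lborel. F (x $ 1) * G (x $ 2)) = (LINT s|lborel. F s) * (LINT t|lborel. G t)"
proof -
  have meas: "(\<lambda>(s, t). vector [s, t] :: real^2) \<in> measurable (lborel \<Otimes>\<^sub>M lborel) borel"
  proof -
    have "(vector [s, t] :: real^2) = s *\<^sub>R axis 1 1 + t *\<^sub>R axis 2 1" for s t :: real
      by (simp add: vec_eq_iff forall_2 axis_def)
    then show ?thesis by (simp add: lborel_prod case_prod_unfold borel_measurable_continuous_onI continuous_intros)
  qed
  have [measurable]: "F \<in> borel_measurable borel" "G \<in> borel_measurable borel"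
    using F G by (auto dest: borel_measurable_integrable)
  have nth: "(\<lambda>x :: real^2. x $ i) \<in> borel_measurable borel" for i
    by (intro borel_measurable_continuous_onI continuous_intros)
  have FG: "(\<lambda>x :: real^2. F (x $ 1) * G (x $ 2)) \<in> borel_measurable borel"
    by (intro borel_measurable_times measurable_compose[OF nth]) auto
  have prod: "integrable (lborel \<Otimes>\<^sub>M lborel) (\<lambda>(s, t). F s * G t)"
  proof (rule lborel_pair.Fubini_integrable)
    have "integrable lborel (\<lambda>s. \<bar>F s\<bar> * (LINT t|lborel. \<bar>G t\<bar>))" using F by (intro integrable_mult_left integrable_abs)
    then show "integrable lborel (\<lambda>s. LINT t|lborel. norm (case (s, t) of (s, t) \<Rightarrow> F s * G t))"
      by (simp add: abs_mult)
    show "AE s in lborel. integrable lborel (\<lambda>t. case (s, t) of (s, t) \<Rightarrow> F s * G t)"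
      using G by simp
  qed simp
  show "integrable lborel (\<lambda>x :: real^2. F (x $ 1) * G (x $ 2))"
    unfolding lborel_vec2_eq_distr using prod
    by (subst integrable_distr_eq[OF meas FG]) (simp add: case_prod_unfold)
  have "(LINT x :: real^2|lborel. F (x $ 1) * G (x $ 2)) = integral\<^sup>L (lborel \<Otimes>\<^sub>M lborel) (\<lambda>(s, t). F s * G t)"
    unfolding lborel_vec2_eq_distr by (subst integral_distr[OF meas FG]) (simp add: case_prod_unfold)
  also have "\<dots> = (LINT s|lborel. LINT t|lborel. F s * G t)"
    using lborel_pair.integral_fst[OF prod] by simp
  also have "\<dots> = (LINT s|lborel. F s) * (LINT t|lborel. G t)" by simp
  finally show "(LINT x :: real^2|lborel. F (x $ 1) * G (x $ 2)) = (LINT s|lborel. F s) * (LINT t|lborel. G t)" .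
qed

text \<open>That images are measurable at all is due to the continuous inverse of the chart, defined on a
  relatively open subset of \<open>M\<close>.\<close>

lemma area_measure_null_image:
  assumes "area_measure M \<mu>" "local_param M U \<phi>" "A \<in> null_sets lborel" "A \<subseteq> U"
  shows "\<phi> ` A \<in> null_sets \<mu>"
proof -
  have A: "A \<in> sets borel" using assms(3) by auto
  have eq: "emeasure \<mu> (\<phi> ` A') = (\<integral>\<^sup>+x\<in>A'. ennreal (sqrt (det (gram \<phi> x))) \<partial>lborel)" if "A' \<in> sets borel" "A' \<subseteq> U" for A'
    using assms(1,2) that unfolding area_measure_def by blast
  have "(\<integral>\<^sup>+x\<in>A. ennreal (sqrt (det (gram \<phi> x))) \<partial>lborel) = (\<integral>\<^sup>+x. 0 \<partial>(lborel :: (real^2) measure))"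
  proof (rule nn_integral_cong_AE)
    show "AE x in lborel. ennreal (sqrt (det (gram \<phi> x))) * indicator A x = 0"
      using AE_not_in[OF assms(3)] by (rule AE_mp) (auto simp: indicator_def)
  qed
  then have "emeasure \<mu> (\<phi> ` A) = 0" using eq[OF A assms(4)] by simp
  moreover have "\<phi> ` A \<in> sets \<mu>"
  proof -
    obtain \<psi> where hom: "homeomorphism U (\<phi> ` U) \<phi> \<psi>" and op: "openin (top_of_set M) (\<phi> ` U)"
      using assms(2) unfolding local_param_def by blast
    obtain T where T: "open T" "\<phi> ` U = M \<inter> T" using op by (auto simp: openin_open)
    have psi: "\<psi> \<in> borel_measurable (restrict_space borel (\<phi> ` U))"
      using hom by (intro borel_measurable_continuous_on_restrict) (auto simp: homeomorphism_def)
    have "\<phi> ` A = \<psi> -` A \<inter> space (restrict_space borel (\<phi> ` U))"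
    proof -
      have inv: "\<psi> (\<phi> x) = x" if "x \<in> U" for x using homeomorphism_apply1[OF hom that] .
      show ?thesis
      proof (intro equalityI subsetI)
        fix y assume "y \<in> \<phi> ` A"
        then obtain x where x: "x \<in> A" "y = \<phi> x" by blast
        then have "x \<in> U" using assms(4) by (rule_tac subsetD)
        then show "y \<in> \<psi> -` A \<inter> space (restrict_space borel (\<phi> ` U))"
          using x inv[of x] by (simp add: space_restrict_space)
      next
        fix y assume "y \<in> \<psi> -` A \<inter> space (restrict_space borel (\<phi> ` U))"
        then obtain x where x: "x \<in> U" "y = \<phi> x" "\<psi> y \<in> A" by (auto simp: space_restrict_space)
        then show "y \<in> \<phi> ` A" using inv[of x] by simp
      qed
    qed
    also have "\<dots> \<in> sets (restrict_space borel (\<phi> ` U))" using A by (rule measurable_sets[OF psi])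
    also have "\<dots> \<subseteq> sets (restrict_space borel M)"
    proof
      fix B assume "B \<in> sets (restrict_space borel (\<phi> ` U))"
      then obtain B' where B': "B' \<in> sets borel" "B = (M \<inter> T) \<inter> B'" unfolding T(2) sets_restrict_space by blast
      then have "B = M \<inter> (T \<inter> B')" "T \<inter> B' \<in> sets borel" using T(1) by (auto intro: borel_open)
      then show "B \<in> sets (restrict_space borel M)" unfolding sets_restrict_space by blast
    qed
    finally show ?thesis using assms(1) by (simp add: area_measure_def)
  qed
  ultimately show ?thesis by auto
qed

lemma area_measure_null_point:
  assumes "area_measure M \<mu>" "smooth_surface M" "p \<in> M"
  shows "{p} \<in> null_sets \<mu>"
proof -
  obtain U \<phi> where "local_param M U \<phi>" "p \<in> \<phi> ` U" using assms(2,3) unfolding smooth_surface_def by blast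
  then obtain x where "local_param M U \<phi>" "x \<in> U" "p = \<phi> x" by blast
  moreover have "{x} \<in> null_sets lborel" by (intro null_setsI) simp_all
  ultimately show ?thesis using area_measure_null_image[OF assms(1), of U \<phi> "{x}"] by simp
qed

lemma null_sets_coordinate_line: "{x :: real^'n. x $ i = c} \<in> null_sets lborel"
proof -
  have cl: "closed {x :: real^'n. x $ i = c}" by (intro closed_Collect_eq continuous_intros)
  have "{x :: real^'n. x $ i = c} \<in> null_sets lebesgue"
    unfolding negligible_iff_null_sets[symmetric] using negligible_standard_hyperplane[of "axis i 1 :: real^'n" c]
    by (simp add: inner_axis axis_in_Basis_iff)
  moreover have "{x :: real^'n. x $ i = c} \<in> sets lborel" using borel_closed[OF cl] by simp
  ultimately show ?thesis using null_sets_completion_iff by blast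
qed

lemma measurable_on_cover:
  assumes "countable \<C>" "M \<subseteq> \<Union>\<C>" "M \<in> sets borel"
    "\<And>\<Omega>. \<Omega> \<in> \<C> \<Longrightarrow> \<Omega> \<subseteq> M \<and> \<Omega> \<in> sets borel \<and> continuous_on \<Omega> f"
  shows "f \<in> borel_measurable (restrict_space borel M)"
proof (rule measurable_piecewise_restrict[OF assms(1)])
  show "space (restrict_space borel M) \<subseteq> \<Union>\<C>" using assms(2) by (simp add: space_restrict_space)
  fix \<Omega> assume \<Omega>: "\<Omega> \<in> \<C>"
  note * = assms(4)[OF \<Omega>]
  have "\<Omega> = M \<inter> \<Omega>" using * by blast
  then have "\<Omega> \<in> sets (restrict_space borel M)" using * unfolding sets_restrict_space by blast
  moreover have "\<Omega> \<inter> space (restrict_space borel M) = \<Omega>" using * by (simp add: space_restrict_space inf.absorb1)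
  ultimately show "\<Omega> \<inter> space (restrict_space borel M) \<in> sets (restrict_space borel M)"
    by simp
  have "restrict_space (restrict_space borel M) \<Omega> = restrict_space borel \<Omega>"
    using * assms(3) \<open>\<Omega> = M \<inter> \<Omega>\<close> by (simp add: restrict_restrict_space)
  then show "f \<in> borel_measurable (restrict_space (restrict_space borel M) \<Omega>)"
    using * by (simp add: borel_measurable_continuous_on_restrict)
qed

lemma periodic_add_int_mult:
  fixes L :: real
  assumes "\<And>s. f (s + L) = f s"
  shows "f (s + of_int k * L) = f s"
proof (induction k rule: int_induct[where k = 0])
  case (step1 i)
  have "f (s + of_int (i + 1) * L) = f ((s + of_int i * L) + L)" by (simp add: algebra_simps)
  then show ?case using step1 assms by simp
next
  case (step2 i)
  have "f ((s + of_int (i - 1) * L) + L) = f (s + of_int i * L)" by (simp add: algebra_simps)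
  then show ?case using step2 assms by metis
qed simp

lemma translate_into_period:
  fixes L :: real
  assumes "0 < L"
  obtains k :: int where "c \<le> s + of_int k * L" "s + of_int k * L < c + L"
proof
  let ?k = "\<lceil>(c - s) / L\<rceil>"
  have "(c - s) / L \<le> of_int ?k" "of_int ?k < (c - s) / L + 1" by linarith+
  then have "(c - s) / L * L \<le> of_int ?k * L" "of_int ?k * L < ((c - s) / L + 1) * L"
    using assms by (simp_all only: mult_right_mono less_imp_le mult_strict_right_mono)
  then have "c - s \<le> of_int ?k * L" "of_int ?k * L < (c - s) + L"
    using assms by (simp_all add: distrib_right)
  then show "c \<le> s + of_int ?k * L" "s + of_int ?k * L < c + L" by linarith+
qed

context profile_piece
begin

lemma mem_chart_box_0:
  fixes x :: "real^2"
  shows "x \<in> box (vector [a, - pi]) (vector [b, pi]) \<longleftrightarrow> a < x $ 1 \<and> x $ 1 < b \<and> - pi < x $ 2 \<and> x $ 2 < pi"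
    "x \<in> box (vector [a, 0]) (vector [b, 2 * pi]) \<longleftrightarrow> a < x $ 1 \<and> x $ 1 < b \<and> 0 < x $ 2 \<and> x $ 2 < 2 * pi"
  using mem_chart_box[of x 0] mem_chart_box[of x pi] by simp_all

lemma chart_coordinates:
  assumes "s \<in> {a<..<b}"
  obtains x where "x \<in> chart_box 0 \<union> chart_box pi" "x $ 1 = s" "Phi x = cylindrical (u s) \<theta> (v s)"
proof -
  obtain k where "0 - pi \<le> \<theta> + of_int k * (2 * pi)" "\<theta> + of_int k * (2 * pi) < 0 - pi + 2 * pi"
    by (rule translate_into_period[of "2 * pi" "0 - pi" \<theta>]) simp
  then obtain \<phi> where \<phi>: "\<phi> = \<theta> + of_int k * (2 * pi)" "- pi \<le> \<phi>" "\<phi> < pi" by simp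
  have "cos \<phi> = cos \<theta>" "sin \<phi> = sin \<theta>"
    unfolding \<phi>(1) using periodic_add_int_mult[of cos "2 * pi"] periodic_add_int_mult[of sin "2 * pi"] by simp_all
  then have eq: "cylindrical (u s) \<phi> (v s) = cylindrical (u s) \<theta> (v s)" by (simp add: cylindrical_def)
  show ?thesis
  proof (cases "\<phi> = - pi")
    case True
    then have "Phi (vector [s, pi]) = cylindrical (u s) \<theta> (v s)" using eq by (simp add: Phi_def cylindrical_def)
    moreover have "vector [s, pi] \<in> chart_box pi" using assms unfolding mem_chart_box by simp
    ultimately show ?thesis using that[of "vector [s, pi]"] by simp
  next
    case False
    then have "Phi (vector [s, \<phi>]) = cylindrical (u s) \<theta> (v s)" using eq by (simp add: Phi_def)
    moreover have "vector [s, \<phi>] \<in> chart_box 0" using assms \<phi> False by (simp add: mem_chart_box mem_chart_box_0)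
    ultimately show ?thesis using that[of "vector [s, \<phi>]"] by simp
  qed
qed

text \<open>One chart covers \<open>M\<close> up to the ends of the piece, contained in \<open>Z\<close>, and one meridian, which is
  the image of a line in a second chart. So \<open>\<mu>\<close> is the image of the measure with density
  \<open>u q / 2\<close> on the rectangle, and the integral over the angle contributes \<open>2 * pi\<close>.\<close>

lemma area_measure_integral:
  assumes \<mu>: "area_measure M \<mu>"
    and Z: "Z \<in> null_sets \<mu>" "\<And>e \<theta>. e \<in> {a, b} \<Longrightarrow> cylindrical (u e) \<theta> (v e) \<in> Z"
    and f: "f \<in> borel_measurable \<mu>" "\<And>s \<theta>. s \<in> {a<..<b} \<Longrightarrow> f (cylindrical (u s) \<theta> (v s)) = g s"
    and g: "set_integrable lborel {a<..<b} (\<lambda>s. g s * (u s * sqrt (4 + (u s)\<^sup>2) / 2))"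
  shows "integrable \<mu> f"
    and "(LINT p|\<mu>. f p) = 2 * pi * (LINT s:{a<..<b}|lborel. g s * (u s * sqrt (4 + (u s)\<^sup>2) / 2))"
proof -
  let ?W = "chart_box 0"
  define w where "w = (\<lambda>s. u s * sqrt (4 + (u s)\<^sup>2) / 2)"
  have Wx: "x $ 1 \<in> {a<..<b}" if "x \<in> ?W" for x using that unfolding mem_chart_box by simp
  have sets\<mu>: "sets \<mu> = sets (restrict_space borel M)" "space \<mu> = M" using \<mu> by (auto simp: area_measure_def)
  define p0 where "p0 = cylindrical (u a) 0 (v a)"
  have p0: "p0 \<in> M" unfolding p0_def using ab by (intro Phi_mem) auto
  (* the chart, extended outside its domain by an arbitrary point of M to have values in the space of the measure *)
  define T where "T = (\<lambda>x. if x \<in> ?W then Phi x else p0)"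
  have "T \<in> borel_measurable borel"
    unfolding T_def
    by (intro borel_measurable_continuous_on_if continuous_on_subset[OF continuous_on_Phi]) (auto simp: mem_chart_box mem_chart_box_0)
  moreover have "T x \<in> M" for x
    using p0 Phi_cbox[of 0] box_subset_cbox by (auto simp: T_def)
  ultimately have "T \<in> measurable borel (restrict_space borel M)" by (intro measurable_restrict_space2) auto
  then have T: "T \<in> measurable borel \<mu>" using sets\<mu>(1) measurable_cong_sets by blast
  define null where "null = Z \<union> Phi ` {x \<in> chart_box pi. x $ 2 = pi}"
  have null: "null \<in> null_sets \<mu>"
  proof -
    have "{x \<in> chart_box pi. x $ 2 = pi} \<in> null_sets lborel"
      by (rule null_sets_subset[OF null_sets_coordinate_line[of 2 pi]]) auto
    then have "Phi ` {x \<in> chart_box pi. x $ 2 = pi} \<in> null_sets \<mu>"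
      by (rule area_measure_null_image[OF \<mu> local_param_Phi[of pi]]) auto
    then show ?thesis unfolding null_def using Z(1) by blast
  qed
  have cover: "M \<subseteq> Phi ` ?W \<union> null"
  proof
    fix p assume "p \<in> M"
    then obtain s \<theta> where st: "s \<in> {a..b}" "0 - pi \<le> \<theta>" "\<theta> < 0 + pi" "p = cylindrical (u s) \<theta> (v s)"
      by (rule Phi_cover[of _ 0])
    consider "s \<in> {a, b}" | "s \<in> {a<..<b}" "\<theta> = - pi" | "s \<in> {a<..<b}" "\<theta> > - pi" using st by fastforce
    then show "p \<in> Phi ` ?W \<union> null"
    proof cases
      case 1
      then show ?thesis using Z(2) st by (auto simp: null_def)
    next
      case 2
      then have "p = Phi (vector [s, pi])" using st by (simp add: Phi_def cylindrical_def)
      moreover have "vector [s, pi] \<in> {x \<in> chart_box pi. x $ 2 = pi}" using 2 by (simp add: mem_chart_box mem_chart_box_0)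
      ultimately show ?thesis unfolding null_def by blast
    next
      case 3
      then have "p = Phi (vector [s, \<theta>])" "vector [s, \<theta>] \<in> ?W" using st by (simp_all add: Phi_def mem_chart_box mem_chart_box_0)
      then show ?thesis by blast
    qed
  qed
  define \<nu> where "\<nu> = density lborel (\<lambda>x. ennreal (indicator ?W x * w (x $ 1)))"
  have wcont: "continuous_on {a..b} w"
    unfolding w_def by (intro continuous_intros cont_u) auto
  have wmeas: "(\<lambda>x :: real^2. indicator ?W x * w (x $ 1)) \<in> borel_measurable borel"
  proof -
    have "continuous_on ?W (\<lambda>x. w (x $ 1))"
      by (rule continuous_on_compose2[OF wcont]) (auto intro!: continuous_intros simp: mem_chart_box mem_chart_box_0)
    from borel_measurable_continuous_on_indicator[OF _ this] show ?thesis by simp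
  qed
  then have wmeasL: "(\<lambda>x :: real^2. indicator ?W x * w (x $ 1)) \<in> borel_measurable lborel" by simp
  have wnn: "0 \<le> w s" if "s \<in> {a..b}" for s unfolding w_def using u_nonneg[OF that] by simp
  have \<mu>_eq: "\<mu> = distr \<nu> \<mu> T"
  proof (rule measure_eqI)
    fix B assume B: "B \<in> sets \<mu>"
    then have BM: "B \<subseteq> M" using sets.sets_into_space sets\<mu>(2) by blast
    define A where "A = ?W \<inter> T -` B"
    have A: "A \<in> sets borel" unfolding A_def using measurable_sets[OF T B] by (intro sets.Int) auto
    have "emeasure \<mu> B = emeasure \<mu> (Phi ` A)"
    proof -
      have im: "Phi ` A = B \<inter> Phi ` ?W" by (auto simp: A_def T_def)
      have "Phi ` A \<in> sets \<mu>"
      proof -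
        have "openin (top_of_set M) (Phi ` ?W)" using local_param_Phi unfolding local_param_def by blast
        then have "Phi ` ?W \<in> sets \<mu>" unfolding sets\<mu> by (auto simp: openin_open sets_restrict_space)
        then show ?thesis unfolding im using B by blast
      qed
      moreover have "AE x in \<mu>. x \<notin> null" using null by (rule AE_not_in)
      then have "AE x in \<mu>. x \<in> B \<longleftrightarrow> x \<in> Phi ` A"
        by (rule AE_mp) (rule AE_I2, unfold im, use cover BM in blast)
      ultimately show ?thesis using B by (intro emeasure_eq_AE) auto
    qed
    also have "\<dots> = (\<integral>\<^sup>+x\<in>A. ennreal (sqrt (det (gram Phi x))) \<partial>lborel)"
      using \<mu> local_param_Phi[of 0] A unfolding area_measure_def A_def by blast
    also have "\<dots> = (\<integral>\<^sup>+x\<in>T -` B. ennreal (indicator ?W x * w (x $ 1)) \<partial>lborel)"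
      by (intro nn_integral_cong) (auto simp: indicator_def A_def sqrt_det_gram_Phi[OF Wx] w_def)
    also have "\<dots> = emeasure \<nu> (T -` B)"
      unfolding \<nu>_def using measurable_sets[OF T B] wmeas by (subst emeasure_density) auto
    also have "\<dots> = emeasure (distr \<nu> \<mu> T) B"
      using T B by (subst emeasure_distr) (auto simp: \<nu>_def)
    finally show "emeasure \<mu> B = emeasure (distr \<nu> \<mu> T) B" .
  qed simp
  have "sets \<nu> = sets borel" by (simp add: \<nu>_def)
  then have T\<nu>: "T \<in> measurable \<nu> \<mu>" using T measurable_cong_sets by blast
  have fT: "(\<lambda>x. f (T x)) \<in> borel_measurable lborel" using measurable_compose[OF T f(1)] by simp
  have dens: "AE x in lborel. 0 \<le> indicator ?W x * w ((x :: real^2) $ 1)"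
  proof (rule AE_I2)
    fix x :: "real^2"
    show "0 \<le> indicator ?W x * w (x $ 1)"
    proof (cases "x \<in> ?W")
      case True
      then show ?thesis using wnn[of "x $ 1"] Wx[OF True] by simp
    qed simp
  qed
  define F where "F = (\<lambda>s. indicator {a<..<b} s * (g s * w s))"
  define G where "G = (\<lambda>t :: real. indicator {- pi<..<pi} t :: real)"
  have FG: "(indicator ?W x * w (x $ 1)) *\<^sub>R f (T x) = F (x $ 1) * G (x $ 2)" for x :: "real^2"
  proof (cases "x \<in> ?W")
    case True
    then have "f (T x) = g (x $ 1)" using f(2)[OF Wx[OF True]] by (simp add: T_def Phi_def)
    then show ?thesis using True by (simp add: F_def G_def mem_chart_box mem_chart_box_0)
  next
    case False
    then show ?thesis by (auto simp: F_def G_def mem_chart_box mem_chart_box_0 indicator_def)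
  qed
  have Fi: "integrable lborel F" using g unfolding set_integrable_def F_def w_def by simp
  have Gi: "integrable lborel G" unfolding G_def by (simp add: integrable_indicator_iff)
  have Gint: "(LINT t|lborel. G t) = 2 * pi" unfolding G_def by simp
  have "integrable \<nu> (\<lambda>x. f (T x))"
    unfolding \<nu>_def integrable_density[OF fT wmeasL dens] FG
    by (rule integral_product_vec2[OF Fi Gi])
  then have "integrable (distr \<nu> \<mu> T) f" by (subst integrable_distr_eq[OF T\<nu> f(1)])
  then show "integrable \<mu> f" using \<mu>_eq by simp
  have "(LINT p|\<mu>. f p) = (LINT p|distr \<nu> \<mu> T. f p)" using \<mu>_eq by simp
  also have "\<dots> = (LINT x|\<nu>. f (T x))" by (rule integral_distr[OF T\<nu> f(1)])
  also have "\<dots> = (LINT x :: real^2|lborel. F (x $ 1) * G (x $ 2))"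
    unfolding \<nu>_def integral_density[OF fT wmeasL dens] FG ..
  also have "\<dots> = (LINT s|lborel. F s) * (2 * pi)"
    unfolding integral_product_vec2(2)[OF Fi Gi] Gint ..
  also have "\<dots> = 2 * pi * (LINT s:{a<..<b}|lborel. g s * (u s * sqrt (4 + (u s)\<^sup>2) / 2))"
    unfolding set_lebesgue_integral_def F_def w_def by simp
  finally show "(LINT p|\<mu>. f p) = 2 * pi * (LINT s:{a<..<b}|lborel. g s * (u s * sqrt (4 + (u s)\<^sup>2) / 2))" .
qed

end

section \<open>Arcs and closed curves as profile pieces\<close>

lemma smooth_interval_subset: "smooth_interval I f \<Longrightarrow> J \<subseteq> I \<Longrightarrow> smooth_interval J f"
  unfolding smooth_interval_def by (elim exE, rule_tac x = D in exI) (auto intro: DERIV_subset)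

lemma arc_profile_piece:
  assumes arc: "arc_profile L u v" and ang: "arc_length_angle {0..L} u v \<sigma>"
    and M: "M = revolution ((\<lambda>s. (u s, v s)) ` {0..L})"
  shows "profile_piece 0 L u v \<sigma> M"
proof
  have at: "at s within {0..L} = at s" if "s \<in> {0<..<L}" for s
    using that by (simp add: at_within_Icc_at)
  note a = arc[unfolded arc_profile_def] and b = ang[unfolded arc_length_angle_def]
  have u0: "u 0 = 0" "u L = 0" and inj: "inj_on (\<lambda>s. (u s, v s)) {0..L}" using a by blast+
  have pos: "0 < u s" if "0 < s" "s < L" for s using a that by blast
  show "0 < L" using a by blast
  show "continuous_on {0..L} u" "continuous_on {0..L} v"
    using b unfolding continuous_on_eq_continuous_within by (blast intro: DERIV_continuous)+
  show "smooth_interval {0<..<L} u" "smooth_interval {0<..<L} v" "smooth_interval {0<..<L} \<sigma>"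
  proof -
    have sm: "smooth_interval {0..L} u" "smooth_interval {0..L} v" "smooth_interval {0..L} \<sigma>" using a b by blast+
    have sub: "{0<..<L} \<subseteq> {0..L}" by auto
    show "smooth_interval {0<..<L} u" "smooth_interval {0<..<L} v" "smooth_interval {0<..<L} \<sigma>"
      by (rule smooth_interval_subset[OF sm(1) sub] smooth_interval_subset[OF sm(2) sub] smooth_interval_subset[OF sm(3) sub])+
  qed
  show "0 < u s" if "s \<in> {0<..<L}" for s using pos that by simp
  show "0 \<le> u s" if "s \<in> {0..L}" for s
  proof (cases "s = 0 \<or> s = L")
    case False
    then have "0 < s" "s < L" using that by simp_all
    then have "0 < u s" by (rule pos)
    then show ?thesis by simp
  next
    case True
    then show ?thesis using u0 by (elim disjE) simp_all
  qed
  show "(u has_real_derivative cos (\<sigma> s)) (at s)" "(v has_real_derivative sqrt (4 + (u s)\<^sup>2) / 2 * sin (\<sigma> s)) (at s)"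
    if "s \<in> {0<..<L}" for s
  proof -
    have "s \<in> {0..L}" using that by simp
    then show "(u has_real_derivative cos (\<sigma> s)) (at s)" "(v has_real_derivative sqrt (4 + (u s)\<^sup>2) / 2 * sin (\<sigma> s)) (at s)"
      using b unfolding at[OF that, symmetric] by blast+
  qed
  show "s = t" if "s \<in> {0<..<L}" "t \<in> {0..L}" "u s = u t" "v s = v t" for s t
    using inj_onD[OF inj, of s t] that by simp
qed (rule M)

lemma periodic_image_eq:
  fixes L :: real
  assumes "0 < L" "\<And>s. f (s + L) = f s"
  shows "f ` {c..c + L} = f ` {d..d + L}"
proof -
  have "f ` {c..c + L} \<subseteq> f ` {d..d + L}" for c d
  proof
    fix y assume "y \<in> f ` {c..c + L}"
    then obtain s where s: "y = f s" by blast
    obtain k where k: "d \<le> s + of_int k * L" "s + of_int k * L < d + L" using translate_into_period[OF assms(1)] .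
    then have "s + of_int k * L \<in> {d..d + L}" by simp
    then show "y \<in> f ` {d..d + L}" using s periodic_add_int_mult[of f L s k] assms(2) by (metis imageI)
  qed
  then show ?thesis by blast
qed

lemma periodic_inj:
  fixes L :: real
  assumes L: "0 < L" and per: "\<And>s. f (s + L) = f s" and inj: "inj_on f {0..<L}"
    and st: "s \<in> {c<..<c + L}" "t \<in> {c..c + L}" "f s = f t"
  shows "s = t"
proof -
  obtain k where k: "0 \<le> s + of_int k * L" "s + of_int k * L < 0 + L" using translate_into_period[OF L] .
  obtain m where m: "0 \<le> t + of_int m * L" "t + of_int m * L < 0 + L" using translate_into_period[OF L] .
  have "f (s + of_int k * L) = f (t + of_int m * L)" using st(3) periodic_add_int_mult[of f, OF per] by metis
  then have "s + of_int k * L = t + of_int m * L" using inj k m unfolding inj_on_def by auto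
  then have eq: "s - t = of_int (m - k) * L" by (simp add: algebra_simps)
  have "\<bar>s - t\<bar> < L" using st by auto
  then have "\<bar>of_int (m - k) :: real\<bar> * L < 1 * L" unfolding eq using L by (simp add: abs_mult)
  then have "\<bar>of_int (m - k) :: real\<bar> < 1" using L by simp
  then have "m - k = 0" by linarith
  then show ?thesis using eq by simp
qed

lemma closed_profile_piece:
  assumes closed: "closed_profile L u v" and ang: "arc_length_angle UNIV u v \<sigma>"
    and M: "M = revolution ((\<lambda>s. (u s, v s)) ` {0..L})"
  shows "profile_piece c (c + L) u v \<sigma> M"
proof
  note a = closed[unfolded closed_profile_def] and b = ang[unfolded arc_length_angle_def]
  have L: "0 < L" and per: "\<And>s. (u (s + L), v (s + L)) = (u s, v s)" and inj: "inj_on (\<lambda>s. (u s, v s)) {0..<L}"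
    using a by auto
  show "c < c + L" using L by simp
  have du: "(u has_real_derivative cos (\<sigma> s)) (at s)" and dv: "(v has_real_derivative sqrt (4 + (u s)\<^sup>2) / 2 * sin (\<sigma> s)) (at s)" for s
    using b by auto
  show "continuous_on {c..c + L} u" "continuous_on {c..c + L} v"
    using du dv by (auto intro!: continuous_at_imp_continuous_on DERIV_isCont)
  show "smooth_interval {c<..<c + L} u" "smooth_interval {c<..<c + L} v" "smooth_interval {c<..<c + L} \<sigma>"
  proof -
    have sm: "smooth_interval UNIV u" "smooth_interval UNIV v" "smooth_interval UNIV \<sigma>" using a b by blast+
    show "smooth_interval {c<..<c + L} u" "smooth_interval {c<..<c + L} v" "smooth_interval {c<..<c + L} \<sigma>"
      by (rule smooth_interval_subset[OF sm(1) subset_UNIV] smooth_interval_subset[OF sm(2) subset_UNIV] smooth_interval_subset[OF sm(3) subset_UNIV])+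
  qed
  have pos: "0 < u s" for s using a by blast
  show "0 < u s" "0 \<le> u s" for s using pos[of s] by simp_all
  show "(u has_real_derivative cos (\<sigma> s)) (at s)" "(v has_real_derivative sqrt (4 + (u s)\<^sup>2) / 2 * sin (\<sigma> s)) (at s)" for s
    by (rule du dv)+
  show "M = revolution ((\<lambda>s. (u s, v s)) ` {c..c + L})"
    unfolding M using periodic_image_eq[of L "\<lambda>s. (u s, v s)" 0 c, OF L per] by simp
  show "s = t" if "s \<in> {c<..<c + L}" "t \<in> {c..c + L}" "u s = u t" "v s = v t" for s t
    using periodic_inj[of L "\<lambda>s. (u s, v s)" s c t, OF L per inj] that by simp
qed

section \<open>The energy of a profile piece\<close>

text \<open>The integrands contain \<open>deriv \<sigma>\<close> and quotients by \<open>u\<close>, which have no useful values at the ends of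
  an arc; they are exchanged for continuous functions on the closed interval.\<close>

lemma set_integral_eq_on_interior:
  fixes f g :: "real \<Rightarrow> real"
  assumes "continuous_on {a..b} g" "\<And>s. s \<in> {a<..<b} \<Longrightarrow> f s = g s"
  shows "set_integrable lborel {a..b} f" "(LINT s:{a..b}|lborel. f s) = (LINT s:{a..b}|lborel. g s)"
    "set_integrable lborel {a<..<b} f" "(LINT s:{a<..<b}|lborel. f s) = (LINT s:{a..b}|lborel. g s)"
proof -
  have g: "set_integrable lborel {a..b} g" by (rule borel_integrable_atLeastAtMost'[OF assms(1)])
  have eq: "indicator {a..b} s *\<^sub>R f s = indicator {a..b} s *\<^sub>R g s"
    "indicator {a<..<b} s *\<^sub>R f s = indicator {a..b} s *\<^sub>R g s" if "s \<notin> {a, b}" for s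
    using assms(2)[of s] that by (auto simp: indicator_def)
  show "set_integrable lborel {a..b} f" "set_integrable lborel {a<..<b} f"
    using g unfolding set_integrable_def
    by (subst integrable_discrete_difference[where X = "{a, b}"]; use eq in auto)+
  show "(LINT s:{a..b}|lborel. f s) = (LINT s:{a..b}|lborel. g s)"
    "(LINT s:{a<..<b}|lborel. f s) = (LINT s:{a..b}|lborel. g s)"
    unfolding set_lebesgue_integral_def
    by (rule integral_discrete_difference[where X = "{a, b}"]; use eq in auto)+
qed

text \<open>At a pole \<open>sin \<sigma>\<close> and \<open>u\<close> both vanish, with derivatives \<open>cos \<sigma> * D\<close> and \<open>cos \<sigma> \<noteq> 0\<close>, so their quotient
  tends to \<open>D\<close>.\<close>

lemma continuous_on_angular_curvature:
  fixes u \<sigma> D :: "real \<Rightarrow> real"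
  assumes u: "\<And>s. s \<in> {a..b} \<Longrightarrow> (u has_real_derivative cos (\<sigma> s)) (at s within {a..b})"
    and \<sigma>: "\<And>s. s \<in> {a..b} \<Longrightarrow> (\<sigma> has_real_derivative D s) (at s within {a..b})"
    and D: "continuous_on {a..b} D"
    and sin0: "\<And>s. s \<in> {a..b} \<Longrightarrow> u s = 0 \<Longrightarrow> sin (\<sigma> s) = 0"
    and pos: "\<And>s. s \<in> {a<..<b} \<Longrightarrow> 0 < u s"
  shows "continuous_on {a..b} (\<lambda>s. if u s = 0 then D s else sin (\<sigma> s) / u s)"
  unfolding continuous_on_eq_continuous_within
proof
  fix e assume e: "e \<in> {a..b}"
  have uc: "(u \<longlongrightarrow> u e) (at e within {a..b})" and sc: "(\<sigma> \<longlongrightarrow> \<sigma> e) (at e within {a..b})"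
    using DERIV_continuous[OF u[OF e]] DERIV_continuous[OF \<sigma>[OF e]] by (auto simp: continuous_within)
  show "continuous (at e within {a..b}) (\<lambda>s. if u s = 0 then D s else sin (\<sigma> s) / u s)"
  proof (cases "u e = 0")
    case False
    then have ev: "\<forall>\<^sub>F s in at e within {a..b}. u s \<noteq> 0" by (rule tendsto_imp_eventually_ne[OF uc])
    have "((\<lambda>s. sin (\<sigma> s) / u s) \<longlongrightarrow> sin (\<sigma> e) / u e) (at e within {a..b})"
      by (intro tendsto_intros uc sc False)
    then have "((\<lambda>s. if u s = 0 then D s else sin (\<sigma> s) / u s) \<longlongrightarrow> sin (\<sigma> e) / u e) (at e within {a..b})"
      by (rule Lim_transform_eventually) (use ev in \<open>auto elim: eventually_mono\<close>)
    then show ?thesis using False by (simp add: continuous_within)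
  next
    case True
    then have S: "sin (\<sigma> e) = 0" using sin0 e by simp
    then have C: "cos (\<sigma> e) \<noteq> 0" using sin_zero_norm_cos_one by fastforce
    have "((\<lambda>s. sin (\<sigma> s)) has_real_derivative cos (\<sigma> e) * D e) (at e within {a..b})"
      by (auto intro!: derivative_eq_intros \<sigma>[OF e])
    then have 1: "((\<lambda>s. sin (\<sigma> s) / (s - e)) \<longlongrightarrow> cos (\<sigma> e) * D e) (at e within {a..b})"
      unfolding has_field_derivative_iff S by simp
    have 2: "((\<lambda>s. u s / (s - e)) \<longlongrightarrow> cos (\<sigma> e)) (at e within {a..b})"
      using u[OF e] unfolding has_field_derivative_iff True by simp
    have "((\<lambda>s. (sin (\<sigma> s) / (s - e)) / (u s / (s - e))) \<longlongrightarrow> cos (\<sigma> e) * D e / cos (\<sigma> e)) (at e within {a..b})"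
      by (rule tendsto_divide[OF 1 2 C])
    then have 3: "((\<lambda>s. (sin (\<sigma> s) / (s - e)) / (u s / (s - e))) \<longlongrightarrow> D e) (at e within {a..b})" using C by simp
    have ne: "\<forall>\<^sub>F s in at e within {a..b}. u s \<noteq> 0 \<and> s \<noteq> e"
    proof -
      have "\<forall>\<^sub>F s in at e within {a..b}. u s / (s - e) \<noteq> 0" by (rule tendsto_imp_eventually_ne[OF 2 C])
      moreover have "\<forall>\<^sub>F s in at e within {a..b}. s \<noteq> e" by (simp add: eventually_at_filter)
      ultimately show ?thesis by eventually_elim auto
    qed
    have "((\<lambda>s. if u s = 0 then D s else sin (\<sigma> s) / u s) \<longlongrightarrow> D e) (at e within {a..b})"
      by (rule Lim_transform_eventually[OF 3]) (use ne in \<open>auto elim!: eventually_mono\<close>)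
    then show ?thesis using True by (simp add: continuous_within)
  qed
qed

context oriented_piece
begin

lemma continuous_on_deriv_\<sigma>: "continuous_on {a<..<b} (deriv \<sigma>)"
proof -
  obtain D where D: "D 0 = \<sigma>" "\<And>k s. s \<in> {a<..<b} \<Longrightarrow> (D k has_real_derivative D (Suc k) s) (at s within {a<..<b})"
    using smooth_\<sigma> unfolding smooth_interval_def by blast
  have "continuous_on {a<..<b} (D 1)"
    unfolding continuous_on_eq_continuous_within using D(2)[of _ 1] by (blast intro: DERIV_continuous)
  moreover have "D 1 s = deriv \<sigma> s" if "s \<in> {a<..<b}" for s
    using D(2)[OF that, of 0] D(1) at_within_open[OF that] by (simp add: DERIV_imp_deriv)
  ultimately show ?thesis by (rule continuous_on_eq)
qed

text \<open>In a chart the density is the continuous expression in \<open>s\<close> found above. Continuity on countably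
  many charts is the source of its measurability.\<close>

lemma continuous_on_spinor_density: "continuous_on (Phi ` chart_box \<alpha>) (spinor_density M n)"
proof -
  obtain \<psi> where \<psi>: "homeomorphism (chart_box \<alpha>) (Phi ` chart_box \<alpha>) Phi \<psi>"
    using local_param_Phi[of \<alpha>] unfolding local_param_def by blast
  define g where "g = (\<lambda>s. ((deriv \<sigma> s + sin (\<sigma> s) / u s) / 2)\<^sup>2 - (cos (\<sigma> s))\<^sup>2 / (4 + (u s)\<^sup>2))"
  have "4 + (u s)\<^sup>2 \<noteq> 0" for s using add_pos_nonneg[of 4 "(u s)\<^sup>2"] by simp
  then have g: "continuous_on {a<..<b} g"
    unfolding g_def using u_pos
    by (intro continuous_intros continuous_on_deriv_\<sigma> continuous_on_profile_interior) force+
  have \<psi>_cont: "continuous_on (Phi ` chart_box \<alpha>) \<psi>" using \<psi> by (simp add: homeomorphism_def)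
  have "continuous_on (Phi ` chart_box \<alpha>) (\<lambda>p. g (\<psi> p $ 1))"
  proof (rule continuous_on_compose2[OF g])
    show "continuous_on (Phi ` chart_box \<alpha>) (\<lambda>p. \<psi> p $ 1)" by (intro continuous_intros \<psi>_cont)
    show "(\<lambda>p. \<psi> p $ 1) ` Phi ` chart_box \<alpha> \<subseteq> {a<..<b}"
    proof (clarsimp simp del: mem_box)
      fix x assume "x \<in> chart_box \<alpha>"
      then show "a < \<psi> (Phi x) $ 1 \<and> \<psi> (Phi x) $ 1 < b"
        using homeomorphism_apply1[OF \<psi>] by (simp add: mem_chart_box)
    qed
  qed
  moreover have "spinor_density M n p = g (\<psi> p $ 1)" if p: "p \<in> Phi ` chart_box \<alpha>" for p
  proof -
    obtain x where x: "x \<in> chart_box \<alpha>" "p = Phi x" using p by blast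
    then have "x $ 1 \<in> {a<..<b}" "\<psi> p = x" using homeomorphism_apply1[OF \<psi>] by (simp_all add: mem_chart_box)
    then show ?thesis using spinor_density_interior[of "x $ 1" "x $ 2"] x(2) by (simp add: Phi_def g_def)
  qed
  ultimately show ?thesis by (simp cong: continuous_on_cong)
qed

text \<open>The null set \<open>Z\<close> contains the part of \<open>M\<close> over the ends of the piece. For an arc it consists of the
  two poles, for a closed profile of one orbit.\<close>

lemma spinor_energy_formula:
  assumes \<mu>: "area_measure M \<mu>"
    and Z: "Z \<in> null_sets \<mu>" "\<And>e \<theta>. e \<in> {a, b} \<Longrightarrow> cylindrical (u e) \<theta> (v e) \<in> Z"
    and meas: "spinor_density M n \<in> borel_measurable \<mu>"
    and \<sigma>: "\<And>s. s \<in> {a..b} \<Longrightarrow> (\<sigma> has_real_derivative D s) (at s within {a..b})"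
    and u: "\<And>s. s \<in> {a..b} \<Longrightarrow> (u has_real_derivative cos (\<sigma> s)) (at s within {a..b})"
    and D: "continuous_on {a..b} D"
    and sin0: "\<And>s. s \<in> {a..b} \<Longrightarrow> u s = 0 \<Longrightarrow> sin (\<sigma> s) = 0"
  shows "integrable \<mu> (spinor_density M n)"
    and "set_integrable lborel {a..b} (bending_density u \<sigma>)"
    and "set_integrable lborel {a..b} (boundary_density u)"
    and "spinor_energy M n \<mu> = pi / 16 * (LINT s:{a..b}|lborel. bending_density u \<sigma> s)
      - pi / 4 * (LINT s:{a..b}|lborel. boundary_density u s)"
    and "(LINT s:{a..b}|lborel. boundary_density u s) =
      cos (\<sigma> b) * sqrt (4 + (u b)\<^sup>2) - cos (\<sigma> a) * sqrt (4 + (u a)\<^sup>2)"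
proof -
  define \<kappa> where "\<kappa> = (\<lambda>s. if u s = 0 then D s else sin (\<sigma> s) / u s)"
  define q where "q = (\<lambda>s. sqrt (4 + (u s)\<^sup>2))"
  define B where "B = (\<lambda>s. (D s - \<kappa> s)\<^sup>2 * (u s * q s))"
  define E where "E = (\<lambda>s. - sin (\<sigma> s) * D s * q s + (cos (\<sigma> s))\<^sup>2 * u s / q s)"
  have \<kappa>: "continuous_on {a..b} \<kappa>"
    unfolding \<kappa>_def by (rule continuous_on_angular_curvature[OF u \<sigma> D sin0 u_pos])
  have \<sigma>c: "continuous_on {a..b} \<sigma>"
    unfolding continuous_on_eq_continuous_within using \<sigma> by (blast intro: DERIV_continuous)
  have q0: "q s > 0" for s unfolding q_def by (simp add: add_pos_nonneg)
  have qc: "continuous_on {a..b} q" unfolding q_def by (intro continuous_intros cont_u)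
  have Bc: "continuous_on {a..b} B" unfolding B_def by (intro continuous_intros D \<kappa> cont_u qc)
  have Ec: "continuous_on {a..b} E"
    unfolding E_def by (intro continuous_intros D \<sigma>c cont_u qc) (use q0 in \<open>auto simp: less_imp_neq[symmetric]\<close>)
  have at: "at s within {a..b} = at s" if "s \<in> {a<..<b}" for s using that by (simp add: at_within_Icc_at)
  have D\<sigma>: "deriv \<sigma> s = D s" if "s \<in> {a<..<b}" for s
    using \<sigma>[of s] that at[OF that] by (simp add: DERIV_imp_deriv)
  have \<kappa>i: "\<kappa> s = sin (\<sigma> s) / u s" if "s \<in> {a<..<b}" for s using u_pos[OF that] by (simp add: \<kappa>_def)
  have Beq: "bending_density u \<sigma> s = B s" if s: "s \<in> {a<..<b}" for s
  proof -
    have "4 * (u s)\<^sup>2 + u s ^ 4 = (u s)\<^sup>2 * (4 + (u s)\<^sup>2)" by (simp add: algebra_simps power2_eq_square power4_eq_xxxx)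
    then have "sqrt (4 * (u s)\<^sup>2 + u s ^ 4) = u s * q s"
      using u_pos[OF s] by (simp add: real_sqrt_mult q_def)
    then show ?thesis by (simp add: bending_density_def B_def D\<sigma>[OF s] \<kappa>i[OF s])
  qed
  have dE: "((\<lambda>t. cos (\<sigma> t) * q t) has_real_derivative E s) (at s within {a..b})" if s: "s \<in> {a..b}" for s
  proof -
    have dq: "(q has_real_derivative u s * cos (\<sigma> s) / q s) (at s within {a..b})"
      unfolding q_def using q0[of s] by (auto intro!: derivative_eq_intros u[OF s] simp: q_def field_simps)
    have dC: "((\<lambda>t. cos (\<sigma> t)) has_real_derivative - sin (\<sigma> s) * D s) (at s within {a..b})"
      by (auto intro!: derivative_eq_intros \<sigma>[OF s])
    show ?thesis
      by (rule DERIV_cong[OF DERIV_mult[OF dC dq]]) (simp add: E_def power2_eq_square)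
  qed
  have Eeq: "boundary_density u s = E s" if s: "s \<in> {a<..<b}" for s
  proof -
    have "((\<lambda>t. cos (\<sigma> t) * q t) has_real_derivative E s) (at s)" using dE[of s] s at[OF s] by auto
    moreover have "cos (\<sigma> t) * q t = deriv u t * sqrt (4 + (u t)\<^sup>2)" if "t \<in> {a<..<b}" for t
      using DERIV_imp_deriv[OF du[OF that]] by (simp add: q_def)
    ultimately have "((\<lambda>t. deriv u t * sqrt (4 + (u t)\<^sup>2)) has_real_derivative E s) (at s)"
      by (rule has_field_derivative_transform_within_open[OF _ open_greaterThanLessThan s])
    then show ?thesis unfolding boundary_density_def by (rule DERIV_imp_deriv)
  qed
  note Bi = set_integral_eq_on_interior[where f = "bending_density u \<sigma>", OF Bc Beq]
  note Ei = set_integral_eq_on_interior[where f = "boundary_density u", OF Ec Eeq]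
  show "set_integrable lborel {a..b} (bending_density u \<sigma>)" by (rule Bi(1))
  show "set_integrable lborel {a..b} (boundary_density u)" by (rule Ei(1))
  define g where "g = (\<lambda>s. ((deriv \<sigma> s + sin (\<sigma> s) / u s) / 2)\<^sup>2 - (cos (\<sigma> s))\<^sup>2 / (4 + (u s)\<^sup>2))"
  (* with k = sin s / u: (D + k)^2 = (D - k)^2 + 4 D k, and the mixed term D k u q / 2 belongs to - E / 2 *)
  have geq: "g s * (u s * sqrt (4 + (u s)\<^sup>2) / 2) = B s / 8 - E s / 2" if s: "s \<in> {a<..<b}" for s
  proof -
    have q2: "4 + (u s)\<^sup>2 = q s * q s" by (simp add: q_def)
    have S: "sin (\<sigma> s) = u s * \<kappa> s" using u_pos[OF s] by (simp add: \<kappa>i[OF s])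
    show ?thesis
      unfolding g_def D\<sigma>[OF s] \<kappa>i[OF s, symmetric] q_def[symmetric] q2 B_def E_def S
      using q0[of s] by (simp add: field_simps power2_eq_square)
  qed
  have "continuous_on {a..b} (\<lambda>s. B s / 8 - E s / 2)" by (intro continuous_intros Bc Ec) auto
  note gi = set_integral_eq_on_interior[OF this geq]
  have \<Sigma>: "integrable \<mu> (spinor_density M n)"
    "(LINT p|\<mu>. spinor_density M n p) = 2 * pi * (LINT s:{a<..<b}|lborel. g s * (u s * sqrt (4 + (u s)\<^sup>2) / 2))"
    by (rule area_measure_integral[OF \<mu> Z meas _ gi(3)]; simp add: spinor_density_interior g_def)+
  show "integrable \<mu> (spinor_density M n)" by (rule \<Sigma>(1))
  have "set_integrable lborel {a..b} B" "set_integrable lborel {a..b} E"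
    by (rule borel_integrable_atLeastAtMost'[OF Bc] borel_integrable_atLeastAtMost'[OF Ec])+
  then have split: "(LINT s:{a..b}|lborel. B s / 8 - E s / 2) = (LINT s:{a..b}|lborel. B s) / 8 - (LINT s:{a..b}|lborel. E s) / 2"
    by (subst set_integral_diff) (auto simp: set_integrable_divide)
  have "(LINT s:{a<..<b}|lborel. g s * (u s * sqrt (4 + (u s)\<^sup>2) / 2)) = (LINT s:{a..b}|lborel. B s / 8 - E s / 2)"
    by (rule gi(4))
  then have gval: "(LINT s:{a<..<b}|lborel. g s * (u s * sqrt (4 + (u s)\<^sup>2) / 2)) =
      (LINT s:{a..b}|lborel. bending_density u \<sigma> s) / 8 - (LINT s:{a..b}|lborel. boundary_density u s) / 2"
    using split Bi(2) Ei(2) by linarith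
  show "spinor_energy M n \<mu> = pi / 16 * (LINT s:{a..b}|lborel. bending_density u \<sigma> s)
      - pi / 4 * (LINT s:{a..b}|lborel. boundary_density u s)"
    unfolding spinor_energy_def \<Sigma>(2) gval by (simp add: right_diff_distrib)
  have "(LINT s:{a..b}|lborel. E s) = cos (\<sigma> b) * q b - cos (\<sigma> a) * q a"
    unfolding set_lebesgue_integral_def
    by (rule integral_FTC_atLeastAtMost[where F = "\<lambda>s. cos (\<sigma> s) * q s"])
      (use ab dE Ec in \<open>auto simp: has_real_derivative_iff_has_vector_derivative\<close>)
  with Ei(2) show "(LINT s:{a..b}|lborel. boundary_density u s) =
      cos (\<sigma> b) * sqrt (4 + (u b)\<^sup>2) - cos (\<sigma> a) * sqrt (4 + (u a)\<^sup>2)"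
    by (simp add: q_def)
qed

end

section \<open>Topology of a surface of revolution\<close>

text \<open>The fibres define a bijection of the images. It is continuous because compact sets have compact, hence
  closed, images, so that both images carry the quotient topology.\<close>

lemma homeomorphic_of_common_quotient:
  fixes f :: "'a::t2_space \<Rightarrow> 'b::t2_space" and g :: "'a \<Rightarrow> 'c::t2_space"
  assumes K: "compact K" and f: "continuous_on K f" and g: "continuous_on K g"
    and fibres: "\<And>x y. x \<in> K \<Longrightarrow> y \<in> K \<Longrightarrow> f x = f y \<longleftrightarrow> g x = g y"
  shows "f ` K homeomorphic g ` K"
proof -
  define h where "h = (\<lambda>p. g (SOME x. x \<in> K \<and> f x = p))"
  have h: "h (f x) = g x" if "x \<in> K" for x
  proof -
    have "(SOME y. y \<in> K \<and> f y = f x) \<in> K \<and> f (SOME y. y \<in> K \<and> f y = f x) = f x"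
      by (rule someI[where P = "\<lambda>y. y \<in> K \<and> f y = f x" and x = x]) (use that in simp)
    then show ?thesis using fibres[of "SOME y. y \<in> K \<and> f y = f x" x] that by (simp add: h_def)
  qed
  have "continuous_on (f ` K) h"
  proof (rule continuous_closedin_preimage_eq[THEN iffD2], intro allI impI)
    fix C :: "'c set" assume "closed C"
    then have "closedin (top_of_set K) (K \<inter> g -` C)" by (rule continuous_closedin_preimage[OF g])
    then have "compact (K \<inter> g -` C)" using K closedin_compact by blast
    then have "compact (f ` (K \<inter> g -` C))" by (rule compact_continuous_image[rotated]) (rule continuous_on_subset[OF f], simp)
    then have "closed (f ` (K \<inter> g -` C))" by (rule compact_imp_closed)
    moreover have "f ` K \<inter> h -` C = f ` (K \<inter> g -` C)" using h by force
    ultimately show "closedin (top_of_set (f ` K)) (f ` K \<inter> h -` C)" by (simp add: closed_subset image_mono)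
  qed
  moreover have "inj_on h (f ` K)" using h fibres by (auto simp: inj_on_def)
  moreover have "h ` f ` K = g ` K" using h by force
  ultimately show ?thesis
    using homeomorphism_compact[OF compact_continuous_image[OF f K]] unfolding homeomorphic_def by metis
qed

lemma cylindrical_eq_iff:
  assumes "0 \<le> r" "0 \<le> r'"
  shows "cylindrical r \<theta> h = cylindrical r' \<theta>' h' \<longleftrightarrow> r = r' \<and> h = h' \<and> (r = 0 \<or> cos \<theta> = cos \<theta>' \<and> sin \<theta> = sin \<theta>')"
proof
  assume eq: "cylindrical r \<theta> h = cylindrical r' \<theta>' h'"
  then have "(r, h) = (r', h')" using orbit_map_cylindrical[OF assms(1)] orbit_map_cylindrical[OF assms(2)] by metis
  with eq show "r = r' \<and> h = h' \<and> (r = 0 \<or> cos \<theta> = cos \<theta>' \<and> sin \<theta> = sin \<theta>')"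
    by (auto simp: cylindrical_def vec_eq_iff forall_3)
qed (auto simp: cylindrical_def)

lemma compact_param_rectangle: "compact ({0..L} \<times> {0..2 * pi :: real})" for L :: real
  by (intro compact_Times) auto

text \<open>A whole turn of angles is used together with both ends, at the price of identifications that
  \<open>homeomorphic_of_common_quotient\<close> matches with those of the standard sphere or torus.\<close>

lemma (in profile_piece) revolution_as_quotient:
  assumes "a = 0"
  shows "(\<lambda>(s, \<theta>). cylindrical (u s) \<theta> (v s)) ` ({0..b} \<times> {0..2 * pi}) = M"
    and "continuous_on ({0..b} \<times> {0..2 * pi}) (\<lambda>(s, \<theta>). cylindrical (u s) \<theta> (v s))"
proof -
  show "(\<lambda>(s, \<theta>). cylindrical (u s) \<theta> (v s)) ` ({0..b} \<times> {0..2 * pi}) = M"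
  proof
    show "(\<lambda>(s, \<theta>). cylindrical (u s) \<theta> (v s)) ` ({0..b} \<times> {0..2 * pi}) \<subseteq> M"
      using Phi_mem assms by auto
    show "M \<subseteq> (\<lambda>(s, \<theta>). cylindrical (u s) \<theta> (v s)) ` ({0..b} \<times> {0..2 * pi})"
    proof
      fix p assume "p \<in> M"
      then obtain s \<theta> where "s \<in> {a..b}" "pi - pi \<le> \<theta>" "\<theta> < pi + pi" "p = cylindrical (u s) \<theta> (v s)"
        by (rule Phi_cover[of _ pi])
      then show "p \<in> (\<lambda>(s, \<theta>). cylindrical (u s) \<theta> (v s)) ` ({0..b} \<times> {0..2 * pi})"
        using assms by (intro image_eqI[of _ _ "(s, \<theta>)"]) auto
    qed
  qed
  have "continuous_on ({0..b} \<times> {0..2 * pi}) (\<lambda>x. u (fst x))" "continuous_on ({0..b} \<times> {0..2 * pi}) (\<lambda>x. v (fst x))"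
    using assms by (auto intro!: continuous_on_compose2[OF cont_u] continuous_on_compose2[OF cont_v] continuous_intros)
  then show "continuous_on ({0..b} \<times> {0..2 * pi}) (\<lambda>(s, \<theta>). cylindrical (u s) \<theta> (v s))"
    unfolding case_prod_unfold cylindrical_def by (intro continuous_on_vector_3 continuous_intros) auto
qed

text \<open>The standard sphere is parametrized over the same rectangle by the polar angle \<open>pi * s / L\<close> and the
  longitude. Both maps collapse precisely the sides \<open>s = 0\<close> and \<open>s = L\<close> to points and close up the
  angle.\<close>

lemma arc_revolution_homeomorphic_sphere:
  assumes arc: "arc_profile L u v" and ang: "arc_length_angle {0..L} u v \<sigma>"
    and M: "M = revolution ((\<lambda>s. (u s, v s)) ` {0..L})"
  shows "M homeomorphic (sphere 0 1 :: (real^3) set)"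
proof -
  interpret profile_piece 0 L u v \<sigma> M by (rule arc_profile_piece[OF assms])
  have u0: "u 0 = 0" "u L = 0" and inj_arc: "inj_on (\<lambda>s. (u s, v s)) {0..L}" and L: "0 < L"
    using arc unfolding arc_profile_def by blast+
  define G where "G = (\<lambda>(s, \<theta>). vector [sin (pi * s / L) * cos \<theta>, sin (pi * s / L) * sin \<theta>, cos (pi * s / L)] :: real^3)"
  let ?K = "{0..L} \<times> {0..2 * pi}"
  have ang_range: "0 \<le> pi * s / L" "pi * s / L \<le> pi" if "s \<in> {0..L}" for s
    using that L by (auto simp: field_simps)
  have sin0: "sin (pi * s / L) = 0 \<longleftrightarrow> u s = 0" if s: "s \<in> {0..L}" for s
  proof (cases "s = 0 \<or> s = L")
    case True
    then show ?thesis using u0 L by auto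
  next
    case False
    then have "0 < s" "s < L" using s by auto
    then have "0 < pi * s / L" "pi * s / L < pi" using L by (auto simp: field_simps)
    then have "sin (pi * s / L) > 0" by (rule sin_gt_zero)
    then show ?thesis using u_pos[of s] \<open>0 < s\<close> \<open>s < L\<close> by simp
  qed
  have "(\<lambda>(s, \<theta>). cylindrical (u s) \<theta> (v s)) ` ?K homeomorphic G ` ?K"
  proof (rule homeomorphic_of_common_quotient[OF compact_param_rectangle revolution_as_quotient(2)[OF refl]])
    show "continuous_on ?K G"
      unfolding G_def case_prod_unfold by (intro continuous_on_vector_3 continuous_intros) (use L in auto)
    fix x y assume xy: "x \<in> ?K" "y \<in> ?K"
    obtain s \<theta> where x: "x = (s, \<theta>)" by fastforce
    obtain t \<phi> where y: "y = (t, \<phi>)" by fastforce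
    have st: "s \<in> {0..L}" "t \<in> {0..L}" using xy x y by auto
    have uv: "u s = u t \<and> v s = v t \<longleftrightarrow> s = t" using inj_onD[OF inj_arc, of s t] st by auto
    have "cylindrical (u s) \<theta> (v s) = cylindrical (u t) \<phi> (v t) \<longleftrightarrow>
        s = t \<and> (u s = 0 \<or> cos \<theta> = cos \<phi> \<and> sin \<theta> = sin \<phi>)"
      using cylindrical_eq_iff[OF u_nonneg[OF st(1)] u_nonneg[OF st(2)]] uv by auto
    also have "\<dots> \<longleftrightarrow> G (s, \<theta>) = G (t, \<phi>)"
    proof
      assume "s = t \<and> (u s = 0 \<or> cos \<theta> = cos \<phi> \<and> sin \<theta> = sin \<phi>)"
      then show "G (s, \<theta>) = G (t, \<phi>)" using sin0[OF st(1)] by (auto simp: G_def)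
    next
      assume eq: "G (s, \<theta>) = G (t, \<phi>)"
      then have "cos (pi * s / L) = cos (pi * t / L)" by (simp add: G_def vec_eq_iff forall_3)
      then have "pi * s / L = pi * t / L" using cos_inj_pi ang_range st by blast
      then have "s = t" using L by simp
      with eq show "s = t \<and> (u s = 0 \<or> cos \<theta> = cos \<phi> \<and> sin \<theta> = sin \<phi>)"
        using sin0[OF st(1)] by (auto simp: G_def vec_eq_iff forall_3)
    qed
    finally show "(case x of (s, \<theta>) \<Rightarrow> cylindrical (u s) \<theta> (v s)) = (case y of (s, \<theta>) \<Rightarrow> cylindrical (u s) \<theta> (v s)) \<longleftrightarrow> G x = G y"
      by (simp add: x y)
  qed
  moreover have "G ` ?K = sphere 0 1"
  proof
    show "G ` ?K \<subseteq> sphere 0 1"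
    proof clarify
      fix s \<theta>
      have "(sin (pi * s / L) * cos \<theta>)\<^sup>2 + (sin (pi * s / L) * sin \<theta>)\<^sup>2 = (sin (pi * s / L))\<^sup>2 * ((sin \<theta>)\<^sup>2 + (cos \<theta>)\<^sup>2)"
        by (simp only: power_mult_distrib distrib_left add.commute)
      then have "G (s, \<theta>) \<bullet> G (s, \<theta>) = 1"
        by (simp add: G_def inner_vec_def sum_3 flip: power2_eq_square)
      then show "G (s, \<theta>) \<in> sphere 0 1" by (simp add: norm_eq_1)
    qed
    show "sphere 0 1 \<subseteq> G ` ?K"
    proof
      fix x :: "real^3" assume "x \<in> sphere 0 1"
      then have x: "(x $ 1)\<^sup>2 + (x $ 2)\<^sup>2 + (x $ 3)\<^sup>2 = 1"
        by (simp add: norm_eq_1 inner_vec_def sum_3 flip: power2_eq_square)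
      define \<phi> where "\<phi> = arccos (x $ 3)"
      have "(x $ 3)\<^sup>2 \<le> 1" using x zero_le_power2[of "x $ 1"] zero_le_power2[of "x $ 2"] by linarith
      then have x3: "- 1 \<le> x $ 3" "x $ 3 \<le> 1" by (auto simp: abs_square_le_1 abs_le_iff)
      have \<phi>: "0 \<le> \<phi>" "\<phi> \<le> pi" "cos \<phi> = x $ 3" unfolding \<phi>_def using x3 by (auto intro: arccos_lbound arccos_ubound)
      have "(x $ 1)\<^sup>2 + (x $ 2)\<^sup>2 = (sin \<phi>)\<^sup>2" using x \<phi>(3) sin_cos_squared_add[of \<phi>] by simp
      obtain t where t: "0 \<le> t" "t \<le> 2 * pi" "x $ 1 = sin \<phi> * cos t" "x $ 2 = sin \<phi> * sin t"
      proof (cases "sin \<phi> = 0")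
        case True
        then have "x $ 1 = 0" "x $ 2 = 0" using \<open>(x $ 1)\<^sup>2 + (x $ 2)\<^sup>2 = (sin \<phi>)\<^sup>2\<close> by (simp_all add: sum_power2_eq_zero_iff)
        then show ?thesis using that[of 0] True by simp
      next
        case False
        have "(x $ 1 / sin \<phi>)\<^sup>2 + (x $ 2 / sin \<phi>)\<^sup>2 = ((x $ 1)\<^sup>2 + (x $ 2)\<^sup>2) / (sin \<phi>)\<^sup>2"
          by (simp only: power_divide add_divide_distrib)
        also have "\<dots> = 1" using False \<open>(x $ 1)\<^sup>2 + (x $ 2)\<^sup>2 = (sin \<phi>)\<^sup>2\<close> by simp
        finally obtain t where "0 \<le> t" "t < 2 * pi" "x $ 1 / sin \<phi> = cos t" "x $ 2 / sin \<phi> = sin t"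
          using sincos_total_2pi by metis
        then show ?thesis using that[of t] False by (simp add: field_simps)
      qed
      have "x = G (\<phi> * L / pi, t)" using t \<phi>(3) L by (simp add: G_def vec_eq_iff forall_3)
      moreover have "(\<phi> * L / pi, t) \<in> ?K" using t \<phi> L by (simp add: field_simps)
      ultimately show "x \<in> G ` ?K" by blast
    qed
  qed
  ultimately show ?thesis using revolution_as_quotient(1)[OF refl] by simp
qed

lemma cis_eq_cis_iff: "cis a = cis b \<longleftrightarrow> cos a = cos b \<and> sin a = sin b"
  by (simp add: complex_eq_iff)

text \<open>Here the competing parametrization is the product of two parametrizations of the circle; both maps
  identify opposite sides of the rectangle and nothing else.\<close>

lemma closed_revolution_homeomorphic_torus:
  assumes closed: "closed_profile L u v" and ang: "arc_length_angle UNIV u v \<sigma>"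
    and M: "M = revolution ((\<lambda>s. (u s, v s)) ` {0..L})"
  shows "M homeomorphic (circle \<times> circle)"
proof -
  interpret profile_piece 0 L u v \<sigma> M using closed_profile_piece[OF assms, of 0] by simp
  have L: "0 < L" and per: "\<And>s. u (s + L) = u s" "\<And>s. v (s + L) = v s" and inj0: "inj_on (\<lambda>s. (u s, v s)) {0..<L}"
    and pos: "\<And>s. 0 < u s"
    using closed unfolding closed_profile_def by auto
  define G where "G = (\<lambda>(s, \<theta>). (cis (2 * pi * s / L), cis \<theta>))"
  let ?K = "{0..L} \<times> {0..2 * pi}"
  have uv: "u s = u t \<and> v s = v t \<longleftrightarrow> cis (2 * pi * s / L) = cis (2 * pi * t / L)" if st: "s \<in> {0..L}" "t \<in> {0..L}" for s t
  proof
    assume eq: "u s = u t \<and> v s = v t"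
    show "cis (2 * pi * s / L) = cis (2 * pi * t / L)"
    proof (cases "s = t")
      case False
      have "s \<notin> {0<..<L}" using inj[of s t] eq st False by auto
      moreover have "t \<notin> {0<..<L}" using inj[of t s] eq st False by auto
      ultimately have "s = 0 \<and> t = L \<or> s = L \<and> t = 0" using st False by auto
      then show ?thesis using L by (auto simp: cis_eq_cis_iff)
    qed simp
  next
    assume "cis (2 * pi * s / L) = cis (2 * pi * t / L)"
    then obtain n :: int where "2 * pi * s / L = 2 * pi * t / L + 2 * pi * of_int n"
      unfolding cis_eq_cis_iff using sin_cos_eq_iff by metis
    then have "2 * pi * s = 2 * pi * (t + of_int n * L)" using L by (simp add: field_simps)
    then have "s = t + of_int n * L" by simp
    then show "u s = u t \<and> v s = v t"
      using periodic_add_int_mult[of u L t n, OF per(1)] periodic_add_int_mult[of v L t n, OF per(2)] by simp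
  qed
  have "(\<lambda>(s, \<theta>). cylindrical (u s) \<theta> (v s)) ` ?K homeomorphic G ` ?K"
  proof (rule homeomorphic_of_common_quotient[OF compact_param_rectangle revolution_as_quotient(2)[OF refl]])
    show "continuous_on ?K G"
      unfolding G_def case_prod_unfold
      by (intro continuous_on_Pair continuous_on_cis continuous_intros) (use L in auto)
    fix x y assume xy: "x \<in> ?K" "y \<in> ?K"
    obtain s \<theta> where x: "x = (s, \<theta>)" by fastforce
    obtain t \<phi> where y: "y = (t, \<phi>)" by fastforce
    have st: "s \<in> {0..L}" "t \<in> {0..L}" using xy x y by auto
    have "u s \<noteq> 0" using pos[of s] by simp
    then have "cylindrical (u s) \<theta> (v s) = cylindrical (u t) \<phi> (v t) \<longleftrightarrow>
        (u s = u t \<and> v s = v t) \<and> cos \<theta> = cos \<phi> \<and> sin \<theta> = sin \<phi>"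
      unfolding cylindrical_eq_iff[OF u_nonneg[OF st(1)] u_nonneg[OF st(2)]] conj_assoc by simp
    also have "\<dots> \<longleftrightarrow> G x = G y"
      unfolding uv[OF st] x y G_def prod.case prod.inject cis_eq_cis_iff[of \<theta> \<phi>] ..
    finally have "cylindrical (u s) \<theta> (v s) = cylindrical (u t) \<phi> (v t) \<longleftrightarrow> G x = G y" .
    then show "(case x of (s, \<theta>) \<Rightarrow> cylindrical (u s) \<theta> (v s)) = (case y of (s, \<theta>) \<Rightarrow> cylindrical (u s) \<theta> (v s)) \<longleftrightarrow> G x = G y"
      by (simp add: x y)
  qed
  moreover have "G ` ?K = circle \<times> circle"
  proof
    show "G ` ?K \<subseteq> circle \<times> circle" by (auto simp: G_def)
    have cis_surj: "\<exists>t. 0 \<le> t \<and> t \<le> 2 * pi \<and> w = cis t" if "w \<in> circle" for w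
    proof -
      have "(Re w)\<^sup>2 + (Im w)\<^sup>2 = 1" using that cmod_power2[of w] by simp
      then obtain t where "0 \<le> t" "t < 2 * pi" "Re w = cos t" "Im w = sin t" using sincos_total_2pi by metis
      then show ?thesis by (intro exI[of _ t]) (simp add: complex_eq_iff)
    qed
    show "circle \<times> circle \<subseteq> G ` ?K"
    proof clarify
      fix w z :: complex assume "w \<in> circle" "z \<in> circle"
      then obtain a b where ab: "0 \<le> a" "a \<le> 2 * pi" "w = cis a" "0 \<le> b" "b \<le> 2 * pi" "z = cis b" using cis_surj by metis
      have "a * L \<le> 2 * pi * L" using ab(2) L by (intro mult_right_mono) auto
      then have "(a * L / (2 * pi), b) \<in> ?K" using ab L by (simp add: field_simps)
      moreover have "(w, z) = G (a * L / (2 * pi), b)" using ab L by (simp add: G_def)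
      ultimately show "(w, z) \<in> G ` ?K" by blast
    qed
  qed
  ultimately show ?thesis using revolution_as_quotient(1)[OF refl] by simp
qed

section \<open>The spinor energy\<close>

lemma smooth_interval_derivative:
  assumes "smooth_interval I f"
  obtains D where "\<And>s. s \<in> I \<Longrightarrow> (f has_real_derivative D s) (at s within I)" "continuous_on I D"
proof -
  obtain D where D: "D 0 = f" "\<And>k s. s \<in> I \<Longrightarrow> (D k has_real_derivative D (Suc k) s) (at s within I)"
    using assms unfolding smooth_interval_def by blast
  show ?thesis
  proof
    show "(f has_real_derivative D 1 s) (at s within I)" if "s \<in> I" for s using D(2)[OF that, of 0] D(1) by simp
    show "continuous_on I (D 1)"
      unfolding continuous_on_eq_continuous_within using D(2)[of _ 1] by (blast intro: DERIV_continuous)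
  qed
qed

lemma chart_image_borel:
  assumes "compact M" "local_param M U \<phi>"
  shows "\<phi> ` U \<subseteq> M" "\<phi> ` U \<in> sets borel"
proof -
  obtain T where "open T" "\<phi> ` U = M \<inter> T" using assms(2) unfolding local_param_def openin_open by blast
  then show "\<phi> ` U \<subseteq> M" "\<phi> ` U \<in> sets borel"
    using borel_closed[OF compact_imp_closed[OF assms(1)]] borel_open by auto
qed

lemma DERIV_nonneg_left_endpoint:
  fixes f :: "real \<Rightarrow> real"
  assumes "a < b" "(f has_real_derivative d) (at a within {a..b})" "f a = 0" "\<And>s. s \<in> {a..b} \<Longrightarrow> 0 \<le> f s"
  shows "0 \<le> d"
proof (rule tendsto_lowerbound)
  show "((\<lambda>s. (f s - f a) / (s - a)) \<longlongrightarrow> d) (at a within {a..b})" using assms(2) by (simp add: has_field_derivative_iff)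
  show "\<forall>\<^sub>F s in at a within {a..b}. 0 \<le> (f s - f a) / (s - a)"
    unfolding eventually_at_filter using assms(3,4) by (intro always_eventually) auto
  show "at a within {a..b} \<noteq> bot" using assms(1) by (simp add: trivial_limit_within islimpt_Icc)
qed

lemma DERIV_nonpos_right_endpoint:
  fixes f :: "real \<Rightarrow> real"
  assumes "a < b" "(f has_real_derivative d) (at b within {a..b})" "f b = 0" "\<And>s. s \<in> {a..b} \<Longrightarrow> 0 \<le> f s"
  shows "d \<le> 0"
proof (rule tendsto_upperbound)
  show "((\<lambda>s. (f s - f b) / (s - b)) \<longlongrightarrow> d) (at b within {a..b})" using assms(2) by (simp add: has_field_derivative_iff)
  show "\<forall>\<^sub>F s in at b within {a..b}. (f s - f b) / (s - b) \<le> 0"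
    unfolding eventually_at_filter using assms(3,4) by (intro always_eventually) (auto intro: divide_nonneg_neg)
  show "at b within {a..b} \<noteq> bot" using assms(1) by (simp add: trivial_limit_within islimpt_Icc)
qed

text \<open>By the quotient rule \<open>(sin \<sigma> / u)' = cos \<sigma> (\<sigma>' - sin \<sigma> / u) / u\<close>, which is \<open>0\<close> here.\<close>

lemma angular_curvature_constant:
  fixes u \<sigma> D :: "real \<Rightarrow> real"
  assumes "\<And>s. s \<in> {a<..<b} \<Longrightarrow> (u has_real_derivative cos (\<sigma> s)) (at s)"
    and "\<And>s. s \<in> {a<..<b} \<Longrightarrow> (\<sigma> has_real_derivative sin (\<sigma> s) / u s) (at s)"
    and "\<And>s. s \<in> {a<..<b} \<Longrightarrow> 0 < u s"
  obtains k where "\<And>s. s \<in> {a<..<b} \<Longrightarrow> sin (\<sigma> s) / u s = k"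
proof (cases "a < b")
  case True
  have "((\<lambda>s. sin (\<sigma> s) / u s) has_real_derivative 0) (at s)" if s: "s \<in> {a<..<b}" for s
  proof -
    have dS: "((\<lambda>s. sin (\<sigma> s)) has_real_derivative cos (\<sigma> s) * (sin (\<sigma> s) / u s)) (at s)"
      by (auto intro!: derivative_eq_intros assms(2)[OF s])
    show ?thesis
      by (rule DERIV_cong[OF DERIV_divide[OF dS assms(1)[OF s]]]) (use assms(3)[OF s] in auto)
  qed
  then have "sin (\<sigma> s) / u s = sin (\<sigma> ((a + b) / 2)) / u ((a + b) / 2)" if "s \<in> {a<..<b}" for s
    using DERIV_isconst3[OF True, of s "(a + b) / 2" "\<lambda>s. sin (\<sigma> s) / u s"] that True by (auto simp: field_simps)
  then show ?thesis using that by blast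
qed (use that in auto)

text \<open>Continuity of the normal gives \<open>sin \<sigma> = 0\<close> at both ends; the sign of \<open>cos \<sigma>\<close> follows
  from \<open>u \<ge> 0\<close>, as \<open>u\<close> must leave and re-enter the axis. So \<open>cos \<sigma> q\<close> runs from \<open>2\<close> to \<open>- 2\<close>.\<close>

lemma spinor_energy_arc:
  assumes arc: "arc_profile L u v" and ang: "arc_length_angle {0..L} u v \<sigma>"
    and M: "M = revolution ((\<lambda>s. (u s, v s)) ` {0..L})"
    and surf: "closed_surface M" and n: "unit_normal_field M n" and \<mu>: "area_measure M \<mu>"
  shows "integrable \<mu> (spinor_density M n)"
    and "set_integrable lborel {0..L} (bending_density u \<sigma>)"
    and "set_integrable lborel {0..L} (boundary_density u)"
    and "spinor_energy M n \<mu> = pi / 16 * (LINT s:{0..L}|lborel. bending_density u \<sigma> s)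
      - pi / 4 * (LINT s:{0..L}|lborel. boundary_density u s)"
    and "(LINT s:{0..L}|lborel. boundary_density u s) = - 4"
    and "(\<And>s. s \<in> {0<..<L} \<Longrightarrow> deriv \<sigma> s = sin (\<sigma> s) / u s) \<Longrightarrow> \<exists>c. \<forall>p\<in>M. mean_curvature M n p = c"
proof -
  have smooth: "smooth_surface M" and cpt: "compact M" using surf by (auto simp: closed_surface_def)
  interpret profile_piece 0 L u v \<sigma> M by (rule arc_profile_piece[OF arc ang M])
  interpret oriented_piece 0 L u v \<sigma> M n by unfold_locales (rule smooth n)+
  have u0: "u 0 = 0" "u L = 0" and L: "0 < L" using arc unfolding arc_profile_def by blast+
  have u_eq0: "s \<in> {0, L}" if "s \<in> {0..L}" "u s = 0" for s using u_pos[of s] that by force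
  have ends: "0 \<in> {0..L}" "L \<in> {0..L}" using L by auto
  obtain D where D: "\<And>s. s \<in> {0..L} \<Longrightarrow> (\<sigma> has_real_derivative D s) (at s within {0..L})" "continuous_on {0..L} D"
    using ang smooth_interval_derivative unfolding arc_length_angle_def by blast
  have du': "(u has_real_derivative cos (\<sigma> s)) (at s within {0..L})"
    and dv': "(v has_real_derivative sqrt (4 + (u s)\<^sup>2) / 2 * sin (\<sigma> s)) (at s within {0..L})" if "s \<in> {0..L}" for s
    using ang that unfolding arc_length_angle_def by blast+
  obtain \<epsilon> where \<epsilon>: "\<epsilon> = 1 \<or> \<epsilon> = -1"
    and neq: "\<And>s \<theta>. s \<in> {0<..<L} \<Longrightarrow> n (cylindrical (u s) \<theta> (v s)) = \<epsilon> *\<^sub>R revolution_normal \<theta> (u s) (\<sigma> s)"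
    using normal_sign by blast
  have sin_ends: "sin (\<sigma> 0) = 0" "sin (\<sigma> L) = 0"
    using normal_at_pole(2)[OF _ _ DERIV_continuous[OF D(1)] neq \<epsilon>, of 0] normal_at_pole(2)[OF _ _ DERIV_continuous[OF D(1)] neq \<epsilon>, of L]
      u0 ends by blast+
  have sin0: "sin (\<sigma> s) = 0" if "s \<in> {0..L}" "u s = 0" for s using u_eq0[OF that] sin_ends by auto
  have "cos (\<sigma> 0) = 1"
  proof -
    have "0 \<le> cos (\<sigma> 0)" by (rule DERIV_nonneg_left_endpoint[OF L du'[OF ends(1)] u0(1) u_nonneg])
    moreover have "\<bar>cos (\<sigma> 0)\<bar> = 1" using sin_ends(1) by (rule sin_zero_abs_cos_one)
    ultimately show ?thesis by simp
  qed
  have "cos (\<sigma> L) = - 1"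
  proof -
    have "cos (\<sigma> L) \<le> 0" by (rule DERIV_nonpos_right_endpoint[OF L du'[OF ends(2)] u0(2) u_nonneg])
    moreover have "\<bar>cos (\<sigma> L)\<bar> = 1" using sin_ends(2) by (rule sin_zero_abs_cos_one)
    ultimately show ?thesis by simp
  qed
  define P where "P = (\<lambda>e. cylindrical (u e) 0 (v e))"
  have P: "cylindrical (u e) \<theta> (v e) = P e" if "e \<in> {0, L}" for e \<theta> using that u0 by (auto simp: P_def cylindrical_def)
  have PM: "P e \<in> M" if "e \<in> {0, L}" for e unfolding P_def using that L by (intro Phi_mem) auto
  define Z where "Z = {P 0} \<union> {P L}"
  have Z: "Z \<in> null_sets \<mu>"
    unfolding Z_def using area_measure_null_point[OF \<mu> smooth] PM by (intro null_sets.Un) auto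
  have Zmem: "cylindrical (u e) \<theta> (v e) \<in> Z" if "e \<in> {0, L}" for e \<theta> using P[OF that] that by (auto simp: Z_def)
  have Mcover: "\<exists>s\<in>{0..L}. \<exists>\<theta>. p = cylindrical (u s) \<theta> (v s)" if "p \<in> M" for p
    using Phi_cover[OF that, of 0] by metis
  have meas: "spinor_density M n \<in> borel_measurable \<mu>"
  proof -
    let ?C = "{Phi ` chart_box 0, Phi ` chart_box pi, {P 0}, {P L}}"
    have "spinor_density M n \<in> borel_measurable (restrict_space borel M)"
    proof (rule measurable_on_cover)
      show "M \<subseteq> \<Union>?C"
      proof
        fix p assume "p \<in> M"
        then obtain s \<theta> where s: "s \<in> {0..L}" "p = cylindrical (u s) \<theta> (v s)" using Mcover by blast
        show "p \<in> \<Union>?C"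
        proof (cases "s \<in> {0, L}")
          case True
          then show ?thesis using P[OF True] s by auto
        next
          case False
          then have "s \<in> {0<..<L}" using s by auto
          then obtain x where "x \<in> chart_box 0 \<union> chart_box pi" "Phi x = p" using chart_coordinates[of s \<theta>] s by metis
          then show ?thesis by blast
        qed
      qed
      show "M \<in> sets borel" using cpt by (intro borel_closed compact_imp_closed)
      fix \<Omega> assume "\<Omega> \<in> ?C"
      then consider \<alpha> where "\<Omega> = Phi ` chart_box \<alpha>" | e where "e \<in> {0, L}" "\<Omega> = {P e}" by blast
      then show "\<Omega> \<subseteq> M \<and> \<Omega> \<in> sets borel \<and> continuous_on \<Omega> (spinor_density M n)"
      proof cases
        case 1
        then show ?thesis using chart_image_borel[OF cpt local_param_Phi] continuous_on_spinor_density by blast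
      next
        case 2
        then show ?thesis using PM by auto
      qed
    qed simp
    moreover have "sets \<mu> = sets (restrict_space borel M)" using \<mu> by (simp add: area_measure_def)
    ultimately show ?thesis using measurable_cong_sets by blast
  qed
  note energy = spinor_energy_formula[OF \<mu> Z Zmem meas D(1) du' D(2) sin0]
  show "integrable \<mu> (spinor_density M n)" by (rule energy(1))
  show "set_integrable lborel {0..L} (bending_density u \<sigma>)" by (rule energy(2))
  show "set_integrable lborel {0..L} (boundary_density u)" by (rule energy(3))
  show "spinor_energy M n \<mu> = pi / 16 * (LINT s:{0..L}|lborel. bending_density u \<sigma> s)
      - pi / 4 * (LINT s:{0..L}|lborel. boundary_density u s)" by (rule energy(4))
  have "sqrt (4 :: real) = 2" by (rule real_sqrt_unique) auto
  then have "cos (\<sigma> L) * sqrt (4 + (u L)\<^sup>2) - cos (\<sigma> 0) * sqrt (4 + (u 0)\<^sup>2) = - 4"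
    unfolding u0 \<open>cos (\<sigma> 0) = 1\<close> \<open>cos (\<sigma> L) = - 1\<close> by simp
  with energy(5) show "(LINT s:{0..L}|lborel. boundary_density u s) = - 4" by (rule trans)
  show "\<exists>c. \<forall>p\<in>M. mean_curvature M n p = c" if cmc: "\<And>s. s \<in> {0<..<L} \<Longrightarrow> deriv \<sigma> s = sin (\<sigma> s) / u s"
  proof -
    have ds: "(\<sigma> has_real_derivative sin (\<sigma> s) / u s) (at s)" if "s \<in> {0<..<L}" for s
      using deriv_\<sigma>[OF that] cmc[OF that] by simp
    obtain k where k: "\<And>s. s \<in> {0<..<L} \<Longrightarrow> sin (\<sigma> s) / u s = k"
      using angular_curvature_constant[OF du ds u_pos] by blast
    have at: "at s within {0..L} = at s" if "s \<in> {0<..<L}" for s using that by (simp add: at_within_Icc_at)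
    have Dk: "D s = k" if "s \<in> {0<..<L}" for s
      using DERIV_unique[OF ds[OF that]] D(1)[of s] at[OF that] k[OF that] that by auto
    have "D s = k" if "s \<in> {0..L}" for s
    proof (rule continuous_constant_on_closure[of "{0<..<L}" D])
      show "continuous_on (closure {0<..<L}) D" "s \<in> closure {0<..<L}" using D(2) L that by (simp_all add: closure_greaterThanLessThan)
    qed (rule Dk)
    then have Dends: "D 0 = k" "D L = k" using ends by auto
    have "mean_curvature M n p = \<epsilon> * k" if pM: "p \<in> M" for p
    proof -
      obtain s \<theta> where s: "s \<in> {0..L}" "p = cylindrical (u s) \<theta> (v s)" using Mcover[OF pM] by blast
      show ?thesis
      proof (cases "s \<in> {0, L}")
        case True
        then have "u s = 0" using u0 by auto
        then have "mean_curvature M n p = \<epsilon> * D s"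
          unfolding s(2) using True
          by (intro mean_curvature_at_pole[OF _ _ neq \<epsilon> du'[OF s(1)] dv'[OF s(1)] D(1)[OF s(1)]]) auto
        then show ?thesis using Dends True by auto
      next
        case False
        then have si: "s \<in> {0<..<L}" using s by auto
        have "mean_curvature M n p = \<epsilon> * (deriv \<sigma> s + sin (\<sigma> s) / u s) / 2"
          unfolding s(2) by (rule mean_curvature_interior[OF si \<epsilon> neq])
        also have "\<dots> = \<epsilon> * k" unfolding cmc[OF si] k[OF si] by simp
        finally show ?thesis .
      qed
    qed
    then show ?thesis by blast
  qed
qed

text \<open>The piece that starts at \<open>0\<close> has a seam, the orbit over its ends. A second piece, shifted by half a
  period, has charts around the seam; they show that it is a null set and that the density is
  measurable near it.\<close>

lemma spinor_energy_closed:
  assumes closed: "closed_profile L u v" and ang: "arc_length_angle UNIV u v \<sigma>"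
    and M: "M = revolution ((\<lambda>s. (u s, v s)) ` {0..L})"
    and surf: "closed_surface M" and n: "unit_normal_field M n" and \<mu>: "area_measure M \<mu>"
  shows "integrable \<mu> (spinor_density M n)"
    and "set_integrable lborel {0..L} (bending_density u \<sigma>)"
    and "set_integrable lborel {0..L} (boundary_density u)"
    and "spinor_energy M n \<mu> = pi / 16 * (LINT s:{0..L}|lborel. bending_density u \<sigma> s)
      - pi / 4 * (LINT s:{0..L}|lborel. boundary_density u s)"
    and "(LINT s:{0..L}|lborel. boundary_density u s) = 0"
    and "\<not> (\<forall>s\<in>{0<..<L}. deriv \<sigma> s = sin (\<sigma> s) / u s)"
proof -
  have smooth: "smooth_surface M" and cpt: "compact M" using surf by (auto simp: closed_surface_def)
  interpret A: profile_piece 0 L u v \<sigma> M using closed_profile_piece[OF closed ang M, of 0] by simp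
  interpret A: oriented_piece 0 L u v \<sigma> M n by unfold_locales (rule smooth n)+
  interpret B: profile_piece "- L / 2" "- L / 2 + L" u v \<sigma> M by (rule closed_profile_piece[OF closed ang M])
  interpret B: oriented_piece "- L / 2" "- L / 2 + L" u v \<sigma> M n by unfold_locales (rule smooth n)+
  have L: "0 < L" and per: "\<And>s. u (s + L) = u s" "\<And>s. v (s + L) = v s" and pos: "\<And>s. 0 < u s"
    using closed unfolding closed_profile_def by auto
  have uL: "u L = u 0" "v L = v 0" using per[of 0] by simp_all
  have du: "(u has_real_derivative cos (\<sigma> s)) (at s)"
    and dv: "(v has_real_derivative sqrt (4 + (u s)\<^sup>2) / 2 * sin (\<sigma> s)) (at s)" for s
    using ang unfolding arc_length_angle_def by auto
  obtain D where D: "\<And>s. (\<sigma> has_real_derivative D s) (at s)" "continuous_on UNIV D"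
    using ang smooth_interval_derivative[of UNIV \<sigma>] unfolding arc_length_angle_def by (metis UNIV_I)
  have mid: "0 \<in> {- L / 2<..<- L / 2 + L}" using L by auto
  define Z where "Z = B.Phi ` {x \<in> B.chart_box 0. x $ 1 = 0} \<union> B.Phi ` {x \<in> B.chart_box pi. x $ 1 = 0}"
  have Z: "Z \<in> null_sets \<mu>"
  proof -
    have "B.Phi ` {x \<in> B.chart_box \<alpha>. x $ 1 = 0} \<in> null_sets \<mu>" for \<alpha>
    proof (rule area_measure_null_image[OF \<mu> B.local_param_Phi[of \<alpha>]])
      show "{x \<in> B.chart_box \<alpha>. x $ 1 = 0} \<in> null_sets lborel"
        by (rule null_sets_subset[OF null_sets_coordinate_line[of 1 0]]) auto
    qed (rule Collect_restrict)
    then show ?thesis unfolding Z_def by (intro null_sets.Un)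
  qed
  have Z0: "cylindrical (u 0) \<theta> (v 0) \<in> Z" for \<theta>
  proof -
    obtain x where "x \<in> B.chart_box 0 \<union> B.chart_box pi" "x $ 1 = 0" "B.Phi x = cylindrical (u 0) \<theta> (v 0)"
      using B.chart_coordinates[OF mid] by metis
    then have "x \<in> {x \<in> B.chart_box 0. x $ 1 = 0} \<union> {x \<in> B.chart_box pi. x $ 1 = 0}" by simp
    then have "B.Phi x \<in> Z" unfolding Z_def by (simp only: image_Un[symmetric] imageI)
    then show ?thesis using \<open>B.Phi x = cylindrical (u 0) \<theta> (v 0)\<close> by simp
  qed
  have Zmem: "cylindrical (u e) \<theta> (v e) \<in> Z" if "e \<in> {0, L}" for e \<theta> using Z0 uL that by auto
  have meas: "spinor_density M n \<in> borel_measurable \<mu>"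
  proof -
    let ?C = "{A.Phi ` A.chart_box 0, A.Phi ` A.chart_box pi, B.Phi ` B.chart_box 0, B.Phi ` B.chart_box pi}"
    have "spinor_density M n \<in> borel_measurable (restrict_space borel M)"
    proof (rule measurable_on_cover)
      show "M \<subseteq> \<Union>?C"
      proof
        fix p assume "p \<in> M"
        then obtain s \<theta> where s: "s \<in> {0..L}" "p = cylindrical (u s) \<theta> (v s)" using A.Phi_cover[of p 0] by metis
        show "p \<in> \<Union>?C"
        proof (cases "s \<in> {0, L}")
          case True
          then have "p = cylindrical (u 0) \<theta> (v 0)" using s uL by auto
          then obtain x where "x \<in> B.chart_box 0 \<union> B.chart_box pi" "B.Phi x = p"
            using B.chart_coordinates[OF mid] by metis
          then show ?thesis by blast
        next
          case False
          then have "s \<in> {0<..<L}" using s by auto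
          then obtain x where "x \<in> A.chart_box 0 \<union> A.chart_box pi" "A.Phi x = p" using A.chart_coordinates[of s \<theta>] s by metis
          then show ?thesis by blast
        qed
      qed
      show "M \<in> sets borel" using cpt by (intro borel_closed compact_imp_closed)
      fix \<Omega> assume "\<Omega> \<in> ?C"
      then consider \<alpha> where "\<Omega> = A.Phi ` A.chart_box \<alpha>" | \<alpha> where "\<Omega> = B.Phi ` B.chart_box \<alpha>" by blast
      then show "\<Omega> \<subseteq> M \<and> \<Omega> \<in> sets borel \<and> continuous_on \<Omega> (spinor_density M n)"
      proof cases
        case 1
        then show ?thesis using chart_image_borel[OF cpt A.local_param_Phi] A.continuous_on_spinor_density by blast
      next
        case 2
        then show ?thesis using chart_image_borel[OF cpt B.local_param_Phi] B.continuous_on_spinor_density by blast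
      qed
    qed simp
    moreover have "sets \<mu> = sets (restrict_space borel M)" using \<mu> by (simp add: area_measure_def)
    ultimately show ?thesis using measurable_cong_sets by blast
  qed
  have sin0: "sin (\<sigma> s) = 0" if "u s = 0" for s using pos[of s] that by simp
  note energy = A.spinor_energy_formula[OF \<mu> Z Zmem meas has_field_derivative_at_within[OF D(1)]
      has_field_derivative_at_within[OF du] continuous_on_subset[OF D(2) subset_UNIV] sin0]
  show "integrable \<mu> (spinor_density M n)" by (rule energy(1))
  show "set_integrable lborel {0..L} (bending_density u \<sigma>)" by (rule energy(2))
  show "set_integrable lborel {0..L} (boundary_density u)" by (rule energy(3))
  show "spinor_energy M n \<mu> = pi / 16 * (LINT s:{0..L}|lborel. bending_density u \<sigma> s)
      - pi / 4 * (LINT s:{0..L}|lborel. boundary_density u s)" by (rule energy(4))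
  have "((\<lambda>s. u (s + L)) has_real_derivative cos (\<sigma> L)) (at 0)"
    using du[of L] DERIV_shift[of u "cos (\<sigma> L)" 0 L] by simp
  then have "cos (\<sigma> L) = cos (\<sigma> 0)" unfolding per using du[of 0] by (rule DERIV_unique)
  then have "cos (\<sigma> L) * sqrt (4 + (u L)\<^sup>2) - cos (\<sigma> 0) * sqrt (4 + (u 0)\<^sup>2) = 0"
    unfolding uL by simp
  with energy(5) show "(LINT s:{0..L}|lborel. boundary_density u s) = 0" by (rule trans)
  show "\<not> (\<forall>s\<in>{0<..<L}. deriv \<sigma> s = sin (\<sigma> s) / u s)"
  proof
    assume cmc: "\<forall>s\<in>{0<..<L}. deriv \<sigma> s = sin (\<sigma> s) / u s"
    have ds: "(\<sigma> has_real_derivative sin (\<sigma> s) / u s) (at s)" if "s \<in> {0<..<L}" for s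
      using A.deriv_\<sigma>[OF that] cmc that by simp
    obtain k where k: "\<And>s. s \<in> {0<..<L} \<Longrightarrow> sin (\<sigma> s) / u s = k"
      using angular_curvature_constant[OF du ds pos] by blast
    (* v takes equal values at 0 and L, so sin vanishes somewhere; the same for u and cos below *)
    obtain z where z: "0 < z" "z < L" "v L - v 0 = (L - 0) * (sqrt (4 + (u z)\<^sup>2) / 2 * sin (\<sigma> z))"
      using MVT2[OF L, of v "\<lambda>s. sqrt (4 + (u s)\<^sup>2) / 2 * sin (\<sigma> s)"] dv by blast
    moreover have "sqrt (4 + (u z)\<^sup>2) > 0" by (simp add: add_pos_nonneg)
    ultimately have "sin (\<sigma> z) = 0" using L uL by simp
    then have "k = 0" using k[of z] z by simp
    obtain y where y: "0 < y" "y < L" "u L - u 0 = (L - 0) * cos (\<sigma> y)"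
      using MVT2[OF L, of u "\<lambda>s. cos (\<sigma> s)"] du by blast
    then have "cos (\<sigma> y) = 0" using L uL by simp
    moreover have "sin (\<sigma> y) = 0" using k[of y] y pos[of y] \<open>k = 0\<close> by simp
    ultimately show False using sin_cos_squared_add[of "\<sigma> y"] by simp
  qed
qed

theorem theorem2:
  fixes L :: real and u v \<sigma> :: "real \<Rightarrow> real"
    and M :: "nil set" and n :: "nil \<Rightarrow> real^3" and \<mu> :: "nil measure"
  assumes "profile_curve L u v \<sigma>"
    and "M = revolution ((\<lambda>s. (u s, v s)) ` {0..L})"
    and "closed_surface M"
    and "unit_normal_field M n"
    and "area_measure M \<mu>"
  shows "integrable \<mu> (spinor_density M n) \<and>
    set_integrable lborel {0..L} (bending_density u \<sigma>) \<and>
    set_integrable lborel {0..L} (boundary_density u) \<and>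
    spinor_energy M n \<mu> =
      pi / 16 * (LINT s:{0..L}|lborel. bending_density u \<sigma> s)
      - pi / 4 * (LINT s:{0..L}|lborel. boundary_density u s) \<and>
    spinor_energy M n \<mu> =
      pi / 16 * (LINT s:{0..L}|lborel. bending_density u \<sigma> s)
      + pi * of_int (euler_char (top_of_set M)) / 2 \<and>
    ((\<forall>s\<in>{0..L}. 0 < u s \<longrightarrow> deriv \<sigma> s = sin (\<sigma> s) / u s) \<longrightarrow>
      M homeomorphic (sphere 0 1 :: (real^3) set) \<and>
      (\<exists>c. \<forall>p\<in>M. mean_curvature M n p = c))"
proof -
  consider (closed) "closed_profile L u v" "arc_length_angle UNIV u v \<sigma>"
    | (arc) "arc_profile L u v" "arc_length_angle {0..L} u v \<sigma>"
    using assms(1) unfolding profile_curve_def by blast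
  then show ?thesis
  proof cases
    case closed
    have "top_of_set M homeomorphic_space top_of_set (circle \<times> circle)"
      using closed_revolution_homeomorphic_torus[OF closed assms(2)] by simp
    then have \<chi>: "euler_char (top_of_set M) = 0" by (rule euler_char_torus)
    note E = spinor_energy_closed[OF closed assms(2-5)]
    have "\<not> (\<forall>s\<in>{0..L}. 0 < u s \<longrightarrow> deriv \<sigma> s = sin (\<sigma> s) / u s)"
    proof
      assume H: "\<forall>s\<in>{0..L}. 0 < u s \<longrightarrow> deriv \<sigma> s = sin (\<sigma> s) / u s"
      have "0 < u s" for s using closed(1) unfolding closed_profile_def by blast
      with H have "\<forall>s\<in>{0<..<L}. deriv \<sigma> s = sin (\<sigma> s) / u s" by simp
      with E(6) show False by contradiction
    qed
    moreover have "spinor_energy M n \<mu> = pi / 16 * (LINT s:{0..L}|lborel. bending_density u \<sigma> s)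
        + pi * of_int (euler_char (top_of_set M)) / 2"
      using E(4) E(5) \<chi> by simp
    ultimately show ?thesis using E(1-4) by blast
  next
    case arc
    have hom: "M homeomorphic (sphere 0 1 :: (real^3) set)"
      by (rule arc_revolution_homeomorphic_sphere[OF arc assms(2)])
    then have "top_of_set M homeomorphic_space top_of_set (sphere 0 1 :: (real^3) set)" by simp
    then have \<chi>: "euler_char (top_of_set M) = 2" by (rule euler_char_sphere)
    note E = spinor_energy_arc[OF arc assms(2-5)]
    have "spinor_energy M n \<mu> = pi / 16 * (LINT s:{0..L}|lborel. bending_density u \<sigma> s)
        + pi * of_int (euler_char (top_of_set M)) / 2"
      using E(4) E(5) \<chi> by simp
    moreover have "\<exists>c. \<forall>p\<in>M. mean_curvature M n p = c"
      if H: "\<forall>s\<in>{0..L}. 0 < u s \<longrightarrow> deriv \<sigma> s = sin (\<sigma> s) / u s"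
    proof (rule E(6))
      fix s assume s: "s \<in> {0<..<L}"
      then have "0 < u s" using arc(1) unfolding arc_profile_def by simp
      then show "deriv \<sigma> s = sin (\<sigma> s) / u s" using H s by simp
    qed
    ultimately show ?thesis using E(1-4) hom by blast
  qed
qed

end
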